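(* Let $\boldsymbol X_a=(X_1^{(a)},\dots,X_r^{(a)})$, $a=1,\dots,n$, be i.i.d. from $\mu=\mu_1\otimes\cdots\otimes\mu_r$, where each $\mu_i$ is a Lebesgue absolutely continuous distribution on $\mathbb R^{d_i}$. Suppose that for every $1\le i\le r$ the empirical distribution of the grid $\mathcal H_n^{d_i}=\{h_1^{d_i},\dots,h_n^{d_i}\}\subset[0,1]^{d_i}$ converges weakly to $\mathrm{Unif}([0,1]^{d_i})$ as $n\to\infty$. Let $\mathcal T=\{S\subseteq\{1,\dots,r\}:|S|\ge2\}$. Then, as $n\to\infty$, jointly in distribution, $$\{n\,\mathrm{RdCov}_n^2(\boldsymbol X_S):S\in\mathcal T\}\xrightarrow{D}\left\{\int_{\mathbb R^{d_S}}|Z_S(\boldsymbol t)|^2\prod_{i\in S}\mathrm dw_i\right\}_{S\in\mathcal T},$$ with $\{Z_S\}_{S\in\mathcal T}$ the Gaussian processes defined in the context. Consequently, for any vector of non-negative weights $\boldsymbol C=(C_2,\dots,C_r)$, $$n\,\mathrm{RJdCov}_n^2(\boldsymbol X;\boldsymbol C)\xrightarrow{D}\sum_{s=2}^rC_s\sum_{S\subseteq\{1,\dots,r\},\,|S|=s}\int_{\mathbb R^{d_S}}|Z_S(\boldsymbol t)|^2\prod_{i\in S}\mathrm dw_i.$$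
   Context: The empirical rank map is $\hat R_i(X_i^{(a)})=h^{d_i}_{\hat\sigma_i(a)}$, where $\hat\sigma_i$ minimizes $\sum_{a=1}^n\|X_i^{(a)}-h^{d_i}_{\sigma(a)}\|^2$ over all permutations $\sigma$ of $\{1,\dots,n\}$. Put $\mathrm dw_i=\dfrac{\mathrm dt_i}{c_{d_i}\|t_i\|^{1+d_i}}$ with $c_d=\pi^{(1+d)/2}/\Gamma((1+d)/2)$, $d_S=\sum_{i\in S}d_i$, $\iota=\sqrt{-1}$. For $S\in\mathcal T$, $$\mathrm{RdCov}_n^2(\boldsymbol X_S)=\int_{\mathbb R^{d_S}}\left|\frac1n\sum_{b=1}^n\prod_{i\in S}\left(\frac1n\sum_{a=1}^ne^{\iota\langle t_i,\hat R_i(X_i^{(a)})\rangle}-e^{\iota\langle t_i,\hat R_i(X_i^{(b)})\rangle}\right)\right|^2\prod_{i\in S}\mathrm dw_i,$$ and $\mathrm{RJdCov}_n^2(\boldsymbol X;\boldsymbol C)=\sum_{s=2}^rC_s\sum_{S\subseteq\{1,\dots,r\},\,|S|=s}\mathrm{RdCov}_n^2(\boldsymbol X_S)$. $\{Z_S\}_{S\in\mathcal T}$ is a collection of mutually independent complex-valued Gaussian processes; for each $S\in\mathcal T$, $Z_S=\{Z_S(\boldsymbol t):\boldsymbol t\in\mathbb R^{d_S}\}$ is a complex-valued Gaussian process with zero mean and covariance function $$C_S(\boldsymbol t,\boldsymbol t')=\mathrm{Cov}[Z_S(\boldsymbol t),Z_S(\boldsymbol t')]=\prod_{i\in S}\left(\mathbb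 E[e^{\iota\langle t_i-t_i',U_i\rangle}]-\mathbb E[e^{\iota\langle t_i,U_i\rangle}]\,\mathbb E[e^{\iota\langle-t_i',U_i\rangle}]\right),$$ where the covariance of zero-mean complex variables is $\mathrm{Cov}[Z,W]=\mathbb E[Z\overline W]$, $\boldsymbol t=(t_i)_{i\in S}$, $\boldsymbol t'=(t_i')_{i\in S}$, $t_i,t_i'\in\mathbb R^{d_i}$, and $U_1,\dots,U_r$ are independent with $U_i\sim\mathrm{Unif}([0,1]^{d_i})$.
   Formalization: The limit processes are additionally required to satisfy E[Z_S(t)Z_S(t')] = C_S(t,-t') (i.e. Z_S(-t) is the conjugate of Z_S(t)), since the covariance alone does not fix the limit law, and to be jointly measurable in t and the sample point. *)

theory Defs
  imports "HOL-Probability.Probability" "HOL-Combinatorics.Permutations"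
begin

section \<open>Euclidean spaces of varying dimension\<close>

text \<open>
  The dimensions \<open>d i\<close> depend on \<open>i\<close>, so a point of \<open>\<real>\<^sup>d\<close> is a function on \<open>{..<d}\<close>, extended by
  \<open>undefined\<close>; a point of the product of the \<open>\<real>\<^bsup>d i\<^esup>\<close>, \<open>i \<in> S\<close>,
  is a family indexed by \<open>S\<close> of such points.
\<close>

definition eucl :: "nat \<Rightarrow> (nat \<Rightarrow> real) measure" where
  "eucl d = PiM {..<d} (\<lambda>_. lborel)"

definition ip :: "nat \<Rightarrow> (nat \<Rightarrow> real) \<Rightarrow> (nat \<Rightarrow> real) \<Rightarrow> real" where
  "ip d x y = (\<Sum>k<d. x k * y k)"

definition enorm :: "nat \<Rightarrow> (nat \<Rightarrow> real) \<Rightarrow> real" where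
  "enorm d x = L2_set x {..<d}"

definition eucl_prod :: "(nat \<Rightarrow> nat) \<Rightarrow> nat set \<Rightarrow> (nat \<Rightarrow> nat \<Rightarrow> real) measure" where
  "eucl_prod d S = PiM S (\<lambda>i. eucl (d i))"

definition unif_cube :: "nat \<Rightarrow> (nat \<Rightarrow> real) measure" where
  "unif_cube d = uniform_measure (eucl d) (PiE {..<d} (\<lambda>_. {0..1}))"


section \<open>Weak convergence in finite-dimensional coordinate spaces\<close>

text \<open>
  Continuity refers to the product topology on functions; on the extensional functions over a
  finite set \<open>I\<close> this is the Euclidean topology of \<open>\<real>\<^sup>I\<close>.
\<close>

definition weak_conv_on ::
  "'i set \<Rightarrow> (nat \<Rightarrow> ('i \<Rightarrow> real) measure) \<Rightarrow> ('i \<Rightarrow> real) measure \<Rightarrow> bool" where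
  "weak_conv_on I P Q \<longleftrightarrow>
     (\<forall>f :: ('i \<Rightarrow> real) \<Rightarrow> real.
        continuous_on (PiE I (\<lambda>_. UNIV)) f \<and> bounded (f ` PiE I (\<lambda>_. UNIV)) \<longrightarrow>
        (\<lambda>n. \<integral>x. f x \<partial>P n) \<longlonglongrightarrow> (\<integral>x. f x \<partial>Q))"

definition converges_in_distribution ::
  "'i set \<Rightarrow> (nat \<Rightarrow> 'w measure) \<Rightarrow> (nat \<Rightarrow> 'w \<Rightarrow> 'i \<Rightarrow> real) \<Rightarrow>
   'v measure \<Rightarrow> ('v \<Rightarrow> 'i \<Rightarrow> real) \<Rightarrow> bool" where
  "converges_in_distribution I M V N W \<longleftrightarrow>
     (\<forall>n. V n \<in> measurable (M n) (PiM I (\<lambda>_. borel))) \<and>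
     W \<in> measurable N (PiM I (\<lambda>_. borel)) \<and>
     weak_conv_on I (\<lambda>n. distr (M n) (PiM I (\<lambda>_. borel)) (V n)) (distr N (PiM I (\<lambda>_. borel)) W)"

text \<open>Counted with multiplicity: the points \<open>h 1, \<dots>, h n\<close> need not be distinct.\<close>

definition empirical :: "nat \<Rightarrow> nat \<Rightarrow> (nat \<Rightarrow> nat \<Rightarrow> real) \<Rightarrow> (nat \<Rightarrow> real) measure" where
  "empirical d n h = distr (uniform_count_measure {1..n}) (eucl d) h"


section \<open>Empirical ranks and rank distance covariance\<close>

text \<open>
  Optimal permutations need not be unique; \<open>arg_min\<close> then selects one of them, depending only on
  the set of minimizers. For absolutely continuous data the ranks \<open>emp_rank n d h x a\<close> do not
  depend on this selection, almost surely.
\<close>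

definition opt_perm ::
  "nat \<Rightarrow> nat \<Rightarrow> (nat \<Rightarrow> nat \<Rightarrow> real) \<Rightarrow> (nat \<Rightarrow> nat \<Rightarrow> real) \<Rightarrow> nat \<Rightarrow> nat" where
  "opt_perm n d h x =
     arg_min (\<lambda>\<sigma>. \<Sum>a=1..n. (enorm d (\<lambda>k. x a k - h (\<sigma> a) k))\<^sup>2) (\<lambda>\<sigma>. \<sigma> permutes {1..n})"

definition emp_rank ::
  "nat \<Rightarrow> nat \<Rightarrow> (nat \<Rightarrow> nat \<Rightarrow> real) \<Rightarrow> (nat \<Rightarrow> nat \<Rightarrow> real) \<Rightarrow> nat \<Rightarrow> nat \<Rightarrow> real" where
  "emp_rank n d h x a = h (opt_perm n d h x a)"

definition c_const :: "nat \<Rightarrow> real" where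
  "c_const d = pi powr ((1 + real d) / 2) / Gamma ((1 + real d) / 2)"

definition w_meas :: "nat \<Rightarrow> (nat \<Rightarrow> real) measure" where
  "w_meas d = density (eucl d) (\<lambda>t. ennreal (1 / (c_const d * enorm d t ^ (1 + d))))"

definition w_prod :: "(nat \<Rightarrow> nat) \<Rightarrow> nat set \<Rightarrow> (nat \<Rightarrow> nat \<Rightarrow> real) measure" where
  "w_prod d S = PiM S (\<lambda>i. w_meas (d i))"

text \<open>In the next two definitions, \<open>R i a\<close> is the rank of the \<open>a\<close>-th observation of component \<open>i\<close>.\<close>

definition RdCov2 ::
  "nat \<Rightarrow> (nat \<Rightarrow> nat) \<Rightarrow> (nat \<Rightarrow> nat \<Rightarrow> nat \<Rightarrow> real) \<Rightarrow> nat set \<Rightarrow> real" where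
  "RdCov2 n d R S =
     (\<integral>t. (cmod ((1 / of_nat n) * (\<Sum>b=1..n. \<Prod>i\<in>S.
              ((1 / of_nat n) * (\<Sum>a=1..n. iexp (ip (d i) (t i) (R i a)))
                 - iexp (ip (d i) (t i) (R i b))))))\<^sup>2
       \<partial>w_prod d S)"

definition RJdCov2 ::
  "nat \<Rightarrow> nat \<Rightarrow> (nat \<Rightarrow> nat) \<Rightarrow> (nat \<Rightarrow> real) \<Rightarrow> (nat \<Rightarrow> nat \<Rightarrow> nat \<Rightarrow> real) \<Rightarrow> real" where
  "RJdCov2 n r d C R =
     (\<Sum>s=2..r. C s * (\<Sum>S\<in>{S. S \<subseteq> {1..r} \<and> card S = s}. RdCov2 n d R S))"


section \<open>Gaussian processes\<close>

definition gaussian_rv :: "'v measure \<Rightarrow> ('v \<Rightarrow> real) \<Rightarrow> bool" where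
  "gaussian_rv N V \<longleftrightarrow> V \<in> borel_measurable N \<and>
     (\<exists>m. distr N borel V = return borel m \<or>
          (\<exists>s>0. distr N borel V = density lborel (\<lambda>x. ennreal (normal_density m s x))))"

text \<open>
  Real parts of complex linear combinations are exactly the real linear combinations of the real
  and imaginary parts, so this is joint Gaussianity of all \<open>Re (Z t)\<close> and \<open>Im (Z t)\<close>.
\<close>

definition complex_gaussian_process ::
  "'v measure \<Rightarrow> 't set \<Rightarrow> ('t \<Rightarrow> 'v \<Rightarrow> complex) \<Rightarrow> bool" where
  "complex_gaussian_process N I Z \<longleftrightarrow>
     (\<forall>t\<in>I. Z t \<in> borel_measurable N) \<and>
     (\<forall>F c. finite F \<and> F \<subseteq> I \<longrightarrow> gaussian_rv N (\<lambda>\<omega>. Re (\<Sum>t\<in>F. c t * Z t \<omega>)))"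

text \<open>\<open>unif_char d t\<close> is \<open>E[exp(\<i>\<langle>t,U\<rangle>)]\<close> for \<open>U\<close> uniform on \<open>[0,1]\<^sup>d\<close>.\<close>

definition unif_char :: "nat \<Rightarrow> (nat \<Rightarrow> real) \<Rightarrow> complex" where
  "unif_char d t = (\<integral>u. iexp (ip d t u) \<partial>unif_cube d)"

definition C_cov ::
  "(nat \<Rightarrow> nat) \<Rightarrow> nat set \<Rightarrow> (nat \<Rightarrow> nat \<Rightarrow> real) \<Rightarrow> (nat \<Rightarrow> nat \<Rightarrow> real) \<Rightarrow> complex" where
  "C_cov d S t t' =
     (\<Prod>i\<in>S. unif_char (d i) (\<lambda>k. t i k - t' i k)
             - unif_char (d i) (t i) * unif_char (d i) (\<lambda>k. - t' i k))"

text \<open>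
  The covariance \<open>E[Z(t) cnj(Z(t'))]\<close> alone does not determine the law of a complex Gaussian
  process; the relation function \<open>E[Z(t) Z(t')]\<close> is needed as well. It is \<open>C_cov d S t (-t')\<close>,
  equivalently \<open>Z(-t) = cnj(Z(t))\<close> almost surely for each \<open>t\<close>; the empirical process inside the
  modulus in \<open>RdCov2\<close>, which converges to \<open>Z\<close> after scaling, has this symmetry. Joint
  measurability makes the integral of the squared modulus of a path a random variable.
\<close>

definition limit_process ::
  "'v measure \<Rightarrow> (nat \<Rightarrow> nat) \<Rightarrow> nat set \<Rightarrow> ((nat \<Rightarrow> nat \<Rightarrow> real) \<Rightarrow> 'v \<Rightarrow> complex) \<Rightarrow> bool" where
  "limit_process N d S Z \<longleftrightarrow>
     (\<lambda>(t, \<omega>). Z t \<omega>) \<in> borel_measurable (eucl_prod d S \<Otimes>\<^sub>M N) \<and>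
     complex_gaussian_process N (space (eucl_prod d S)) Z \<and>
     (\<forall>t\<in>space (eucl_prod d S). (\<integral>\<omega>. Z t \<omega> \<partial>N) = 0) \<and>
     (\<forall>t\<in>space (eucl_prod d S). \<forall>t'\<in>space (eucl_prod d S).
        (\<integral>\<omega>. Z t \<omega> * cnj (Z t' \<omega>) \<partial>N) = C_cov d S t t' \<and>
        (\<integral>\<omega>. Z t \<omega> * Z t' \<omega> \<partial>N) = C_cov d S t (\<lambda>i k. - t' i k))"

definition limit_integral ::
  "(nat \<Rightarrow> nat) \<Rightarrow> nat set \<Rightarrow> ((nat \<Rightarrow> nat \<Rightarrow> real) \<Rightarrow> 'v \<Rightarrow> complex) \<Rightarrow> 'v \<Rightarrow> real" where
  "limit_integral d S Z \<omega> = (\<integral>t. (cmod (Z t \<omega>))\<^sup>2 \<partial>w_prod d S)"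

end

theory Submission
  imports Defs
begin

text \<open>
  Almost surely the ranks are determined by the data, and relabelling the observations of one
  component relabels its ranks; hence the rank vectors are independent uniformly random
  arrangements of the grids, and only independent uniform permutations matter.

  For finite-dimensional distributions, the permutations are revealed one position at a time. The mean of
  a product of at least two centred functions over \<open>m\<close> remaining positions is \<open>O(1 / m)\<close>, so the total
  drift is \<open>O(ln n / sqrt n)\<close>, while the conditional variances are almost constant:
  characteristic functions of linear functionals converge to Gaussian ones.

  The integrals are approximated by Riemann sums, uniformly in \<open>n\<close>, through second moments.
  Averaging characteristic functions over Gaussian coefficients gives the joint Laplace transform of
  the Riemann sums, and for tight nonnegative vectors Laplace transforms determine weak convergence.
\<close>

section \<open>Averages over random permutations\<close>

text \<open>Everything hinges on \<open>S\<close> having at least two elements. For one component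
  the sum of a centred function over all positions of a permutation vanishes identically; with
  several independent permutations each block mean is of order \<open>1 / sqrt m\<close>, their
  product of order \<open>1 / m\<close>, and the harmonic sum grows only like \<open>ln n\<close>.
  The permutations thus act like independent draws from the grids, and the processes for different
  \<open>S\<close> decouple, because a centred factor then occurs in only one of two multiplied
  products. The weights have infinite mass near frequencies with a vanishing block. This is
  compensated by second moments bounded by a product of \<open>min 1 (|t i|^2)\<close>, which is
  integrable; the bounds for the limit process are inherited from the empirical ones as the
  covariances converge. Averaging over Gaussian coefficients asks only for pointwise convergence of
  characteristic functions, so no tightness in a function space enters; the bounded means of the
  integrals suffice. Grid points may repeat, so the ranks are almost surely determined while the
  optimal permutations need not be.\<close>

definition avg :: "'a set \<Rightarrow> ('a \<Rightarrow> 'b::real_normed_field) \<Rightarrow> 'b" where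
  "avg A f = (\<Sum>x\<in>A. f x) / of_nat (card A)"

lemma avg_cong: "(\<And>x. x \<in> A \<Longrightarrow> f x = g x) \<Longrightarrow> avg A f = avg A g"
  by (simp add: avg_def)

lemma avg_add: "avg A (\<lambda>x. f x + g x) = avg A f + avg A g"
  by (simp add: avg_def sum.distrib add_divide_distrib)

lemma avg_diff: "avg A (\<lambda>x. f x - g x) = avg A f - avg A g"
  by (simp add: avg_def sum_subtractf diff_divide_distrib)

lemma avg_minus: "avg A (\<lambda>x. - f x) = - avg A f"
  by (simp add: avg_def sum_negf)

lemma avg_cmult: "avg A (\<lambda>x. c * f x) = c * avg A f"
  by (simp add: avg_def sum_distrib_left)

lemma avg_cmult_right: "avg A (\<lambda>x. f x * c) = avg A f * c"
  by (simp add: avg_def sum_distrib_right)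

lemma avg_divide: "avg A (\<lambda>x. f x / c) = avg A f / c"
  by (simp add: avg_def mult.commute flip: sum_divide_distrib)

lemma avg_sum: "avg A (\<lambda>x. \<Sum>p\<in>P. f p x) = (\<Sum>p\<in>P. avg A (f p))"
  by (simp add: avg_def sum.swap[of _ P A] sum_divide_distrib)

lemma avg_const: "finite A \<Longrightarrow> A \<noteq> {} \<Longrightarrow> avg A (\<lambda>_. c) = c"
  by (simp add: avg_def)

lemma avg_swap: "avg A (\<lambda>x. avg B (f x)) = avg B (\<lambda>y. avg A (\<lambda>x. f x y))"
  by (simp add: avg_def sum.swap[of _ B A] flip: sum_divide_distrib)

lemma avg_bij: "bij_betw t A B \<Longrightarrow> avg B f = avg A (\<lambda>x. f (t x))"
  by (simp add: avg_def sum.reindex_bij_betw bij_betw_same_card)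

lemma norm_avg_le: "norm (avg A f) \<le> avg A (\<lambda>x. norm (f x))"
  by (simp add: avg_def norm_divide divide_right_mono norm_sum)

lemma avg_mono: "(\<And>x. x \<in> A \<Longrightarrow> f x \<le> g x) \<Longrightarrow> avg A f \<le> (avg A g :: real)"
  by (simp add: avg_def divide_right_mono sum_mono)

lemma avg_le_const:
  "finite A \<Longrightarrow> A \<noteq> {} \<Longrightarrow> (\<And>x. x \<in> A \<Longrightarrow> f x \<le> c) \<Longrightarrow> avg A f \<le> (c :: real)"
  using avg_mono[of A f "\<lambda>_. c"] by (simp add: avg_const)

lemma avg_nonneg: "(\<And>x. x \<in> A \<Longrightarrow> 0 \<le> f x) \<Longrightarrow> 0 \<le> (avg A f :: real)"
  by (simp add: avg_def sum_nonneg)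

lemma avg_of_real: "avg A (\<lambda>x. of_real (f x)) = of_real (avg A f)"
  by (simp add: avg_def)

lemma Re_avg: "Re (avg A f) = avg A (\<lambda>x. Re (f x))"
  by (simp add: avg_def Re_divide_of_nat)

lemma Im_avg: "Im (avg A f) = avg A (\<lambda>x. Im (f x))"
  by (simp add: avg_def Im_divide_of_nat)

lemma cnj_avg: "cnj (avg A f) = avg A (\<lambda>x. cnj (f x))"
  by (simp add: avg_def)

lemma norm_avg_le_const:
  "finite A \<Longrightarrow> A \<noteq> {} \<Longrightarrow> (\<And>x. x \<in> A \<Longrightarrow> norm (f x) \<le> c) \<Longrightarrow> norm (avg A f) \<le> c"
  by (rule order_trans[OF norm_avg_le avg_le_const])

lemma avg_power2_le: "(avg A f)\<^sup>2 \<le> avg A (\<lambda>x. (f x)\<^sup>2 :: real)"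
proof (cases "card A = 0")
  case False
  have "(\<Sum>x\<in>A. f x)\<^sup>2 \<le> (\<Sum>x\<in>A. (f x)\<^sup>2) * card A"
    by (rule sum_squared_le_sum_of_squares)
  with False show ?thesis
    by (simp add: avg_def power_divide field_simps power2_eq_square)
qed (simp add: avg_def)

lemma avg_PiE_prod:
  assumes "finite I" "\<And>i. i \<in> I \<Longrightarrow> finite (A i)"
  shows "avg (PiE I A) (\<lambda>x. \<Prod>i\<in>I. f i (x i)) = (\<Prod>i\<in>I. avg (A i) (f i))"
  using assms by (simp add: avg_def prod_sum_PiE card_PiE prod_dividef)

text \<open>Independence of the components: coordinates outside \<open>S\<close> carry the constant
  factor 1, whose average is 1 because each \<open>A i\<close> is nonempty.\<close>

lemma avg_PiE_prod_subset:
  assumes "finite I" "\<And>i. i \<in> I \<Longrightarrow> finite (A i)" "\<And>i. i \<in> I \<Longrightarrow> A i \<noteq> {}" "S \<subseteq> I"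
  shows "avg (PiE I A) (\<lambda>x. \<Prod>i\<in>S. f i (x i)) = (\<Prod>i\<in>S. avg (A i) (f i))"
proof -
  have restr: "(\<Prod>i\<in>S. F i) = (\<Prod>i\<in>I. if i \<in> S then F i else 1)" for F :: "'a \<Rightarrow> 'c"
    using prod.inter_restrict[OF assms(1), of F S] assms(4) by (simp add: Int_absorb1)
  have "avg (PiE I A) (\<lambda>x. \<Prod>i\<in>S. f i (x i))
      = avg (PiE I A) (\<lambda>x. \<Prod>i\<in>I. (\<lambda>y. if i \<in> S then f i y else 1) (x i))"
    by (simp add: restr)
  also have "\<dots> = (\<Prod>i\<in>I. avg (A i) (\<lambda>y. if i \<in> S then f i y else 1))"
    using assms by (intro avg_PiE_prod) auto
  also have "\<dots> = (\<Prod>i\<in>I. if i \<in> S then avg (A i) (f i) else 1)"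
    using assms by (intro prod.cong refl) (auto simp: avg_const)
  finally show ?thesis by (simp add: restr)
qed

section \<open>Uniform permutations and sampling without replacement\<close>

definition perms :: "nat \<Rightarrow> (nat \<Rightarrow> nat) set" where
  "perms n = {p. p permutes {1..n}}"

text \<open>Extensional outside \<open>I\<close>, so that the set is finite for finite
  \<open>I\<close> and averages over it factorize by \<open>avg_PiE_prod\<close>.\<close>

definition perm_tuples :: "'i set \<Rightarrow> nat \<Rightarrow> ('i \<Rightarrow> nat \<Rightarrow> nat) set" where
  "perm_tuples I n = PiE I (\<lambda>_. perms n)"

lemma finite_perms [simp]: "finite (perms n)"
  by (simp add: perms_def finite_permutations)

lemma id_in_perms: "id \<in> perms n"
  by (simp add: perms_def permutes_id)

lemma perms_nonempty [simp]: "perms n \<noteq> {}"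
  using id_in_perms by blast

lemma finite_perm_tuples [simp]: "finite I \<Longrightarrow> finite (perm_tuples I n)"
  by (simp add: perm_tuples_def finite_PiE)

lemma perm_tuples_nonempty [simp]: "perm_tuples I n \<noteq> {}"
  by (simp add: perm_tuples_def PiE_eq_empty_iff)

lemma perms_in: "p \<in> perms n \<Longrightarrow> c \<in> {1..n} \<Longrightarrow> p c \<in> {1..n}"
  unfolding perms_def using permutes_in_image by fastforce

lemma perm_tuples_in:
  "\<pi> \<in> perm_tuples I n \<Longrightarrow> i \<in> I \<Longrightarrow> c \<in> {1..n} \<Longrightarrow> \<pi> i c \<in> {1..n}"
  unfolding perm_tuples_def using PiE_mem perms_in by fast

lemma transpose_in_perms: "a \<in> {1..n} \<Longrightarrow> b \<in> {1..n} \<Longrightarrow> Transposition.transpose a b \<in> perms n"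
  by (simp add: perms_def permutes_swap_id)

text \<open>Composition on the right relabels positions, composition on the left (next lemma)
  relabels values. The first invariance of the uniform law drives all exchange arguments, the second
  the final averaging over the ranks.\<close>

lemma bij_betw_perms_comp:
  assumes "t \<in> perms n" shows "bij_betw (\<lambda>p. p \<circ> t) (perms n) (perms n)"
proof (rule bij_betw_byWitness[where f' = "\<lambda>p. p \<circ> inv t"])
  have t: "t permutes {1..n}" using assms by (simp add: perms_def)
  show "\<forall>p\<in>perms n. p \<circ> t \<circ> inv t = p" "\<forall>p\<in>perms n. p \<circ> inv t \<circ> t = p"
    by (auto simp: o_assoc[symmetric] permutes_inv_o[OF t])
  show "(\<lambda>p. p \<circ> t) ` perms n \<subseteq> perms n" "(\<lambda>p. p \<circ> inv t) ` perms n \<subseteq> perms n"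
    using t by (auto simp: perms_def intro: permutes_compose permutes_inv)
qed

lemma bij_betw_perms_comp_left:
  assumes "t \<in> perms n" shows "bij_betw (\<lambda>p. t \<circ> p) (perms n) (perms n)"
proof (rule bij_betw_byWitness[where f' = "\<lambda>p. inv t \<circ> p"])
  have t: "t permutes {1..n}" using assms by (simp add: perms_def)
  show "\<forall>p\<in>perms n. inv t \<circ> (t \<circ> p) = p" "\<forall>p\<in>perms n. t \<circ> (inv t \<circ> p) = p"
    by (auto simp: o_assoc permutes_inv_o[OF t])
  show "(\<lambda>p. t \<circ> p) ` perms n \<subseteq> perms n" "(\<lambda>p. inv t \<circ> p) ` perms n \<subseteq> perms n"
    using t by (auto simp: perms_def intro: permutes_compose permutes_inv)
qed

lemma bij_betw_PiE_map:
  assumes "\<And>i. i \<in> I \<Longrightarrow> bij_betw (t i) (A i) (B i)"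
  shows "bij_betw (\<lambda>x. \<lambda>i\<in>I. t i (x i)) (PiE I A) (PiE I B)"
proof (rule bij_betw_byWitness[where f' = "\<lambda>y. \<lambda>i\<in>I. inv_into (A i) (t i) (y i)"])
  have inj: "inj_on (t i) (A i)" and im: "t i ` A i = B i" if "i \<in> I" for i
    using assms[OF that] by (auto simp: bij_betw_def)
  show "\<forall>x\<in>PiE I A. (\<lambda>i\<in>I. inv_into (A i) (t i) ((\<lambda>i\<in>I. t i (x i)) i)) = x"
  proof (intro ballI ext)
    fix x i assume x: "x \<in> PiE I A"
    show "(\<lambda>i\<in>I. inv_into (A i) (t i) ((\<lambda>i\<in>I. t i (x i)) i)) i = x i"
    proof (cases "i \<in> I")
      case True
      then have "x i \<in> A i" by (rule PiE_mem[OF x])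
      from inv_into_f_f[OF inj[OF True] this] True show ?thesis by simp
    next
      case False
      with PiE_arb[OF x False] show ?thesis by simp
    qed
  qed
  show "\<forall>y\<in>PiE I B. (\<lambda>i\<in>I. t i ((\<lambda>i\<in>I. inv_into (A i) (t i) (y i)) i)) = y"
  proof (intro ballI ext)
    fix y i assume y: "y \<in> PiE I B"
    show "(\<lambda>i\<in>I. t i ((\<lambda>i\<in>I. inv_into (A i) (t i) (y i)) i)) i = y i"
    proof (cases "i \<in> I")
      case True
      then have "y i \<in> t i ` A i" using PiE_mem[OF y True] im by simp
      from f_inv_into_f[OF this] True show ?thesis by simp
    next
      case False
      with PiE_arb[OF y False] show ?thesis by simp
    qed
  qed
  show "(\<lambda>x. \<lambda>i\<in>I. t i (x i)) ` PiE I A \<subseteq> PiE I B"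
  proof (rule image_subsetI)
    fix x assume x: "x \<in> PiE I A"
    have "t i (x i) \<in> B i" if "i \<in> I" for i
      using PiE_mem[OF x that] im[OF that] by blast
    then show "(\<lambda>i\<in>I. t i (x i)) \<in> PiE I B" by simp
  qed
  show "(\<lambda>y. \<lambda>i\<in>I. inv_into (A i) (t i) (y i)) ` PiE I B \<subseteq> PiE I A"
  proof (rule image_subsetI)
    fix y assume y: "y \<in> PiE I B"
    have "inv_into (A i) (t i) (y i) \<in> A i" if "i \<in> I" for i
      using PiE_mem[OF y that] im[OF that] by (intro inv_into_into) simp
    then show "(\<lambda>i\<in>I. inv_into (A i) (t i) (y i)) \<in> PiE I A" by simp
  qed
qed

text \<open>Transposing \<open>c\<close> and \<open>c'\<close> shows that the average does not
  depend on the position; after averaging over all positions as well, each single permutation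
  already runs through all values.\<close>

lemma avg_perms_point:
  assumes "c \<in> {1..n}"
  shows "avg (perms n) (\<lambda>p. f (p c)) = avg {1..n} f"
proof -
  have eq: "avg (perms n) (\<lambda>p. f (p c)) = avg (perms n) (\<lambda>p. f (p c'))" if "c' \<in> {1..n}" for c'
    using avg_bij[OF bij_betw_perms_comp[OF transpose_in_perms[OF assms that]], of "\<lambda>p. f (p c)"]
    by simp
  have "avg (perms n) (\<lambda>p. f (p c)) = avg {1..n} (\<lambda>c'. avg (perms n) (\<lambda>p. f (p c')))"
    using assms by (subst avg_cong[OF eq[symmetric]]) (auto intro: avg_const[symmetric])
  also have "\<dots> = avg (perms n) (\<lambda>p. avg {1..n} (\<lambda>c'. f (p c')))"
    by (rule avg_swap)
  also have "\<dots> = avg (perms n) (\<lambda>p. avg {1..n} f)"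
    by (intro avg_cong avg_bij[symmetric]) (auto simp: perms_def permutes_imp_bij)
  finally show ?thesis by (simp add: avg_const)
qed

text \<open>Transpositions fixing \<open>c\<close> make the \<open>n - 1\<close> other positions
  equivalent. As \<open>g\<close> is centred, its values there add up to \<open>- g (p c)\<close>,
  which leaves a one-point average and produces the correlation
  \<open>- 1 / (n - 1)\<close>.\<close>

lemma avg_perms_pair:
  fixes f g :: "nat \<Rightarrow> 'b::real_normed_field"
  assumes c: "c \<in> {1..n}" "c' \<in> {1..n}" "c \<noteq> c'" and g: "(\<Sum>j=1..n. g j) = 0"
  shows "avg (perms n) (\<lambda>p. f (p c) * g (p c')) = - avg {1..n} (\<lambda>j. f j * g j) / of_nat (n - 1)"
proof -
  let ?k = "avg (perms n) (\<lambda>p. f (p c) * g (p c'))"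
  have eq: "avg (perms n) (\<lambda>p. f (p c) * g (p x)) = ?k" if "x \<in> {1..n} - {c}" for x
  proof -
    have "Transposition.transpose c' x \<in> perms n"
      using that c by (intro transpose_in_perms) auto
    moreover have "Transposition.transpose c' x c = c" "Transposition.transpose c' x x = c'"
      using that c by (simp_all add: Transposition.transpose_def)
    ultimately show ?thesis
      using avg_bij[OF bij_betw_perms_comp, of "Transposition.transpose c' x" n
          "\<lambda>p. f (p c) * g (p x)"] by simp
  qed
  have "of_nat (n - 1) * ?k = (\<Sum>x\<in>{1..n} - {c}. avg (perms n) (\<lambda>p. f (p c) * g (p x)))"
    using c by (subst sum.cong[OF refl eq]) simp_all
  also have "\<dots> = avg (perms n) (\<lambda>p. f (p c) * (\<Sum>x\<in>{1..n} - {c}. g (p x)))"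
    by (simp add: avg_sum sum_distrib_left)
  also have "\<dots> = avg (perms n) (\<lambda>p. - (f (p c) * g (p c)))"
  proof (intro avg_cong)
    fix p assume "p \<in> perms n"
    then have "(\<Sum>x=1..n. g (p x)) = 0"
      using g sum.reindex_bij_betw[of p "{1..n}" "{1..n}" g]
      by (simp add: perms_def permutes_imp_bij)
    then have "(\<Sum>x\<in>{1..n} - {c}. g (p x)) = - g (p c)"
      using c by (simp add: sum_diff1)
    then show "f (p c) * (\<Sum>x\<in>{1..n} - {c}. g (p x)) = - (f (p c) * g (p c))"
      by simp
  qed
  also have "\<dots> = - avg {1..n} (\<lambda>j. f j * g j)"
    using avg_perms_point[OF c(1), of "\<lambda>j. f j * g j"] by (simp add: avg_minus)
  finally have "of_nat (n - 1) * ?k = - avg {1..n} (\<lambda>j. f j * g j)" .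
  then have "?k * of_nat (n - 1) = - avg {1..n} (\<lambda>j. f j * g j)"
    by (simp only: mult.commute[of ?k])
  moreover have "n - 1 \<noteq> 0" using c by auto
  then have "of_nat (n - 1) \<noteq> (0 :: 'b)" by (simp only: of_nat_eq_0_iff not_False_eq_True)
  ultimately show ?thesis by (subst nonzero_eq_divide_eq) assumption+
qed

text \<open>Sampling without replacement: distinct draws from a centred population are negatively
  correlated, so the variance of a block mean is at most the independent one.\<close>

lemma avg_perms_block_power2_le:
  fixes f :: "nat \<Rightarrow> complex"
  assumes B: "B \<subseteq> {1..n}" "B \<noteq> {}" and f: "(\<Sum>j=1..n. f j) = 0"
  shows "avg (perms n) (\<lambda>p. (cmod (avg B (\<lambda>c. f (p c))))\<^sup>2)
    \<le> avg {1..n} (\<lambda>j. (cmod (f j))\<^sup>2) / card B"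
proof -
  let ?v = "avg {1..n} (\<lambda>j. (cmod (f j))\<^sup>2)"
  have finB: "finite B" using B finite_subset by blast
  define m where "m = card B"
  have m: "m \<ge> 1" using finB B by (simp add: m_def Suc_leI card_gt_0_iff)
  have v: "avg {1..n} (\<lambda>j. f j * cnj (f j)) = of_real ?v"
    by (simp add: complex_norm_square[symmetric] flip: avg_of_real)
  have cf: "(\<Sum>j=1..n. cnj (f j)) = 0"
    using f by (metis complex_cnj_zero cnj_sum)
  have pair: "Re (avg (perms n) (\<lambda>p. f (p c) * cnj (f (p c')))) \<le> (if c = c' then ?v else 0)"
    if "c \<in> B" "c' \<in> B" for c c'
  proof (cases "c = c'")
    case True
    have "avg (perms n) (\<lambda>p. f (p c) * cnj (f (p c))) = of_real ?v"
      using avg_perms_point[of c n "\<lambda>j. f j * cnj (f j)"] v that B by auto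
    with True show ?thesis by simp
  next
    case False
    have "avg (perms n) (\<lambda>p. f (p c) * cnj (f (p c'))) = - of_real ?v / of_nat (n - 1)"
      using avg_perms_pair[OF subsetD[OF B(1) that(1)] subsetD[OF B(1) that(2)] False cf, of f]
      by (simp only: v)
    then have "Re (avg (perms n) (\<lambda>p. f (p c) * cnj (f (p c')))) = - (?v / real (n - 1))"
      by (simp add: Re_divide_of_nat)
    with False show ?thesis by (simp add: avg_nonneg)
  qed
  have "complex_of_real (avg (perms n) (\<lambda>p. (cmod (avg B (\<lambda>c. f (p c))))\<^sup>2))
    = avg (perms n) (\<lambda>p. avg B (\<lambda>c. f (p c)) * cnj (avg B (\<lambda>c. f (p c))))"
    by (simp add: complex_norm_square[symmetric] flip: avg_of_real)
  also have "\<dots> = avg (perms n) (\<lambda>p. avg B (\<lambda>c. avg B (\<lambda>c'. f (p c) * cnj (f (p c')))))"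
    by (simp add: cnj_avg avg_cmult avg_cmult_right)
  also have "\<dots> = avg B (\<lambda>c. avg B (\<lambda>c'. avg (perms n) (\<lambda>p. f (p c) * cnj (f (p c')))))"
    by (simp add: avg_swap[of "perms n"])
  finally have "Re (complex_of_real (avg (perms n) (\<lambda>p. (cmod (avg B (\<lambda>c. f (p c))))\<^sup>2)))
    = Re (avg B (\<lambda>c. avg B (\<lambda>c'. avg (perms n) (\<lambda>p. f (p c) * cnj (f (p c'))))))"
    by (rule arg_cong)
  then have "avg (perms n) (\<lambda>p. (cmod (avg B (\<lambda>c. f (p c))))\<^sup>2)
    = avg B (\<lambda>c. avg B (\<lambda>c'. Re (avg (perms n) (\<lambda>p. f (p c) * cnj (f (p c'))))))"
    by (simp only: Re_avg Re_complex_of_real)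
  also have "\<dots> \<le> avg B (\<lambda>c. avg B (\<lambda>c'. if c = c' then ?v else 0))"
    by (intro avg_mono pair)
  also have "\<dots> = avg B (\<lambda>c. ?v / m)"
    by (intro avg_cong) (simp add: avg_def[of B] m_def sum.delta' finB)
  also have "\<dots> = ?v / m"
    using finB B by (simp add: avg_const)
  finally show ?thesis by (simp add: m_def)
qed

lemma avg_variance:
  fixes f :: "'a \<Rightarrow> complex"
  assumes "finite A" "A \<noteq> {}"
  shows "avg A (\<lambda>j. (cmod (f j - avg A f))\<^sup>2) = avg A (\<lambda>j. (cmod (f j))\<^sup>2) - (cmod (avg A f))\<^sup>2"
proof -
  let ?a = "avg A f"
  have "avg A (\<lambda>j. (cmod (f j - ?a))\<^sup>2) = avg A (\<lambda>j. (cmod (f j))\<^sup>2 - 2 * Re (f j * cnj ?a) + (cmod ?a)\<^sup>2)"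
    by (intro avg_cong) (simp add: cmod_power2, simp add: power2_eq_square algebra_simps)
  also have "\<dots> = avg A (\<lambda>j. (cmod (f j))\<^sup>2) - 2 * Re (?a * cnj ?a) + (cmod ?a)\<^sup>2"
    using assms by (simp add: avg_add avg_diff avg_cmult avg_const Re_avg[symmetric] avg_cmult_right
        del: times_complex.sel complex_cnj)
  finally show ?thesis
    by (simp add: complex_norm_square[symmetric] del: times_complex.sel)
qed

text \<open>Jensen's inequality passes to the second moment, and subtracting the mean only decreases
  that of \<open>f\<close>, so the bound 1 survives the centring. The rate
  \<open>1 / sqrt (card B)\<close> per component is the source of all later rates.\<close>

lemma avg_perms_block_le:
  fixes f :: "nat \<Rightarrow> complex"
  assumes B: "B \<subseteq> {1..n}" "B \<noteq> {}" and f: "\<And>j. j \<in> {1..n} \<Longrightarrow> cmod (f j) \<le> 1"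
  shows "avg (perms n) (\<lambda>p. cmod (avg B (\<lambda>c. f (p c)) - avg {1..n} f)) \<le> 1 / sqrt (card B)"
proof -
  let ?a = "avg {1..n} f"
  have finB: "finite B" using B finite_subset by blast
  have n: "{1..n} \<noteq> {}" "n \<noteq> 0" using B by auto
  have s: "(\<Sum>j=1..n. f j) = of_nat n * ?a"
    unfolding avg_def using n by simp
  have c: "(\<Sum>j=1..n. f j - ?a) = 0"
    using s by (simp add: sum_subtractf)
  have "avg {1..n} (\<lambda>j. (cmod (f j - ?a))\<^sup>2) \<le> avg {1..n} (\<lambda>j. (cmod (f j))\<^sup>2)"
    using avg_variance[OF _ n(1), of f] by simp
  also have "\<dots> \<le> 1"
    using n f by (intro avg_le_const) (auto simp: power_le_one)
  finally have v: "avg {1..n} (\<lambda>j. (cmod (f j - ?a))\<^sup>2) \<le> 1" .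
  have "(avg (perms n) (\<lambda>p. cmod (avg B (\<lambda>c. f (p c)) - ?a)))\<^sup>2
      = (avg (perms n) (\<lambda>p. cmod (avg B (\<lambda>c. f (p c) - ?a))))\<^sup>2"
    using finB B by (simp add: avg_diff avg_const)
  also have "\<dots> \<le> avg (perms n) (\<lambda>p. (cmod (avg B (\<lambda>c. f (p c) - ?a)))\<^sup>2)"
    by (rule avg_power2_le)
  also have "\<dots> \<le> avg {1..n} (\<lambda>j. (cmod (f j - ?a))\<^sup>2) / card B"
    using avg_perms_block_power2_le[OF B, of "\<lambda>j. f j - ?a"] c by simp
  also have "\<dots> \<le> 1 / card B" using v by (simp add: divide_right_mono)
  finally show ?thesis
    using real_le_rsqrt by (fastforce simp: real_sqrt_divide)
qed

section \<open>A central limit theorem for products of centred functions\<close>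

lemma abs_exp_minus_linear_le:
  fixes x :: real assumes "0 \<le> x" shows "\<bar>1 - x - exp (- x)\<bar> \<le> x\<^sup>2"
proof -
  have "1 - x \<le> exp (- x)" using exp_ge_add_one_self[of "- x"] by simp
  moreover have "exp (- x) \<le> 1 - x + x\<^sup>2"
  proof -
    \<comment> \<open>The product is \<open>1 + x ^ 3\<close>; with \<open>1 + x <= exp x\<close>,
      division by \<open>exp x\<close> yields the upper bound for \<open>exp (- x)\<close>.\<close>
    have "1 \<le> (1 + x) * (1 - x + x\<^sup>2)"
    proof -
      have "(1 + x) * (1 - x + x\<^sup>2) = 1 + x ^ 3"
        by (simp add: algebra_simps power2_eq_square power3_eq_cube)
      then show ?thesis using assms by simp
    qed
    also have "\<dots> \<le> exp x * (1 - x + x\<^sup>2)"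
    proof (rule mult_right_mono)
      show "1 + x \<le> exp x" by (rule exp_ge_add_one_self)
      have "1 - x + x\<^sup>2 = (x - 1/2)\<^sup>2 + 3/4" by (simp add: power2_eq_square algebra_simps)
      then show "0 \<le> 1 - x + x\<^sup>2" by (simp add: add_nonneg_nonneg)
    qed
    finally have "exp (- x) * 1 \<le> exp (- x) * (exp x * (1 - x + x\<^sup>2))"
      by (rule mult_left_mono) simp
    also have "\<dots> = 1 - x + x\<^sup>2" by (simp add: mult.assoc[symmetric] flip: exp_add)
    finally show ?thesis by simp
  qed
  ultimately show ?thesis by simp
qed

lemma iexp_approx_quadratic: "cmod (iexp x - (1 + \<i> * x - of_real (x\<^sup>2 / 2))) \<le> \<bar>x\<bar> ^ 3 / 6"
proof -
  have "(\<Sum>k\<le>2. (\<i> * complex_of_real x) ^ k / fact k) = 1 + \<i> * x - of_real (x\<^sup>2 / 2)"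
    by (simp add: numeral_2_eq_2 power2_eq_square complex_eq_iff)
  with iexp_approx1[of x 2] show ?thesis
    by (simp add: numeral_3_eq_3 fact_numeral)
qed

text \<open>Each term is at most the increment \<open>2 * (sqrt m - sqrt (m - 1))\<close> of the
  right-hand side.\<close>

lemma sum_inverse_sqrt_le: "(\<Sum>m=1..n. 1 / sqrt (real m)) \<le> 2 * sqrt (real n)"
proof (induction n)
  case (Suc n)
  define a where "a = sqrt (real n)"
  define b where "b = sqrt (real (Suc n))"
  have ab: "0 \<le> a" "a \<le> b" "0 < b" "b\<^sup>2 - a\<^sup>2 = 1" by (simp_all add: a_def b_def)
  have "1 = (b - a) * (b + a)" using ab by (simp add: power2_eq_square algebra_simps)
  also have "\<dots> \<le> (b - a) * (2 * b)" using ab by (intro mult_left_mono) auto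
  finally have "1 / b \<le> 2 * (b - a)" using ab by (simp add: field_simps)
  then show ?case using Suc by (simp add: a_def b_def)
qed simp

text \<open>In the application an index \<open>p\<close> is a pair of the component set
  \<open>S p\<close> and a frequency, and \<open>\<alpha> p i j\<close> is half the centred
  exponential at grid point \<open>j\<close>. Halving achieves the bound 1; the powers of 2 move
  into \<open>c\<close>.\<close>

locale centered_array =
  fixes I :: "'i set" and P :: "'p set" and S :: "'p \<Rightarrow> 'i set" and c :: "'p \<Rightarrow> complex"
    and \<alpha> :: "'p \<Rightarrow> 'i \<Rightarrow> nat \<Rightarrow> complex" and n :: nat
  assumes finite_I: "finite I" and finite_P: "finite P" and n_pos: "1 \<le> n"
    and S_subset: "p \<in> P \<Longrightarrow> S p \<subseteq> I"
    and card_S: "p \<in> P \<Longrightarrow> 2 \<le> card (S p)"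
    and norm_le_1: "p \<in> P \<Longrightarrow> i \<in> S p \<Longrightarrow> j \<in> {1..n} \<Longrightarrow> cmod (\<alpha> p i j) \<le> 1"
    and centered: "p \<in> P \<Longrightarrow> i \<in> S p \<Longrightarrow> (\<Sum>j=1..n. \<alpha> p i j) = 0"
begin

text \<open>The summand of a single position at which component \<open>i\<close> takes the value
  \<open>j i\<close>. The linear functional under study is the sum of the real parts over all
  positions, divided by \<open>sqrt n\<close>.\<close>

definition H :: "('i \<Rightarrow> nat) \<Rightarrow> complex" where
  "H j = (\<Sum>p\<in>P. c p * (\<Prod>i\<in>S p. \<alpha> p i (j i)))"

definition G :: "('i \<Rightarrow> nat) \<Rightarrow> real" where
  "G j = Re (H j)"

definition D :: real where
  "D = (\<Sum>p\<in>P. cmod (c p))"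

text \<open>For coordinates drawn independently and uniformly, \<open>G\<close> has mean 0, since
  every product contains centred factors; hence this is its variance.\<close>

definition var :: real where
  "var = avg (PiE I (\<lambda>_. {1..n})) (\<lambda>j. (G j)\<^sup>2)"

lemma D_nonneg: "0 \<le> D"
  by (simp add: D_def sum_nonneg)

lemma finite_S: "p \<in> P \<Longrightarrow> finite (S p)"
  using finite_subset[OF S_subset finite_I] .

lemma norm_H_le:
  assumes "\<And>i. i \<in> I \<Longrightarrow> j i \<in> {1..n}" shows "cmod (H j) \<le> D"
  unfolding H_def D_def
proof (rule sum_norm_le)
  fix p assume p: "p \<in> P"
  have "(\<Prod>i\<in>S p. cmod (\<alpha> p i (j i))) \<le> 1"
    using p assms S_subset[OF p] by (intro prod_le_1) (auto simp: norm_le_1)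
  then have "cmod (c p) * (\<Prod>i\<in>S p. cmod (\<alpha> p i (j i))) \<le> cmod (c p) * 1"
    by (intro mult_left_mono) auto
  then show "cmod (c p * (\<Prod>i\<in>S p. \<alpha> p i (j i))) \<le> cmod (c p)"
    by (simp add: norm_mult prod_norm)
qed

lemma abs_G_le:
  assumes "\<And>i. i \<in> I \<Longrightarrow> j i \<in> {1..n}" shows "\<bar>G j\<bar> \<le> D"
  unfolding G_def by (rule order_trans[OF abs_Re_le_cmod norm_H_le]) (rule assms)

lemma H_cong: "(\<And>i. i \<in> I \<Longrightarrow> j i = j' i) \<Longrightarrow> H j = H j'"
  unfolding H_def using S_subset
  by (intro sum.cong refl arg_cong2[where f = "(*)"] prod.cong) (auto simp: subset_iff)

lemma var_nonneg: "0 \<le> var"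
  unfolding var_def by (rule avg_nonneg) simp

lemma PiE_nonempty: "b \<le> n \<Longrightarrow> PiE I (\<lambda>_. {b..n}) \<noteq> {}"
  by (simp add: PiE_eq_empty_iff)

lemma var_le: "var \<le> D\<^sup>2"
  unfolding var_def
proof (rule avg_le_const)
  fix j assume "j \<in> PiE I (\<lambda>_. {1..n})"
  then have "\<bar>G j\<bar> \<le> D" by (intro abs_G_le) (rule PiE_mem)
  then show "(G j)\<^sup>2 \<le> D\<^sup>2" using D_nonneg by (rule_tac abs_le_square_iff[THEN iffD1]) simp
qed (use n_pos PiE_nonempty finite_I in \<open>auto intro: finite_PiE\<close>)

text \<open>Given the values of a uniformly random permutation before \<open>b\<close>, its value at \<open>b\<close> is
  uniformly distributed over the remaining ones.\<close>

lemma exchange: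
  assumes b: "b \<in> {1..n}"
    and \<Phi>: "\<And>\<pi> k. \<pi> \<in> perm_tuples I n \<Longrightarrow> k \<in> PiE I (\<lambda>_. {b..n}) \<Longrightarrow>
      \<Phi> (\<lambda>i\<in>I. \<pi> i \<circ> Transposition.transpose b (k i)) = \<Phi> \<pi>"
    and F: "\<And>j j'. (\<And>i. i \<in> I \<Longrightarrow> j i = j' i) \<Longrightarrow> F j = F j'"
  shows "avg (perm_tuples I n) (\<lambda>\<pi>. \<Phi> \<pi> * F (\<lambda>i. \<pi> i b))
    = avg (perm_tuples I n) (\<lambda>\<pi>. \<Phi> \<pi> * avg (PiE I (\<lambda>_. {b..n})) (\<lambda>k. F (\<lambda>i. \<pi> i (k i))) :: complex)"
proof -
  let ?K = "PiE I (\<lambda>_. {b..n})"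
  let ?L = "avg (perm_tuples I n) (\<lambda>\<pi>. \<Phi> \<pi> * F (\<lambda>i. \<pi> i b))"
  \<comment> \<open>For fixed \<open>k\<close>, right composition with the transpositions of
    \<open>b\<close> and \<open>k i\<close> preserves the uniform law and \<open>\<Phi>\<close>, and
    turns the value at \<open>b\<close> into the value at \<open>k i\<close>.\<close>
  have eq: "?L = avg (perm_tuples I n) (\<lambda>\<pi>. \<Phi> \<pi> * F (\<lambda>i. \<pi> i (k i)))" if k: "k \<in> ?K" for k
  proof -
    have t: "Transposition.transpose b (k i) \<in> perms n" if "i \<in> I" for i
      using PiE_mem[OF k that] b by (intro transpose_in_perms) auto
    have "?L = avg (perm_tuples I n) (\<lambda>\<pi>. \<Phi> (\<lambda>i\<in>I. \<pi> i \<circ> Transposition.transpose b (k i))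
        * F (\<lambda>i. (\<lambda>i\<in>I. \<pi> i \<circ> Transposition.transpose b (k i)) i b))"
      unfolding perm_tuples_def
      by (rule avg_bij[OF bij_betw_PiE_map]) (use t in \<open>rule bij_betw_perms_comp\<close>)
    also have "\<dots> = avg (perm_tuples I n) (\<lambda>\<pi>. \<Phi> \<pi> * F (\<lambda>i. \<pi> i (k i)))"
      by (intro avg_cong arg_cong2[where f = "(*)"] \<Phi> k F) simp_all
    finally show ?thesis .
  qed
  have fin: "finite ?K" using finite_I by (simp add: finite_PiE)
  have "?L = avg ?K (\<lambda>k. ?L)"
    using fin PiE_nonempty[of b] b by (simp add: avg_const)
  also have "\<dots> = avg ?K (\<lambda>k. avg (perm_tuples I n) (\<lambda>\<pi>. \<Phi> \<pi> * F (\<lambda>i. \<pi> i (k i))))"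
    by (rule avg_cong) (rule eq)
  also have "\<dots> = avg (perm_tuples I n) (\<lambda>\<pi>. avg ?K (\<lambda>k. \<Phi> \<pi> * F (\<lambda>i. \<pi> i (k i))))"
    by (rule avg_swap)
  finally show ?thesis by (simp only: avg_cmult)
qed

section \<open>Averages over the block of positions not yet revealed\<close>

lemma avg_prod_le:
  assumes S: "T \<subseteq> I" and f: "\<And>i p. i \<in> T \<Longrightarrow> p \<in> perms n \<Longrightarrow> 0 \<le> f i p"
    and g: "\<And>i. i \<in> T \<Longrightarrow> avg (perms n) (f i) \<le> (g :: real)"
  shows "avg (perm_tuples I n) (\<lambda>\<pi>. \<Prod>i\<in>T. f i (\<pi> i)) \<le> g ^ card T"
proof -
  have "avg (perm_tuples I n) (\<lambda>\<pi>. \<Prod>i\<in>T. f i (\<pi> i)) = (\<Prod>i\<in>T. avg (perms n) (f i))"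
    unfolding perm_tuples_def by (rule avg_PiE_prod_subset) (use finite_I S in auto)
  also have "\<dots> \<le> (\<Prod>i\<in>T. g)"
    by (intro prod_mono conjI avg_nonneg f g)
  finally show ?thesis by simp
qed

text \<open>The average over \<open>k\<close> factorizes into block means, one for each
  \<open>i\<close> in \<open>S p\<close>. These depend on different permutations, so the averages of
  their moduli multiply, and each is at most \<open>1 / sqrt m\<close> for the block length
  \<open>m = n - b + 1\<close>.\<close>

lemma avg_block_H_le:
  assumes b: "b \<in> {1..n}"
  shows "avg (perm_tuples I n) (\<lambda>\<pi>. cmod (avg (PiE I (\<lambda>_. {b..n})) (\<lambda>k. H (\<lambda>i. \<pi> i (k i)))))
    \<le> D / real (n - b + 1)"
proof -
  let ?K = "PiE I (\<lambda>_. {b..n})" and ?m = "real (n - b + 1)"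
  have cardB: "real (card {b..n}) = ?m" using b by simp
  have m: "?m \<ge> 1" by simp
  have sub: "{b..n} \<subseteq> {1..n}" "{b..n} \<noteq> {}" using b by auto
  have eq: "avg ?K (\<lambda>k. H (\<lambda>i. \<pi> i (k i)))
      = (\<Sum>p\<in>P. c p * (\<Prod>i\<in>S p. avg {b..n} (\<lambda>j. \<alpha> p i (\<pi> i j))))" for \<pi>
  proof -
    have "avg ?K (\<lambda>k. \<Prod>i\<in>S p. \<alpha> p i (\<pi> i (k i))) = (\<Prod>i\<in>S p. avg {b..n} (\<lambda>j. \<alpha> p i (\<pi> i j)))"
      if "p \<in> P" for p
      using sub finite_I S_subset[OF that]
      by (intro avg_PiE_prod_subset[where f = "\<lambda>i j. \<alpha> p i (\<pi> i j)"]) auto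
    then show ?thesis
      unfolding H_def by (simp add: avg_sum avg_cmult)
  qed
  have "avg (perm_tuples I n) (\<lambda>\<pi>. cmod (avg ?K (\<lambda>k. H (\<lambda>i. \<pi> i (k i)))))
    \<le> avg (perm_tuples I n) (\<lambda>\<pi>. \<Sum>p\<in>P. cmod (c p) * (\<Prod>i\<in>S p. cmod (avg {b..n} (\<lambda>j. \<alpha> p i (\<pi> i j)))))"
    unfolding eq by (intro avg_mono sum_norm_le) (simp add: norm_mult prod_norm)
  also have "\<dots> = (\<Sum>p\<in>P. cmod (c p) * avg (perm_tuples I n) (\<lambda>\<pi>. \<Prod>i\<in>S p. cmod (avg {b..n} (\<lambda>j. \<alpha> p i (\<pi> i j)))))"
    by (simp add: avg_sum avg_cmult)
  also have "\<dots> \<le> (\<Sum>p\<in>P. cmod (c p) * (1 / ?m))"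
  proof (intro sum_mono mult_left_mono)
    fix p assume p: "p \<in> P"
    have "avg (perm_tuples I n) (\<lambda>\<pi>. \<Prod>i\<in>S p. cmod (avg {b..n} (\<lambda>j. \<alpha> p i (\<pi> i j))))
      \<le> (1 / sqrt ?m) ^ card (S p)"
    proof (rule avg_prod_le[where f = "\<lambda>i q. cmod (avg {b..n} (\<lambda>j. \<alpha> p i (q j)))"])
      fix i assume i: "i \<in> S p"
      have "avg {1..n} (\<alpha> p i) = 0" using centered[OF p i] by (simp add: avg_def)
      then show "avg (perms n) (\<lambda>q. cmod (avg {b..n} (\<lambda>j. \<alpha> p i (q j)))) \<le> 1 / sqrt ?m"
        using avg_perms_block_le[OF sub, of "\<alpha> p i"] norm_le_1[OF p i] cardB by simp
    qed (use S_subset[OF p] in auto)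
    \<comment> \<open>Two factors already give the rate \<open>1 / m\<close>; further ones are at
      most 1. Here \<open>card_S\<close> enters.\<close>
    also have "\<dots> \<le> (1 / sqrt ?m) ^ 2"
      using card_S[OF p] m by (intro power_decreasing) (auto simp del: of_nat_add of_nat_Suc)
    also have "\<dots> = 1 / ?m" using m by (simp add: power_divide)
    finally show "avg (perm_tuples I n) (\<lambda>\<pi>. \<Prod>i\<in>S p. cmod (avg {b..n} (\<lambda>j. \<alpha> p i (\<pi> i j)))) \<le> 1 / ?m" .
  qed simp
  finally show ?thesis by (simp add: D_def sum_divide_distrib)
qed

text \<open>Without centring, block averages are only close to the averages over the whole grid. A
  difference of products of numbers of modulus at most 1 is bounded by the sum of the differences,
  and each contributes \<open>1 / sqrt m\<close>. This weaker rate suffices, as variances enter with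
  the factor \<open>1 / n\<close> instead of \<open>1 / sqrt n\<close>.\<close>

lemma avg_block_prod_le:
  assumes b: "b \<in> {1..n}" and \<beta>: "\<And>i j. i \<in> I \<Longrightarrow> j \<in> {1..n} \<Longrightarrow> cmod (\<beta> i j) \<le> 1"
  shows "avg (perm_tuples I n) (\<lambda>\<pi>. cmod (avg (PiE I (\<lambda>_. {b..n})) (\<lambda>k. \<Prod>i\<in>I. \<beta> i (\<pi> i (k i)))
      - avg (PiE I (\<lambda>_. {1..n})) (\<lambda>j. \<Prod>i\<in>I. \<beta> i (j i))))
    \<le> card I / sqrt (real (n - b + 1))"
proof -
  have cardB: "real (card {b..n}) = real (n - b + 1)" using b by simp
  have sub: "{b..n} \<subseteq> {1..n}" "{b..n} \<noteq> {}" "{1..n} \<noteq> {}" using b by auto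
  have "avg (perm_tuples I n) (\<lambda>\<pi>. cmod (avg (PiE I (\<lambda>_. {b..n})) (\<lambda>k. \<Prod>i\<in>I. \<beta> i (\<pi> i (k i)))
      - avg (PiE I (\<lambda>_. {1..n})) (\<lambda>j. \<Prod>i\<in>I. \<beta> i (j i))))
    = avg (perm_tuples I n) (\<lambda>\<pi>. cmod ((\<Prod>i\<in>I. avg {b..n} (\<lambda>j. \<beta> i (\<pi> i j))) - (\<Prod>i\<in>I. avg {1..n} (\<beta> i))))"
    using finite_I by (simp add: avg_PiE_prod[where f = "\<lambda>i j. \<beta> i (_ i j)"] avg_PiE_prod)
  also have "\<dots> \<le> avg (perm_tuples I n) (\<lambda>\<pi>. \<Sum>i\<in>I. cmod (avg {b..n} (\<lambda>j. \<beta> i (\<pi> i j)) - avg {1..n} (\<beta> i)))"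
  proof (intro avg_mono norm_prod_diff norm_avg_le_const \<beta>)
    fix \<pi> i j assume "\<pi> \<in> perm_tuples I n" "i \<in> I" "j \<in> {b..n}"
    then show "\<pi> i j \<in> {1..n}"
      using perm_tuples_in[of \<pi> I n i j] sub(1) by blast
  qed (use sub in auto)
  also have "\<dots> = (\<Sum>i\<in>I. avg (perm_tuples I n) (\<lambda>\<pi>. \<Prod>i\<in>{i}. cmod (avg {b..n} (\<lambda>j. \<beta> i (\<pi> i j)) - avg {1..n} (\<beta> i))))"
    by (simp add: avg_sum)
  also have "\<dots> \<le> (\<Sum>i\<in>I. (1 / sqrt (real (n - b + 1))) ^ card {i})"
  proof (rule sum_mono)
    fix i assume i: "i \<in> I"
    show "avg (perm_tuples I n) (\<lambda>\<pi>. \<Prod>i\<in>{i}. cmod (avg {b..n} (\<lambda>j. \<beta> i (\<pi> i j)) - avg {1..n} (\<beta> i)))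
      \<le> (1 / sqrt (real (n - b + 1))) ^ card {i}"
    proof (rule avg_prod_le[where f = "\<lambda>i q. cmod (avg {b..n} (\<lambda>j. \<beta> i (q j)) - avg {1..n} (\<beta> i))"])
      fix i' assume "i' \<in> {i}"
      then have "i' \<in> I" using i by simp
      from avg_perms_block_le[OF sub(1,2) \<beta>[OF this]] cardB
      show "avg (perms n) (\<lambda>q. cmod (avg {b..n} (\<lambda>j. \<beta> i' (q j)) - avg {1..n} (\<beta> i')))
        \<le> 1 / sqrt (real (n - b + 1))" by simp
    qed (use i in auto)
  qed
  finally show ?thesis by simp
qed

text \<open>The square of \<open>G\<close> is \<open>Re (H * cnj H + H * H) / 2\<close>, a linear
  combination of products over all of \<open>I\<close> once missing factors are filled in with 1
  (\<open>ga\<close>), and \<open>avg_block_prod_le\<close> applies to each. Both kinds of products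
  have weight one half, so the moduli of the coefficients add up to the square of
  \<open>D\<close>.\<close>

lemma avg_block_G2_le:
  assumes b: "b \<in> {1..n}"
  shows "avg (perm_tuples I n) (\<lambda>\<pi>. \<bar>avg (PiE I (\<lambda>_. {b..n})) (\<lambda>k. (G (\<lambda>i. \<pi> i (k i)))\<^sup>2) - var\<bar>)
    \<le> D\<^sup>2 * (card I / sqrt (real (n - b + 1)))"
proof -
  let ?K = "PiE I (\<lambda>_. {b..n})" and ?N = "PiE I (\<lambda>_. {1..n})"
  let ?e = "card I / sqrt (real (n - b + 1))"
  define ga where "ga p i = (if i \<in> S p then \<alpha> p i else (\<lambda>_. 1))" for p i
  define ex where "ex B \<beta> \<pi> = avg (PiE I (\<lambda>_. B)) (\<lambda>k. \<Prod>i\<in>I. \<beta> i (\<pi> i (k i)))"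
    for B :: "nat set" and \<beta> :: "'i \<Rightarrow> nat \<Rightarrow> complex" and \<pi> :: "'i \<Rightarrow> nat \<Rightarrow> nat"
  define b1 where "b1 p q i j = ga p i j * cnj (ga q i j)" for p q i j
  define b2 where "b2 p q i j = ga p i j * ga q i j" for p q i j
  have ga_le: "cmod (ga p i j) \<le> 1" if "p \<in> P" "j \<in> {1..n}" for p i j
    using norm_le_1 that by (simp add: ga_def)
  have b1_le: "cmod (b1 p q i j) \<le> 1" and b2_le: "cmod (b2 p q i j) \<le> 1"
    if "p \<in> P" "q \<in> P" "j \<in> {1..n}" for p q i j
    using ga_le that by (auto simp: b1_def b2_def norm_mult intro!: mult_le_one)
  have prodS: "(\<Prod>i\<in>S p. \<alpha> p i (j i)) = (\<Prod>i\<in>I. ga p i (j i))" if "p \<in> P" for p j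
  proof -
    have "(\<Prod>i\<in>I. ga p i (j i)) = (\<Prod>i\<in>I. if i \<in> S p then \<alpha> p i (j i) else 1)"
      by (intro prod.cong) (simp_all add: ga_def)
    also have "\<dots> = (\<Prod>i\<in>I \<inter> S p. \<alpha> p i (j i))"
      using prod.inter_restrict[OF finite_I, of "\<lambda>i. \<alpha> p i (j i)" "S p"] by simp
    finally show ?thesis using S_subset[OF that] by (simp add: Int_absorb1)
  qed
  have H: "H j = (\<Sum>p\<in>P. c p * (\<Prod>i\<in>I. ga p i (j i)))" for j
    unfolding H_def by (intro sum.cong refl) (simp add: prodS)
  have HH: "H j * cnj (H j) = (\<Sum>p\<in>P. \<Sum>q\<in>P. c p * cnj (c q) * (\<Prod>i\<in>I. b1 p q i (j i)))"
    "H j * H j = (\<Sum>p\<in>P. \<Sum>q\<in>P. c p * c q * (\<Prod>i\<in>I. b2 p q i (j i)))" for j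
    unfolding H b1_def b2_def
    by (simp_all add: sum_product prod.distrib cnj_sum cnj_prod mult_ac)
  have G2: "(G j)\<^sup>2 = Re (H j * cnj (H j) + H j * H j) / 2" for j
    by (simp add: G_def power2_eq_square)
  have exp: "avg (PiE I (\<lambda>_. B)) (\<lambda>k. (G (\<lambda>i. \<pi> i (k i)))\<^sup>2)
      = Re (\<Sum>p\<in>P. \<Sum>q\<in>P. c p * cnj (c q) * ex B (b1 p q) \<pi> + c p * c q * ex B (b2 p q) \<pi>) / 2" for B \<pi>
    unfolding G2 HH ex_def
    by (simp add: avg_divide Re_avg[symmetric] avg_add avg_sum avg_cmult sum.distrib
        del: plus_complex.sel)
  have var: "var = Re (\<Sum>p\<in>P. \<Sum>q\<in>P. c p * cnj (c q) * ex {1..n} (b1 p q) (\<lambda>_ j. j)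
      + c p * c q * ex {1..n} (b2 p q) (\<lambda>_ j. j)) / 2"
    unfolding var_def using exp[of "{1..n}" "\<lambda>_ j. j"] by simp
  define df where "df \<beta> \<pi> = cmod (ex {b..n} \<beta> \<pi> - ex {1..n} \<beta> (\<lambda>_ j. j))" for \<beta> \<pi>
  have df_le: "avg (perm_tuples I n) (df \<beta>) \<le> ?e"
    if "\<And>i j. i \<in> I \<Longrightarrow> j \<in> {1..n} \<Longrightarrow> cmod (\<beta> i j) \<le> 1" for \<beta>
    using avg_block_prod_le[OF b, of \<beta>] that by (simp add: df_def[abs_def] ex_def)
  have pt: "\<bar>avg ?K (\<lambda>k. (G (\<lambda>i. \<pi> i (k i)))\<^sup>2) - var\<bar>
    \<le> (\<Sum>p\<in>P. \<Sum>q\<in>P. cmod (c p) * cmod (c q) * (df (b1 p q) \<pi> / 2 + df (b2 p q) \<pi> / 2))" for \<pi>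
  proof -
    let ?d = "\<lambda>\<beta>. ex {b..n} \<beta> \<pi> - ex {1..n} \<beta> (\<lambda>_ j. j)"
    have "avg ?K (\<lambda>k. (G (\<lambda>i. \<pi> i (k i)))\<^sup>2) - var
      = Re (\<Sum>p\<in>P. \<Sum>q\<in>P. c p * cnj (c q) * ?d (b1 p q) + c p * c q * ?d (b2 p q)) / 2"
      unfolding exp var by (simp add: diff_divide_distrib[symmetric] Re_sum[symmetric] sum_subtractf[symmetric]
          algebra_simps del: Re_sum times_complex.sel plus_complex.sel minus_complex.sel flip: minus_complex.sel)
    then have "\<bar>avg ?K (\<lambda>k. (G (\<lambda>i. \<pi> i (k i)))\<^sup>2) - var\<bar>
      = \<bar>Re (\<Sum>p\<in>P. \<Sum>q\<in>P. c p * cnj (c q) * ?d (b1 p q) + c p * c q * ?d (b2 p q)) / 2\<bar>"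
      by (simp only:)
    also have "\<dots> \<le> cmod (\<Sum>p\<in>P. \<Sum>q\<in>P. c p * cnj (c q) * ?d (b1 p q) + c p * c q * ?d (b2 p q)) / 2"
      unfolding abs_divide abs_numeral by (rule divide_right_mono[OF abs_Re_le_cmod]) simp
    also have "\<dots> \<le> (\<Sum>p\<in>P. \<Sum>q\<in>P. cmod (c p) * cmod (c q) * (df (b1 p q) \<pi> + df (b2 p q) \<pi>)) / 2"
      by (intro divide_right_mono sum_norm_le order_trans[OF norm_triangle_ineq])
         (simp_all add: norm_mult df_def distrib_left)
    finally show ?thesis by (simp add: sum_divide_distrib add_divide_distrib distrib_left)
  qed
  have "avg (perm_tuples I n) (\<lambda>\<pi>. \<bar>avg ?K (\<lambda>k. (G (\<lambda>i. \<pi> i (k i)))\<^sup>2) - var\<bar>)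
    \<le> avg (perm_tuples I n) (\<lambda>\<pi>. \<Sum>p\<in>P. \<Sum>q\<in>P. cmod (c p) * cmod (c q) * (df (b1 p q) \<pi> / 2 + df (b2 p q) \<pi> / 2))"
    by (rule avg_mono) (rule pt)
  also have "\<dots> = (\<Sum>p\<in>P. \<Sum>q\<in>P. cmod (c p) * cmod (c q)
      * (avg (perm_tuples I n) (df (b1 p q)) / 2 + avg (perm_tuples I n) (df (b2 p q)) / 2))"
    by (simp add: avg_sum avg_cmult avg_add avg_divide)
  also have "\<dots> \<le> (\<Sum>p\<in>P. \<Sum>q\<in>P. cmod (c p) * cmod (c q) * (?e / 2 + ?e / 2))"
    by (intro sum_mono mult_left_mono add_mono divide_right_mono df_le b1_le b2_le) simp_all
  also have "\<dots> = D\<^sup>2 * ?e"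
    unfolding field_sum_of_halves D_def power2_eq_square sum_product by (simp only: sum_distrib_right)
  finally show ?thesis .
qed

text \<open>By \<open>exchange\<close> the factor at \<open>b\<close> may be replaced by its mean
  over the remaining values. Expanding both exponentials leaves four errors, in this order: the
  cubic Taylor remainder, the conditional drift, the deviation of the conditional variance from
  \<open>var\<close>, and the remainder of the real exponential.\<close>

lemma avg_iexp_step:
  assumes b: "b \<in> {1..n}"
    and \<Phi>: "\<And>\<pi> k. \<pi> \<in> perm_tuples I n \<Longrightarrow> k \<in> PiE I (\<lambda>_. {b..n}) \<Longrightarrow>
      \<Phi> (\<lambda>i\<in>I. \<pi> i \<circ> Transposition.transpose b (k i)) = \<Phi> \<pi>"
    and \<Phi>_le: "\<And>\<pi>. cmod (\<Phi> \<pi>) \<le> 1"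
  shows "cmod (avg (perm_tuples I n) (\<lambda>\<pi>. \<Phi> \<pi> * (iexp (G (\<lambda>i. \<pi> i b) / sqrt n) - exp (- (var / (2 * real n))))))
    \<le> D ^ 3 / (6 * real n * sqrt n) + D / sqrt n * (1 / real (n - b + 1))
      + D\<^sup>2 * card I / (2 * real n) * (1 / sqrt (real (n - b + 1))) + D ^ 4 / (4 * real n ^ 2)"
proof -
  let ?K = "PiE I (\<lambda>_. {b..n})" and ?PT = "perm_tuples I n"
  define y where "y j = G j / sqrt n" for j
  define F where "F j = iexp (y j) - complex_of_real (exp (- (var / (2 * real n))))" for j
  have finK: "finite ?K" "?K \<noteq> {}" using finite_I PiE_nonempty b by (auto simp: finite_PiE)
  have n: "real n > 0" using n_pos by simp
  have Fcong: "F j = F j'" if "\<And>i. i \<in> I \<Longrightarrow> j i = j' i" for j j'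
    using H_cong[of j j'] that by (simp add: F_def y_def G_def)
  define r where "r j = iexp (y j) - (1 + \<i> * y j - of_real ((y j)\<^sup>2 / 2))" for j
  define u where "u \<pi> = cmod (avg ?K (\<lambda>k. H (\<lambda>i. \<pi> i (k i))))" for \<pi> :: "'i \<Rightarrow> nat \<Rightarrow> nat"
  define v where "v \<pi> = \<bar>avg ?K (\<lambda>k. (G (\<lambda>i. \<pi> i (k i)))\<^sup>2) - var\<bar>" for \<pi> :: "'i \<Rightarrow> nat \<Rightarrow> nat"
  let ?x = "var / (2 * real n)"
  have F_eq: "F j = r j + \<i> * of_real (y j) - of_real ((y j)\<^sup>2 / 2 - ?x) + of_real (1 - ?x - exp (- ?x))" for j
    by (simp add: F_def r_def)
  have pt: "cmod (avg ?K (\<lambda>k. F (\<lambda>i. \<pi> i (k i))))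
    \<le> D ^ 3 / (6 * real n * sqrt n) + u \<pi> / sqrt n + v \<pi> / (2 * real n) + D ^ 4 / (4 * real n ^ 2)"
    if \<pi>: "\<pi> \<in> ?PT" for \<pi>
  proof -
    let ?j = "\<lambda>k i. \<pi> i (k i)"
    have jin: "?j k i \<in> {1..n}" if "k \<in> ?K" "i \<in> I" for k i
      using perm_tuples_in[OF \<pi> that(2), of "k i"] PiE_mem[OF that] b by simp
    have 1: "cmod (avg ?K (\<lambda>k. r (?j k))) \<le> D ^ 3 / (6 * real n * sqrt n)"
    proof (rule norm_avg_le_const)
      fix k assume k: "k \<in> ?K"
      have "cmod (r (?j k)) \<le> \<bar>y (?j k)\<bar> ^ 3 / 6"
        unfolding r_def by (rule iexp_approx_quadratic)
      also have "\<dots> \<le> (D / sqrt n) ^ 3 / 6"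
        using abs_G_le[of "?j k"] jin[OF k] n
        by (intro divide_right_mono power_mono) (auto simp: y_def abs_divide divide_right_mono)
      also have "\<dots> = D ^ 3 / (6 * real n * sqrt n)"
        using n by (simp add: power_divide power3_eq_cube)
      finally show "cmod (r (?j k)) \<le> D ^ 3 / (6 * real n * sqrt n)" .
    qed (use finK in auto)
    have 2: "cmod (\<i> * of_real (avg ?K (\<lambda>k. y (?j k)))) \<le> u \<pi> / sqrt n"
    proof -
      have "avg ?K (\<lambda>k. y (?j k)) = Re (avg ?K (\<lambda>k. H (?j k))) / sqrt n"
        by (simp add: y_def G_def avg_divide Re_avg)
      then show ?thesis
        using abs_Re_le_cmod[of "avg ?K (\<lambda>k. H (?j k))"] n
        by (simp add: norm_mult norm_divide u_def abs_divide divide_right_mono)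
    qed
    have 3: "cmod (of_real (avg ?K (\<lambda>k. (y (?j k))\<^sup>2) / 2 - ?x)) \<le> v \<pi> / (2 * real n)"
    proof -
      have "avg ?K (\<lambda>k. (y (?j k))\<^sup>2) / 2 - ?x = (avg ?K (\<lambda>k. (G (?j k))\<^sup>2) - var) / (2 * real n)"
        using n by (simp add: y_def avg_divide power_divide diff_divide_distrib)
      then show ?thesis using n by (simp only: norm_of_real) (simp add: v_def abs_divide)
    qed
    have 4: "cmod (of_real (1 - ?x - exp (- ?x))) \<le> D ^ 4 / (4 * real n ^ 2)"
    proof -
      have x0: "0 \<le> ?x" using var_nonneg n by simp
      have "\<bar>1 - ?x - exp (- ?x)\<bar> \<le> ?x\<^sup>2" by (rule abs_exp_minus_linear_le[OF x0])
      also have "\<dots> \<le> (D\<^sup>2 / (2 * real n))\<^sup>2"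
        using x0 var_le n by (intro power_mono divide_right_mono) auto
      also have "\<dots> = D ^ 4 / (4 * real n ^ 2)"
        by (simp add: power_divide power_mult_distrib flip: power_mult)
      finally show ?thesis by (simp only: norm_of_real)
    qed
    have tri: "cmod (z1 + z2 - z3 + z4) \<le> cmod z1 + cmod z2 + cmod z3 + cmod z4" for z1 z2 z3 z4
      by (smt (verit) norm_triangle_ineq norm_triangle_ineq4)
    have "avg ?K (\<lambda>k. F (?j k)) = avg ?K (\<lambda>k. r (?j k)) + \<i> * of_real (avg ?K (\<lambda>k. y (?j k)))
      - of_real (avg ?K (\<lambda>k. (y (?j k))\<^sup>2) / 2 - ?x) + of_real (1 - ?x - exp (- ?x))"
      unfolding F_eq using finK
      by (simp only: avg_add avg_diff avg_cmult avg_of_real avg_divide avg_const not_False_eq_True)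
    also have "cmod \<dots> \<le> D ^ 3 / (6 * real n * sqrt n) + u \<pi> / sqrt n + v \<pi> / (2 * real n) + D ^ 4 / (4 * real n ^ 2)"
      by (rule order_trans[OF tri]) (intro add_mono 1 2 3 4)
    finally show ?thesis .
  qed
  have "cmod (avg ?PT (\<lambda>\<pi>. \<Phi> \<pi> * F (\<lambda>i. \<pi> i b)))
      = cmod (avg ?PT (\<lambda>\<pi>. \<Phi> \<pi> * avg ?K (\<lambda>k. F (\<lambda>i. \<pi> i (k i)))))"
    by (rule arg_cong[where f = cmod], rule exchange[OF b]) (fact \<Phi> Fcong)+
  also have "\<dots> \<le> avg ?PT (\<lambda>\<pi>. D ^ 3 / (6 * real n * sqrt n) + u \<pi> / sqrt n + v \<pi> / (2 * real n) + D ^ 4 / (4 * real n ^ 2))"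
  proof (rule order_trans[OF norm_avg_le avg_mono])
    fix \<pi> assume \<pi>: "\<pi> \<in> ?PT"
    have "cmod (\<Phi> \<pi> * avg ?K (\<lambda>k. F (\<lambda>i. \<pi> i (k i)))) \<le> 1 * cmod (avg ?K (\<lambda>k. F (\<lambda>i. \<pi> i (k i))))"
      unfolding norm_mult by (intro mult_right_mono \<Phi>_le norm_ge_zero)
    with pt[OF \<pi>] show "cmod (\<Phi> \<pi> * avg ?K (\<lambda>k. F (\<lambda>i. \<pi> i (k i))))
      \<le> D ^ 3 / (6 * real n * sqrt n) + u \<pi> / sqrt n + v \<pi> / (2 * real n) + D ^ 4 / (4 * real n ^ 2)" by simp
  qed
  also have "\<dots> = D ^ 3 / (6 * real n * sqrt n) + avg ?PT u / sqrt n + avg ?PT v / (2 * real n) + D ^ 4 / (4 * real n ^ 2)"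
    using finite_I by (simp add: avg_add avg_divide avg_const)
  also have "\<dots> \<le> D ^ 3 / (6 * real n * sqrt n) + (D / real (n - b + 1)) / sqrt n
      + (D\<^sup>2 * (card I / sqrt (real (n - b + 1)))) / (2 * real n) + D ^ 4 / (4 * real n ^ 2)"
    using avg_block_H_le[OF b] avg_block_G2_le[OF b]
    by (intro add_mono divide_right_mono order_refl) (simp_all add: u_def[abs_def] v_def[abs_def])
  finally show ?thesis by (simp add: F_def y_def mult_ac)
qed

text \<open>Telescoping over \<open>b\<close>: one factor \<open>iexp (G (\<lambda>i. \<pi> i b) / sqrt n)\<close> after the other is traded for
  the constant \<open>exp (- var / (2 n))\<close>, starting with the last one.\<close>

theorem combinatorial_CLT_bound:
  "cmod (avg (perm_tuples I n) (\<lambda>\<pi>. iexp ((\<Sum>b=1..n. G (\<lambda>i. \<pi> i b)) / sqrt n)) - exp (- (var / 2)))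
    \<le> D ^ 3 / (6 * sqrt n) + D * (ln n + 1) / sqrt n + D\<^sup>2 * card I / sqrt n + D ^ 4 / (4 * real n)"
proof -
  let ?PT = "perm_tuples I n"
  define q where "q = exp (- (var / (2 * real n)))"
  have q: "0 \<le> q" "q \<le> 1" using var_nonneg n_pos by (simp_all add: q_def)
  define \<Phi> where "\<Phi> b \<pi> = iexp ((\<Sum>b'=1..b. G (\<lambda>i. \<pi> i b')) / sqrt n)" for b and \<pi> :: "'i \<Rightarrow> nat \<Rightarrow> nat"
  \<comment> \<open>The first \<open>b\<close> positions keep their factors, the other
    \<open>n - b\<close> are replaced by \<open>q\<close>. Thus \<open>E n\<close> is the
    characteristic function and \<open>E 0\<close> is
    \<open>q ^ n = exp (- var / 2)\<close>.\<close>
  define E where "E b = avg ?PT (\<Phi> b) * of_real q ^ (n - b)" for b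
  define e where "e m = D ^ 3 / (6 * real n * sqrt n) + D / sqrt n * (1 / real m)
      + D\<^sup>2 * card I / (2 * real n) * (1 / sqrt (real m)) + D ^ 4 / (4 * real n ^ 2)" for m :: nat
  have n: "real n > 0" using n_pos by simp
  have step: "cmod (E b - E (b - 1)) \<le> e (n - b + 1)" if b: "b \<in> {1..n}" for b
  proof -
    have pow: "complex_of_real q ^ (n - (b - 1)) = of_real q * of_real q ^ (n - b)"
      using b by (simp add: Suc_diff_le flip: power_Suc)
    have \<Phi>_eq: "\<Phi> b \<pi> = \<Phi> (b - 1) \<pi> * iexp (G (\<lambda>i. \<pi> i b) / sqrt n)" for \<pi>
    proof -
      have "(\<Sum>b'=1..b. G (\<lambda>i. \<pi> i b')) = (\<Sum>b'=1..b - 1. G (\<lambda>i. \<pi> i b')) + G (\<lambda>i. \<pi> i b)"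
        using b by (cases b) simp_all
      then show ?thesis
        by (simp add: \<Phi>_def add_divide_distrib distrib_left exp_add)
    qed
    have "E b - E (b - 1) = of_real q ^ (n - b)
      * avg ?PT (\<lambda>\<pi>. \<Phi> (b - 1) \<pi> * (iexp (G (\<lambda>i. \<pi> i b) / sqrt n) - of_real q))"
      unfolding E_def pow \<Phi>_eq
      by (simp add: avg_diff avg_cmult_right right_diff_distrib)
    then have "cmod (E b - E (b - 1)) = q ^ (n - b)
      * cmod (avg ?PT (\<lambda>\<pi>. \<Phi> (b - 1) \<pi> * (iexp (G (\<lambda>i. \<pi> i b) / sqrt n) - of_real q)))"
      using q by (simp add: norm_mult norm_power)
    also have "\<dots> \<le> 1 * e (n - b + 1)"
    proof (rule mult_mono)
      show "cmod (avg ?PT (\<lambda>\<pi>. \<Phi> (b - 1) \<pi> * (iexp (G (\<lambda>i. \<pi> i b) / sqrt n) - of_real q))) \<le> e (n - b + 1)"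
        unfolding e_def q_def
      proof (rule avg_iexp_step[OF b])
        \<comment> \<open>\<open>\<Phi> (b - 1)\<close> sees only positions below \<open>b\<close>,
          which the transpositions of \<open>b\<close> with some \<open>k i >= b\<close> leave
          fixed.\<close>
        fix \<pi> k assume "\<pi> \<in> ?PT" and k: "k \<in> PiE I (\<lambda>_. {b..n})"
        have "G (\<lambda>i. (\<lambda>i\<in>I. \<pi> i \<circ> Transposition.transpose b (k i)) i b') = G (\<lambda>i. \<pi> i b')"
          if "b' \<in> {1..b - 1}" for b'
        proof -
          have "Transposition.transpose b (k i) b' = b'" if "i \<in> I" for i
            using PiE_mem[OF k that] \<open>b' \<in> {1..b - 1}\<close> by (auto simp: Transposition.transpose_def)
          then show ?thesis unfolding G_def by (intro arg_cong[where f = Re] H_cong) simp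
        qed
        then show "\<Phi> (b - 1) (\<lambda>i\<in>I. \<pi> i \<circ> Transposition.transpose b (k i)) = \<Phi> (b - 1) \<pi>"
          unfolding \<Phi>_def by (simp cong: sum.cong_simp)
      qed (simp add: \<Phi>_def)
    qed (use q in \<open>auto simp: power_le_one\<close>)
    finally show ?thesis by simp
  qed
  have "E n - E 0 = (\<Sum>b=1..n. E b - E (b - 1))"
    using sum_telescope''[of 0 n E] by simp
  then have "cmod (E n - E 0) \<le> (\<Sum>b=1..n. e (n - b + 1))"
    using sum_norm_le[of "{1..n}" "\<lambda>b. E b - E (b - 1)", OF step] by simp
  \<comment> \<open>Here \<open>m = n - b + 1\<close> counts the values still available at position
    \<open>b\<close>.\<close>
  also have "\<dots> = (\<Sum>m=1..n. e m)"
    by (rule sum.reindex_bij_witness[of _ "\<lambda>m. n - m + 1" "\<lambda>m. n - m + 1"]) auto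
  also have "\<dots> = n * (D ^ 3 / (6 * real n * sqrt n)) + D / sqrt n * (\<Sum>m=1..n. 1 / real m)
      + D\<^sup>2 * card I / (2 * real n) * (\<Sum>m=1..n. 1 / sqrt (real m)) + n * (D ^ 4 / (4 * real n ^ 2))"
    unfolding e_def by (simp add: sum.distrib sum_distrib_left)
  also have "\<dots> \<le> n * (D ^ 3 / (6 * real n * sqrt n)) + D / sqrt n * (ln n + 1)
      + D\<^sup>2 * card I / (2 * real n) * (2 * sqrt n) + n * (D ^ 4 / (4 * real n ^ 2))"
  proof (intro add_mono mult_left_mono order_refl sum_inverse_sqrt_le)
    have "(\<Sum>m=1..n. 1 / real m) = harm n" by (simp add: harm_def inverse_eq_divide)
    \<comment> \<open>The difference decreases and equals 1 at \<open>n = 1\<close>; the sequence of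
      \<open>decseq_harm_diff_ln\<close> is indexed through \<open>Suc\<close>, hence the instance
      at \<open>n - 1\<close>.\<close>
    moreover have "harm n - ln (real n) \<le> harm (Suc 0) - ln (Suc 0)"
      using decseqD[OF decseq_harm_diff_ln, of 0 "n - 1"] n_pos by simp
    ultimately show "(\<Sum>m=1..n. 1 / real m) \<le> ln n + 1"
      by (simp add: harm_def)
  qed (use D_nonneg in auto)
  also have "\<dots> = D ^ 3 / (6 * sqrt n) + D * (ln n + 1) / sqrt n + D\<^sup>2 * card I / sqrt n + D ^ 4 / (4 * real n)"
    using n by (simp add: field_simps power2_eq_square real_sqrt_divide)
  finally have "cmod (E n - E 0)
    \<le> D ^ 3 / (6 * sqrt n) + D * (ln n + 1) / sqrt n + D\<^sup>2 * card I / sqrt n + D ^ 4 / (4 * real n)" .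
  moreover have "E 0 = exp (- (var / 2))"
  proof -
    have "q ^ n = exp (- (var / 2))" using n by (simp add: q_def flip: exp_of_nat_mult)
    then show ?thesis using finite_I
      by (simp add: E_def \<Phi>_def[abs_def] avg_const flip: of_real_power exp_of_real)
  qed
  moreover have "E n = avg ?PT (\<lambda>\<pi>. iexp ((\<Sum>b=1..n. G (\<lambda>i. \<pi> i b)) / sqrt n))"
    by (simp add: E_def \<Phi>_def[abs_def])
  ultimately show ?thesis by simp
qed

end

section \<open>The law of the empirical ranks\<close>

text \<open>Tonelli: a measurable set is null if all its sections along one coordinate are null. It
  is applied to single real coordinates of a point and to single observations of a sample.\<close>

lemma (in product_sigma_finite) AE_PiM_coordinate:
  assumes "finite J" "j \<in> J" and meas: "Measurable.pred (PiM J M) P"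
    and AE: "\<And>x. x \<in> space (PiM (J - {j}) M) \<Longrightarrow> AE y in M j. P (x(j := y))"
  shows "AE x in PiM J M. P x"
proof -
  have J: "insert j (J - {j}) = J" using assms(2) by auto
  let ?B = "{x \<in> space (PiM J M). \<not> P x}"
  have B: "?B \<in> sets (PiM J M)" using meas by measurable
  have "emeasure (PiM J M) ?B = (\<integral>\<^sup>+x. indicator ?B x \<partial>PiM (insert j (J - {j})) M)"
    by (simp only: J nn_integral_indicator[OF B])
  also have "\<dots> = (\<integral>\<^sup>+x. (\<integral>\<^sup>+y. indicator ?B (x(j := y)) \<partial>M j) \<partial>PiM (J - {j}) M)"
  proof (rule product_nn_integral_insert)
    show "indicator ?B \<in> borel_measurable (PiM (insert j (J - {j})) M)"
      unfolding J by (rule borel_measurable_indicator[OF B])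
  qed (use assms(1) in auto)
  also have "\<dots> = (\<integral>\<^sup>+x. 0 \<partial>PiM (J - {j}) M)"
  proof (rule nn_integral_cong)
    fix x assume x: "x \<in> space (PiM (J - {j}) M)"
    have "(\<integral>\<^sup>+y. indicator ?B (x(j := y)) \<partial>M j) = (\<integral>\<^sup>+y. 0 \<partial>M j)"
      by (rule nn_integral_cong_AE) (use AE[OF x] in eventually_elim, simp)
    then show "(\<integral>\<^sup>+y. indicator ?B (x(j := y)) \<partial>M j) = 0" by simp
  qed
  finally have "emeasure (PiM J M) ?B = 0" by simp
  then show ?thesis using AE_iff_measurable[OF B, of P] by simp
qed

lemma space_eucl: "space (eucl d) = PiE {..<d} (\<lambda>_. UNIV)"
  by (simp add: eucl_def space_PiM)

lemma measurable_eucl_component [measurable]: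
  "k < d \<Longrightarrow> (\<lambda>x. x k) \<in> borel_measurable (eucl d)"
  unfolding eucl_def
  using measurable_component_singleton[of k "{..<d}" "\<lambda>_. lborel :: real measure"] by simp

text \<open>With the other coordinates fixed, only one value of coordinate \<open>k\<close> solves
  the equation.\<close>

lemma AE_eucl_hyperplane:
  assumes "k < d" "v k \<noteq> 0"
  shows "AE y in eucl d. (\<Sum>k<d. y k * v k) \<noteq> c"
proof -
  interpret product_sigma_finite "\<lambda>_ :: nat. lborel :: real measure" ..
  show ?thesis unfolding eucl_def
  proof (rule AE_PiM_coordinate[of _ k])
    fix x :: "nat \<Rightarrow> real"
    have eq: "(\<Sum>l<d. (x(k := y)) l * v l) = y * v k + (\<Sum>l\<in>{..<d} - {k}. x l * v l)" for y
      using assms(1) by (subst sum.remove[of _ k]) auto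
    have "AE y in lborel. y \<noteq> (c - (\<Sum>l\<in>{..<d} - {k}. x l * v l)) / v k"
      by (rule AE_lborel_singleton)
    then show "AE y in lborel. (\<Sum>l<d. (x(k := y)) l * v l) \<noteq> c"
      unfolding eq by eventually_elim (use assms in \<open>auto simp: field_simps\<close>)
    show "Measurable.pred (PiM {..<d} (\<lambda>_. lborel)) (\<lambda>y. (\<Sum>l<d. y l * v l) \<noteq> c)"
      using measurable_eucl_component[of _ d] unfolding eucl_def by measurable
  qed (use assms(1) in auto)
qed

text \<open>The sample size is fixed. Every \<open>\<mu> i\<close> is a probability measure, also
  for \<open>i\<close> outside \<open>I\<close>, because families of product spaces are total. Grid
  points are extensional, so two distinct ones differ in one of the \<open>d i\<close>
  coordinates.\<close>

locale grid_sample =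
  fixes I :: "nat set" and d :: "nat \<Rightarrow> nat" and \<mu> :: "nat \<Rightarrow> (nat \<Rightarrow> real) measure"
    and g :: "nat \<Rightarrow> nat \<Rightarrow> nat \<Rightarrow> real" and n :: nat
  assumes finite_I: "finite I" and n_pos: "1 \<le> n"
    and prob_mu: "\<And>i. prob_space (\<mu> i)"
    and sets_mu: "\<And>i. i \<in> I \<Longrightarrow> sets (\<mu> i) = sets (eucl (d i))"
    and ac_mu: "\<And>i. i \<in> I \<Longrightarrow> absolutely_continuous (eucl (d i)) (\<mu> i)"
    and grid: "\<And>i j. i \<in> I \<Longrightarrow> j \<in> {1..n} \<Longrightarrow> g i j \<in> PiE {..<d i} (\<lambda>_. UNIV)"
begin

text \<open>A single product over pairs of observation and component: permuting the observations
  separately in each component is then a mere reindexing.\<close>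

definition sample :: "(nat \<times> nat \<Rightarrow> nat \<Rightarrow> real) measure" where
  "sample = PiM ({1..n} \<times> I) (\<lambda>ai. \<mu> (snd ai))"

definition cost :: "nat \<Rightarrow> (nat \<Rightarrow> nat) \<Rightarrow> (nat \<times> nat \<Rightarrow> nat \<Rightarrow> real) \<Rightarrow> real" where
  "cost i p x = (\<Sum>a=1..n. (enorm (d i) (\<lambda>k. x (a, i) k - g i (p a) k))\<^sup>2)"

definition minimizers :: "nat \<Rightarrow> (nat \<times> nat \<Rightarrow> nat \<Rightarrow> real) \<Rightarrow> (nat \<Rightarrow> nat) set" where
  "minimizers i x = {p \<in> perms n. \<forall>q\<in>perms n. cost i p x \<le> cost i q x}"

definition rank_perm :: "(nat \<times> nat \<Rightarrow> nat \<Rightarrow> real) \<Rightarrow> nat \<Rightarrow> nat \<Rightarrow> nat" where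
  "rank_perm x = (\<lambda>i\<in>I. opt_perm n (d i) (g i) (\<lambda>a. x (a, i)))"

sublocale sample_prod: product_prob_space "\<lambda>ai. \<mu> (snd ai)" "{1..n} \<times> I"
  by (intro product_prob_spaceI prob_mu)

lemma prob_sample: "prob_space sample"
  unfolding sample_def by (rule prob_space_PiM) (rule prob_mu)

section \<open>Measurability and almost sure determination of the ranks\<close>

lemma enorm_power2: "(enorm e x)\<^sup>2 = (\<Sum>k<e. (x k)\<^sup>2)"
  by (simp add: enorm_def L2_set_def sum_nonneg)

lemma measurable_coordinate:
  assumes "a \<in> {1..n}" "i \<in> I" "k < d i"
  shows "(\<lambda>x. x (a, i) k) \<in> borel_measurable sample"
proof -
  have "(\<lambda>x. x (a, i)) \<in> measurable sample (\<mu> i)"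
    unfolding sample_def
    using measurable_component_singleton[of "(a, i)" "{1..n} \<times> I" "\<lambda>ai. \<mu> (snd ai)"] assms by simp
  also have "measurable sample (\<mu> i) = measurable sample (eucl (d i))"
    using sets_mu[OF assms(2)] by (rule measurable_cong_sets[OF refl])
  finally show ?thesis
    using measurable_compose[OF _ measurable_eucl_component[OF assms(3)]] by blast
qed

lemma measurable_cost: "i \<in> I \<Longrightarrow> cost i p \<in> borel_measurable sample"
  unfolding cost_def[abs_def] enorm_power2
  by (intro borel_measurable_sum borel_measurable_power borel_measurable_diff
      measurable_coordinate borel_measurable_const) auto

text \<open>The selected permutation is a function of the finite set \<open>minimizers i x\<close>
  alone. Measurability of the ranks thereby reduces to that of a finite-valued map decided by
  finitely many comparisons of costs.\<close>

lemma opt_perm_eq: "opt_perm n (d i) (g i) (\<lambda>a. x (a, i)) = (SOME p. p \<in> minimizers i x)"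
  by (simp add: opt_perm_def arg_min_def is_arg_min_linorder minimizers_def cost_def perms_def
      conj_commute)

lemma minimizers_subset: "minimizers i x \<subseteq> perms n"
  by (auto simp: minimizers_def)

lemma minimizers_nonempty: "minimizers i x \<noteq> {}"
proof -
  obtain p where "p \<in> perms n" "\<And>q. q \<in> perms n \<Longrightarrow> cost i p x \<le> cost i q x"
    using ex_is_arg_min_if_finite[OF finite_perms perms_nonempty, of "\<lambda>p. cost i p x"]
    unfolding is_arg_min_linorder by blast
  then show ?thesis by (auto simp: minimizers_def)
qed

lemma opt_perm_minimizes: "opt_perm n (d i) (g i) (\<lambda>a. x (a, i)) \<in> minimizers i x"
  unfolding opt_perm_eq using minimizers_nonempty by (simp add: some_in_eq)

lemma rank_perm_minimizes: "i \<in> I \<Longrightarrow> rank_perm x i \<in> minimizers i x"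
  by (simp add: rank_perm_def opt_perm_minimizes)

lemma rank_perm_in: "rank_perm x \<in> perm_tuples I n"
  using opt_perm_minimizes by (auto simp: rank_perm_def perm_tuples_def minimizers_def)

lemma measurable_minimizers: "i \<in> I \<Longrightarrow> minimizers i \<in> measurable sample (count_space (Pow (perms n)))"
proof (subst measurable_count_space_eq_countable)
  assume i: "i \<in> I"
  show "countable (Pow (perms n))" by (simp add: countable_finite)
  show "minimizers i \<in> space sample \<rightarrow> Pow (perms n) \<and>
    (\<forall>A\<in>Pow (perms n). minimizers i -` {A} \<inter> space sample \<in> sets sample)"
  proof (intro conjI ballI)
    fix A assume "A \<in> Pow (perms n)"
    then have "minimizers i x = A \<longleftrightarrow>
        (\<forall>p\<in>perms n. (p \<in> A) = (\<forall>q\<in>perms n. cost i p x \<le> cost i q x))" for x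
      unfolding minimizers_def by blast
    then have "minimizers i -` {A} \<inter> space sample = {x \<in> space sample.
        \<forall>p\<in>perms n. (p \<in> A) = (\<forall>q\<in>perms n. cost i p x \<le> cost i q x)}"
      by blast
    also have "\<dots> \<in> sets sample"
    proof (rule sets.sets_Collect_finite_All')
      fix p
      have "{x \<in> space sample. \<forall>q\<in>perms n. cost i p x \<le> cost i q x} \<in> sets sample"
        using measurable_cost[OF i]
        by (intro sets.sets_Collect_finite_All' borel_measurable_le) simp_all
      from this sets.sets_Collect_neg[OF this]
      show "{x \<in> space sample. (p \<in> A) = (\<forall>q\<in>perms n. cost i p x \<le> cost i q x)} \<in> sets sample"
        by (cases "p \<in> A") simp_all
    qed simp_all
    finally show "minimizers i -` {A} \<inter> space sample \<in> sets sample" .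
  qed (use minimizers_subset in blast)
qed

lemma measurable_rank_perm: "rank_perm \<in> measurable sample (count_space (perm_tuples I n))"
proof (subst measurable_count_space_eq_countable)
  show "countable (perm_tuples I n)" using finite_I by (simp add: countable_finite)
  show "rank_perm \<in> space sample \<rightarrow> perm_tuples I n \<and>
    (\<forall>\<pi>\<in>perm_tuples I n. rank_perm -` {\<pi>} \<inter> space sample \<in> sets sample)"
  proof (intro conjI ballI)
    fix \<pi> assume \<pi>: "\<pi> \<in> perm_tuples I n"
    have "rank_perm -` {\<pi>} \<inter> space sample = {x \<in> space sample.
        \<forall>i\<in>I. minimizers i x \<in> {A. (SOME p. p \<in> A) = \<pi> i}}"
    proof -
      have "rank_perm x = \<pi> \<longleftrightarrow> (\<forall>i\<in>I. rank_perm x i = \<pi> i)" for x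
        using PiE_ext[OF rank_perm_in[unfolded perm_tuples_def] \<pi>[unfolded perm_tuples_def]] by blast
      then show ?thesis by (auto simp: rank_perm_def opt_perm_eq)
    qed
    also have "\<dots> \<in> sets sample"
    proof (rule sets.sets_Collect_finite_All)
      fix i assume i: "i \<in> I"
      have "minimizers i -` ({A. (SOME p. p \<in> A) = \<pi> i} \<inter> Pow (perms n)) \<inter> space sample \<in> sets sample"
        by (rule measurable_sets[OF measurable_minimizers[OF i]]) simp
      also have "minimizers i -` ({A. (SOME p. p \<in> A) = \<pi> i} \<inter> Pow (perms n)) \<inter> space sample
        = {x \<in> space sample. minimizers i x \<in> {A. (SOME p. p \<in> A) = \<pi> i}}"
        using minimizers_subset by blast
      finally show "{x \<in> space sample. minimizers i x \<in> {A. (SOME p. p \<in> A) = \<pi> i}} \<in> sets sample" .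
    qed (use finite_I in auto)
    finally show "rank_perm -` {\<pi>} \<inter> space sample \<in> sets sample" .
  qed (use rank_perm_in in auto)
qed

text \<open>The squares of the data cancel in the difference of two costs, which is therefore affine
  in each observation. In observation \<open>a\<close> its gradient is twice the nonzero difference
  of the assigned grid points, so equality confines that observation to a hyperplane, a null set by
  absolute continuity.\<close>

lemma AE_cost_neq:
  assumes i: "i \<in> I" and p: "p \<in> perms n" and q: "q \<in> perms n"
    and a: "a \<in> {1..n}" "g i (p a) \<noteq> g i (q a)"
  shows "AE x in sample. cost i p x \<noteq> cost i q x"
proof -
  define v where "v a k = 2 * (g i (q a) k - g i (p a) k)" for a k
  define c where "c a = (\<Sum>k<d i. (g i (p a) k)\<^sup>2 - (g i (q a) k)\<^sup>2)" for a
  have dif: "cost i p x - cost i q x = (\<Sum>a=1..n. (\<Sum>k<d i. x (a, i) k * v a k) + c a)" for x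
    unfolding cost_def enorm_power2 v_def c_def sum_subtractf[symmetric] sum.distrib[symmetric]
    by (intro sum.cong refl) (simp add: power2_eq_square algebra_simps)
  have "\<exists>k<d i. g i (p a) k \<noteq> g i (q a) k"
  proof (rule ccontr)
    assume "\<not> ?thesis"
    then have "g i (p a) = g i (q a)"
      using grid[OF i perms_in[OF p a(1)]] grid[OF i perms_in[OF q a(1)]]
      by (intro PiE_ext) auto
    with a(2) show False by simp
  qed
  then obtain k where k: "k < d i" "v a k \<noteq> 0" by (auto simp: v_def)
  have "AE x in sample. cost i p x - cost i q x \<noteq> 0"
    unfolding sample_def
  proof (rule sample_prod.AE_PiM_coordinate[of _ "(a, i)"])
    show "finite ({1..n} \<times> I)" using finite_I by simp
    show "(a, i) \<in> {1..n} \<times> I" using a i by simp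
    show "Measurable.pred (PiM ({1..n} \<times> I) (\<lambda>ai. \<mu> (snd ai))) (\<lambda>x. cost i p x - cost i q x \<noteq> 0)"
      using measurable_cost[OF i, of p] measurable_cost[OF i, of q] unfolding sample_def by measurable
    fix x :: "nat \<times> nat \<Rightarrow> nat \<Rightarrow> real"
    define e where "e = (\<Sum>b\<in>{1..n} - {a}. (\<Sum>k<d i. x (b, i) k * v b k) + c b) + c a"
    have eq: "cost i p (x((a, i) := y)) - cost i q (x((a, i) := y)) = (\<Sum>k<d i. y k * v a k) + e" for y
      unfolding dif e_def using a(1) by (subst sum.remove[of _ a]) auto
    have "AE y in eucl (d i). (\<Sum>k<d i. y k * v a k) \<noteq> - e"
      by (rule AE_eucl_hyperplane[where v = "v a"]) (use k in auto)
    then have "AE y in \<mu> i. (\<Sum>k<d i. y k * v a k) \<noteq> - e"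
      by (rule absolutely_continuous_AE[OF sets_mu[OF i] ac_mu[OF i]])
    then show "AE y in \<mu> (snd (a, i)). cost i p (x((a, i) := y)) - cost i q (x((a, i) := y)) \<noteq> 0"
      unfolding eq snd_conv by eventually_elim auto
  qed
  then show ?thesis by eventually_elim simp
qed

text \<open>Equal costs force equal ranks, not equal permutations: repeated grid points can be
  interchanged at no cost.\<close>

lemma AE_cost_inj:
  "AE x in sample. \<forall>i\<in>I. \<forall>p\<in>perms n. \<forall>q\<in>perms n. cost i p x = cost i q x \<longrightarrow> (\<forall>a\<in>{1..n}. g i (p a) = g i (q a))"
proof -
  have "AE x in sample. cost i p x = cost i q x \<longrightarrow> (\<forall>a\<in>{1..n}. g i (p a) = g i (q a))"
    if "i \<in> I" "p \<in> perms n" "q \<in> perms n" for i p q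
  proof (cases "\<forall>a\<in>{1..n}. g i (p a) = g i (q a)")
    case False
    then obtain a where "a \<in> {1..n}" "g i (p a) \<noteq> g i (q a)" by blast
    from AE_cost_neq[OF that this] show ?thesis by eventually_elim simp
  qed simp
  then show ?thesis
    using finite_I by (intro AE_finite_allI) auto
qed

section \<open>Relabelling of observations and uniformity of the ranks\<close>

lemma cost_permuted:
  assumes t: "t permutes {1..n}" and y: "\<And>a. a \<in> {1..n} \<Longrightarrow> y (a, i) = x (t a, i)"
  shows "cost i p y = cost i (p \<circ> inv t) x"
proof -
  have "cost i p y = (\<Sum>a=1..n. (enorm (d i) (\<lambda>k. x (t a, i) k - g i ((p \<circ> inv t) (t a)) k))\<^sup>2)"
    unfolding cost_def by (intro sum.cong refl) (simp add: y permutes_inverses[OF t])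
  also have "\<dots> = cost i (p \<circ> inv t) x"
    unfolding cost_def
    by (rule sum.reindex_bij_betw[OF permutes_imp_bij[OF t],
        of "\<lambda>b. (enorm (d i) (\<lambda>k. x (b, i) k - g i ((p \<circ> inv t) b) k))\<^sup>2"])
  finally show ?thesis .
qed

text \<open>If \<open>p\<close> is optimal for the relabelled sample, then
  \<open>p \<circ> inv (\<tau> i)\<close> is optimal for the original one. It has the same cost as
  the permutation selected there, so by hypothesis \<open>x\<close> both assign the same grid
  points.\<close>

lemma rank_perm_permuted:
  assumes x: "\<forall>i\<in>I. \<forall>p\<in>perms n. \<forall>q\<in>perms n. cost i p x = cost i q x \<longrightarrow> (\<forall>a\<in>{1..n}. g i (p a) = g i (q a))"
    and \<tau>: "\<tau> \<in> perm_tuples I n" and i: "i \<in> I" and a: "a \<in> {1..n}"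
  shows "g i (rank_perm (\<lambda>ai\<in>{1..n} \<times> I. x (\<tau> (snd ai) (fst ai), snd ai)) i a)
    = g i (rank_perm x i (\<tau> i a))"
proof -
  let ?y = "\<lambda>ai\<in>{1..n} \<times> I. x (\<tau> (snd ai) (fst ai), snd ai)"
  have \<tau>i: "\<tau> i \<in> perms n" using PiE_mem[OF \<tau>[unfolded perm_tuples_def] i] .
  then have t: "\<tau> i permutes {1..n}" by (simp add: perms_def)
  have cost: "cost i p ?y = cost i (p \<circ> inv (\<tau> i)) x" for p
    by (rule cost_permuted[OF t]) (use i in auto)
  define p where "p = rank_perm ?y i"
  define q where "q = rank_perm x i"
  have p: "p \<in> minimizers i ?y" and q: "q \<in> minimizers i x"
    unfolding p_def q_def by (rule rank_perm_minimizes[OF i])+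
  have it: "inv (\<tau> i) \<in> perms n" using t by (simp add: perms_def permutes_inv)
  have p': "p \<circ> inv (\<tau> i) \<in> perms n" and q': "q \<circ> \<tau> i \<in> perms n"
    using p q it \<tau>i by (auto simp: minimizers_def perms_def intro: permutes_compose)
  have "cost i q x \<le> cost i (p \<circ> inv (\<tau> i)) x"
    using q p' by (simp add: minimizers_def)
  moreover have "cost i (p \<circ> inv (\<tau> i)) x \<le> cost i q x"
  proof -
    have "cost i p ?y \<le> cost i (q \<circ> \<tau> i) ?y" using p q' by (simp add: minimizers_def)
    then have "cost i (p \<circ> inv (\<tau> i)) x \<le> cost i (q \<circ> \<tau> i \<circ> inv (\<tau> i)) x" by (simp only: cost)
    then show ?thesis by (simp add: o_assoc[symmetric] permutes_inv_o[OF t])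
  qed
  ultimately have "cost i (p \<circ> inv (\<tau> i)) x = cost i q x" by simp
  moreover have "q \<in> perms n" using q by (simp add: minimizers_def)
  moreover have "\<tau> i a \<in> {1..n}" by (rule perms_in[OF \<tau>i a])
  ultimately have "g i ((p \<circ> inv (\<tau> i)) (\<tau> i a)) = g i (q (\<tau> i a))"
    using x i p' by blast
  then show ?thesis by (simp add: p_def q_def permutes_inverses[OF t])
qed

text \<open>Observations may be relabelled by a different permutation in each component because
  components are independent; the reindexing of pairs keeps the component and hence the factor
  measure.\<close>

lemma distr_sample_permuted:
  assumes \<tau>: "\<tau> \<in> perm_tuples I n"
  shows "distr sample sample (\<lambda>x. \<lambda>ai\<in>{1..n} \<times> I. x (\<tau> (snd ai) (fst ai), snd ai)) = sample"
proof -
  let ?J = "{1..n} \<times> I" and ?f = "\<lambda>ai. (\<tau> (snd ai) (fst ai), snd ai)"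
  have perm: "\<tau> i permutes {1..n}" if "i \<in> I" for i
    using PiE_mem[OF \<tau>[unfolded perm_tuples_def] that] by (simp add: perms_def)
  have inj: "inj_on ?f ?J"
    using perm by (auto simp: inj_on_def dest: permutes_inj injD)
  have into: "?f \<in> ?J \<rightarrow> ?J"
    using perm_tuples_in[OF \<tau>] by (auto simp del: atLeastAtMost_iff)
  show ?thesis
    using distr_PiM_reindex[of ?J "\<lambda>ai. \<mu> (snd ai)", OF prob_mu inj into]
    by (simp add: sample_def)
qed

text \<open>The integral is unchanged when the ranks are composed with any tuple
  \<open>\<tau>\<close>, so it may be averaged over \<open>\<tau>\<close>. For a fixed sample the
  composition runs through all tuples exactly once, which makes the inner average deterministic.
  Since \<open>\<Psi>\<close> sees only rank values, ambiguous permutations cause no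
  trouble.\<close>

theorem integral_rank_perm:
  fixes \<Psi> :: "(nat \<Rightarrow> nat \<Rightarrow> nat \<Rightarrow> real) \<Rightarrow> real"
  assumes \<Psi>: "\<And>R R'. (\<And>i a. i \<in> I \<Longrightarrow> a \<in> {1..n} \<Longrightarrow> R i a = R' i a) \<Longrightarrow> \<Psi> R = \<Psi> R'"
  shows "(\<integral>x. \<Psi> (\<lambda>i a. g i (rank_perm x i a)) \<partial>sample)
    = avg (perm_tuples I n) (\<lambda>\<pi>. \<Psi> (\<lambda>i a. g i (\<pi> i a)))"
proof -
  interpret prob_space sample by (rule prob_sample)
  let ?PT = "perm_tuples I n"
  define f where "f \<pi> = \<Psi> (\<lambda>i a. g i (\<pi> i a))" for \<pi>
  have f_cong: "f \<pi> = f \<pi>'" if "\<And>i a. i \<in> I \<Longrightarrow> a \<in> {1..n} \<Longrightarrow> g i (\<pi> i a) = g i (\<pi>' i a)" for \<pi> \<pi>'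
    unfolding f_def by (rule \<Psi>) (rule that)
  have meas: "(\<lambda>x. F (rank_perm x)) \<in> borel_measurable sample" for F :: "_ \<Rightarrow> real"
    by (rule measurable_compose[OF measurable_rank_perm]) simp
  have int: "integrable sample (\<lambda>x. F (rank_perm x))" for F :: "_ \<Rightarrow> real"
  proof (rule integrable_const_bound[where B = "Max ((\<lambda>\<pi>. \<bar>F \<pi>\<bar>) ` ?PT)"])
    show "AE x in sample. norm (F (rank_perm x)) \<le> Max ((\<lambda>\<pi>. \<bar>F \<pi>\<bar>) ` ?PT)"
      using rank_perm_in finite_I by (intro AE_I2) (auto intro!: Max_ge)
  qed (rule meas)
  have inv: "(\<integral>x. f (rank_perm x) \<partial>sample) = (\<integral>x. f (\<lambda>i\<in>I. rank_perm x i \<circ> \<tau> i) \<partial>sample)"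
    if \<tau>: "\<tau> \<in> ?PT" for \<tau>
  proof -
    let ?T = "\<lambda>x. \<lambda>ai\<in>{1..n} \<times> I. x (\<tau> (snd ai) (fst ai), snd ai)"
    have T: "?T \<in> measurable sample sample"
      unfolding sample_def
    proof (rule measurable_restrict)
      fix ai assume ai: "ai \<in> {1..n} \<times> I"
      then have "(\<tau> (snd ai) (fst ai), snd ai) \<in> {1..n} \<times> I"
        using perm_tuples_in[OF \<tau>] by (auto simp del: atLeastAtMost_iff)
      from measurable_component_singleton[OF this, of "\<lambda>ai. \<mu> (snd ai)"]
      show "(\<lambda>x. x (\<tau> (snd ai) (fst ai), snd ai)) \<in> measurable (PiM ({1..n} \<times> I) (\<lambda>ai. \<mu> (snd ai))) (\<mu> (snd ai))"
        by simp
    qed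
    have "(\<integral>x. f (rank_perm x) \<partial>sample) = (\<integral>x. f (rank_perm x) \<partial>distr sample sample ?T)"
      by (simp only: distr_sample_permuted[OF \<tau>])
    also have "\<dots> = (\<integral>x. f (rank_perm (?T x)) \<partial>sample)"
      by (rule integral_distr[OF T meas])
    also have "\<dots> = (\<integral>x. f (\<lambda>i\<in>I. rank_perm x i \<circ> \<tau> i) \<partial>sample)"
    proof (rule integral_cong_AE)
      show "AE x in sample. f (rank_perm (?T x)) = f (\<lambda>i\<in>I. rank_perm x i \<circ> \<tau> i)"
        using AE_cost_inj
      proof eventually_elim
        case (elim x)
        show ?case
        proof (rule f_cong)
          fix i a assume "i \<in> I" "a \<in> {1..n}"
          then show "g i (rank_perm (?T x) i a) = g i ((\<lambda>i\<in>I. rank_perm x i \<circ> \<tau> i) i a)"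
            by (simp only: rank_perm_permuted[OF elim \<tau>] restrict_apply' comp_apply)
        qed
      qed
      show "(\<lambda>x. f (rank_perm (?T x))) \<in> borel_measurable sample"
        by (rule measurable_compose[OF T meas])
    qed (rule meas)
    finally show ?thesis .
  qed
  have "(\<integral>x. f (rank_perm x) \<partial>sample) = avg ?PT (\<lambda>\<tau>. \<integral>x. f (rank_perm x) \<partial>sample)"
    using finite_I by (simp add: avg_const)
  also have "\<dots> = avg ?PT (\<lambda>\<tau>. \<integral>x. f (\<lambda>i\<in>I. rank_perm x i \<circ> \<tau> i) \<partial>sample)"
    by (rule avg_cong) (rule inv)
  also have "\<dots> = (\<integral>x. avg ?PT (\<lambda>\<tau>. f (\<lambda>i\<in>I. rank_perm x i \<circ> \<tau> i)) \<partial>sample)"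
    unfolding avg_def
    using Bochner_Integration.integral_sum[of ?PT sample "\<lambda>\<tau> x. f (\<lambda>i\<in>I. rank_perm x i \<circ> \<tau> i)"]
      int[of "\<lambda>\<pi>. f (\<lambda>i\<in>I. \<pi> i \<circ> _ i)"] by simp
  also have "\<dots> = (\<integral>x. avg ?PT f \<partial>sample)"
  proof (rule Bochner_Integration.integral_cong[OF refl])
    fix x
    have "rank_perm x i \<in> perms n" if "i \<in> I" for i
      using PiE_mem[OF rank_perm_in[unfolded perm_tuples_def] that] .
    then show "avg ?PT (\<lambda>\<tau>. f (\<lambda>i\<in>I. rank_perm x i \<circ> \<tau> i)) = avg ?PT f"
      unfolding perm_tuples_def
      by (intro avg_bij[symmetric] bij_betw_PiE_map bij_betw_perms_comp_left)
  qed
  finally show ?thesis by (simp add: f_def[abs_def] prob_space)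
qed

text \<open>Both laws agree on rectangles: independence of the observations multiplies over
  \<open>a\<close>, and the product form of each law multiplies over \<open>i\<close>.\<close>

lemma distr_sample:
  fixes M :: "'w measure" and X :: "nat \<Rightarrow> 'w \<Rightarrow> nat \<Rightarrow> nat \<Rightarrow> real"
  assumes M: "prob_space M"
    and indep: "prob_space.indep_vars M (\<lambda>_. eucl_prod d I) X {1..n}"
    and distr: "\<And>a. a \<in> {1..n} \<Longrightarrow> distr M (eucl_prod d I) (X a) = PiM I \<mu>"
  shows "(\<lambda>\<omega>. \<lambda>ai\<in>{1..n} \<times> I. X (fst ai) \<omega> (snd ai)) \<in> measurable M sample"
    and "distr M sample (\<lambda>\<omega>. \<lambda>ai\<in>{1..n} \<times> I. X (fst ai) \<omega> (snd ai)) = sample"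
proof -
  interpret M: prob_space M by fact
  interpret mu: product_prob_space \<mu> I
    by (intro product_prob_spaceI prob_mu)
  let ?J = "{1..n} \<times> I" and ?F = "\<lambda>\<omega>. \<lambda>ai\<in>{1..n} \<times> I. X (fst ai) \<omega> (snd ai)"
  have rv: "X a \<in> measurable M (eucl_prod d I)" if "a \<in> {1..n}" for a
    using indep that unfolding M.indep_vars_def by blast
  have sets_prod: "sets (eucl_prod d I) = sets (PiM I \<mu>)"
    unfolding eucl_prod_def by (rule sets_PiM_cong) (simp_all add: sets_mu)
  show F: "?F \<in> measurable M sample"
    unfolding sample_def
  proof (rule measurable_restrict)
    fix ai assume ai: "ai \<in> ?J"
    have "X (fst ai) \<in> measurable M (PiM I \<mu>)"
      using rv[of "fst ai"] ai measurable_cong_sets[OF refl sets_prod, of M] by fastforce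
    from measurable_compose[OF this measurable_component_singleton[of "snd ai" I \<mu>]] ai
    show "(\<lambda>\<omega>. X (fst ai) \<omega> (snd ai)) \<in> measurable M (\<mu> (snd ai))" by auto
  qed
  show "distr M sample ?F = sample"
    unfolding sample_def
  proof (rule sample_prod.PiM_eqI)
    show "finite ?J" using finite_I by simp
    fix A assume A: "\<And>ai. ai \<in> ?J \<Longrightarrow> A ai \<in> sets (\<mu> (snd ai))"
    define B where "B a = PiE I (\<lambda>i. A (a, i))" for a
    have B: "B a \<in> sets (PiM I \<mu>)" if "a \<in> {1..n}" for a
      unfolding B_def using A[of "(a, _)"] that by (intro sets_PiM_I_finite finite_I) auto
    have sp: "X a \<omega> \<in> PiE I (\<lambda>i. space (\<mu> i))" if "a \<in> {1..n}" "\<omega> \<in> space M" for a \<omega>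
      using measurable_space[OF rv[OF that(1)] that(2)] sets_eq_imp_space_eq[OF sets_prod]
      by (simp add: space_PiM)
    \<comment> \<open>Uses \<open>n >= 1\<close>: an intersection over an empty index set would be
      \<open>UNIV\<close> instead of \<open>space M\<close>.\<close>
    have "?F -` PiE ?J A \<inter> space M = (\<Inter>a\<in>{1..n}. X a -` B a \<inter> space M)"
      using n_pos sp unfolding B_def by (fastforce simp: PiE_iff extensional_def)
    then have "emeasure (distr M (PiM ?J (\<lambda>ai. \<mu> (snd ai))) ?F) (PiE ?J A)
      = emeasure M (\<Inter>a\<in>{1..n}. X a -` B a \<inter> space M)"
      using F A finite_I by (subst emeasure_distr) (auto simp: sample_def intro!: sets_PiM_I_finite)
    also have "\<dots> = (\<Prod>a\<in>{1..n}. M.prob (X a -` B a \<inter> space M))"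
      unfolding M.emeasure_eq_measure
      using n_pos B sets_prod by (subst M.indep_varsD[OF indep]) auto
    also have "\<dots> = (\<Prod>a\<in>{1..n}. emeasure M (X a -` B a \<inter> space M))"
      by (simp add: M.emeasure_eq_measure prod_ennreal)
    also have "\<dots> = (\<Prod>a\<in>{1..n}. emeasure (PiM I \<mu>) (B a))"
    proof (rule prod.cong[OF refl])
      fix a assume a: "a \<in> {1..n}"
      show "emeasure M (X a -` B a \<inter> space M) = emeasure (PiM I \<mu>) (B a)"
        using emeasure_distr[OF rv[OF a], of "B a"] B[OF a] sets_prod by (simp add: distr[OF a])
    qed
    also have "\<dots> = (\<Prod>a\<in>{1..n}. \<Prod>i\<in>I. emeasure (\<mu> i) (A (a, i)))"
      unfolding B_def using A finite_I
      by (intro prod.cong refl mu.emeasure_PiM) auto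
    also have "\<dots> = (\<Prod>ai\<in>?J. emeasure (\<mu> (snd ai)) (A ai))"
      by (simp add: prod.cartesian_product split_def)
    finally show "emeasure (distr M (PiM ?J (\<lambda>ai. \<mu> (snd ai))) ?F) (PiE ?J A)
      = (\<Prod>ai\<in>?J. emeasure (\<mu> (snd ai)) (A ai))" .
  qed simp
qed

end

section \<open>Laplace transforms and weak convergence\<close>

text \<open>The library has these separation instances only for countable index types and metric
  spaces, whereas the components of the limit are indexed by sets of natural numbers.\<close>

lemma open_coordinate_vimage: "open U \<Longrightarrow> open ((\<lambda>f :: 'a \<Rightarrow> 'b::topological_space. f i) -` U)"
  by (rule open_vimage[OF _ continuous_on_product_coordinates])

instance "fun" :: (type, t0_space) t0_space
proof
  fix x y :: "'a \<Rightarrow> 'b"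
  assume "x \<noteq> y"
  then obtain i where "x i \<noteq> y i" by auto
  then have "\<exists>U. open U \<and> \<not> (x i \<in> U \<longleftrightarrow> y i \<in> U)"
    by (rule separation_t0[THEN iffD1])
  then obtain U where U: "open U" "\<not> (x i \<in> U \<longleftrightarrow> y i \<in> U)"
    by (elim exE conjE)
  have "open ((\<lambda>f :: 'a \<Rightarrow> 'b. f i) -` U)"
    by (rule open_coordinate_vimage[OF U(1)])
  with U show "\<exists>U. open U \<and> \<not> (x \<in> U \<longleftrightarrow> y \<in> U)"
    by (intro exI[of _ "(\<lambda>f. f i) -` U"]) auto
qed

instance "fun" :: (type, t1_space) t1_space
proof
  fix x y :: "'a \<Rightarrow> 'b"
  assume "x \<noteq> y"
  then obtain i where "x i \<noteq> y i" by auto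
  then have "\<exists>U. open U \<and> x i \<in> U \<and> y i \<notin> U"
    by (rule separation_t1[THEN iffD1])
  then obtain U where U: "open U" "x i \<in> U" "y i \<notin> U"
    by (elim exE conjE)
  have "open ((\<lambda>f :: 'a \<Rightarrow> 'b. f i) -` U)"
    by (rule open_coordinate_vimage[OF U(1)])
  with U show "\<exists>U. open U \<and> x \<in> U \<and> y \<notin> U"
    by (intro exI[of _ "(\<lambda>f. f i) -` U"]) auto
qed

instance "fun" :: (type, t2_space) t2_space
proof
  fix x y :: "'a \<Rightarrow> 'b"
  assume "x \<noteq> y"
  then obtain i where "x i \<noteq> y i" by auto
  then obtain U V where UV: "open U" "open V" "x i \<in> U" "y i \<in> V" "U \<inter> V = {}"
    using hausdorff[OF \<open>x i \<noteq> y i\<close>] by (elim exE conjE)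
  have "open ((\<lambda>f :: 'a \<Rightarrow> 'b. f i) -` U)" "open ((\<lambda>f :: 'a \<Rightarrow> 'b. f i) -` V)"
    by (rule open_coordinate_vimage[OF UV(1)], rule open_coordinate_vimage[OF UV(2)])
  with UV show "\<exists>U V. open U \<and> open V \<and> x \<in> U \<and> y \<in> V \<and> U \<inter> V = {}"
    by (intro exI[of _ "(\<lambda>f. f i) -` U"] exI[of _ "(\<lambda>f. f i) -` V"]) auto
qed

text \<open>Extensional functions are a full product with the singleton \<open>{undefined}\<close>
  outside \<open>I\<close>, so Tychonoff's theorem applies.\<close>

lemma compact_PiE_Icc: "compact (PiE I (\<lambda>_. {a..b::real}))"
proof -
  have "PiE I (\<lambda>_. {a..b}) = PiE UNIV (\<lambda>i. if i \<in> I then {a..b} else {undefined})"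
    by (auto simp: PiE_iff extensional_def fun_eq_iff split: if_splits)
  then have "compactin (product_topology (\<lambda>_. euclidean) UNIV) (PiE I (\<lambda>_. {a..b}))"
    by (simp add: compactin_PiE)
  then show ?thesis by (simp add: euclidean_product_topology)
qed

text \<open>Only continuity on extensional functions is available, and the sigma-algebra is the
  product over \<open>I\<close>. Rounding all coordinates in \<open>I\<close> down to multiples of
  \<open>1 / Suc m\<close> gives maps with countably many values, hence measurable compositions with
  \<open>f\<close>, and these converge pointwise to \<open>f\<close>.\<close>

lemma continuous_imp_measurable_PiM:
  fixes f :: "('i \<Rightarrow> real) \<Rightarrow> real"
  assumes I: "finite I" and f: "continuous_on (PiE I (\<lambda>_. UNIV)) f"
  shows "f \<in> borel_measurable (PiM I (\<lambda>_. borel))"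
proof (rule borel_measurable_LIMSEQ_real)
  let ?M = "PiM I (\<lambda>_. borel :: real measure)"
  define fl where "fl m x = (\<lambda>i\<in>I. \<lfloor>real (Suc m) * x i\<rfloor>)" for m and x :: "'i \<Rightarrow> real"
  define un where "un m z = (\<lambda>i\<in>I. real_of_int (z i) / real (Suc m))" for m and z :: "'i \<Rightarrow> int"
  have fl: "fl m \<in> measurable ?M (count_space (PiE I (\<lambda>_. UNIV)))" for m
  proof (subst measurable_count_space_eq_countable)
    show "countable (PiE I (\<lambda>_. UNIV :: int set))" by (rule countable_PiE[OF I]) simp
    show "fl m \<in> space ?M \<rightarrow> PiE I (\<lambda>_. UNIV) \<and> (\<forall>z\<in>PiE I (\<lambda>_. UNIV). fl m -` {z} \<inter> space ?M \<in> sets ?M)"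
    proof (intro conjI ballI)
      fix z :: "'i \<Rightarrow> int" assume z: "z \<in> PiE I (\<lambda>_. UNIV)"
      have "fl m x = z \<longleftrightarrow> (\<forall>i\<in>I. \<lfloor>real (Suc m) * x i\<rfloor> = z i)" for x
        using z by (auto simp: fl_def fun_eq_iff PiE_iff extensional_def)
      then have "fl m -` {z} \<inter> space ?M = {x \<in> space ?M. \<forall>i\<in>I. \<lfloor>real (Suc m) * x i\<rfloor> = z i}"
        by blast
      also have "\<dots> \<in> sets ?M"
      proof (rule sets.sets_Collect_finite_All[OF _ I])
        fix i assume "i \<in> I"
        then have [measurable]: "(\<lambda>x. x i) \<in> borel_measurable ?M" by simp
        show "{x \<in> space ?M. \<lfloor>real (Suc m) * x i\<rfloor> = z i} \<in> sets ?M" by measurable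
      qed
      finally show "fl m -` {z} \<inter> space ?M \<in> sets ?M" .
    qed (auto simp: fl_def)
  qed
  show "(\<lambda>x. f (un m (fl m x))) \<in> borel_measurable ?M" for m
    by (rule measurable_compose[OF fl]) simp
  fix x assume x: "x \<in> space ?M"
  \<comment> \<open>Convergence in the product topology is checked coordinatewise; outside
    \<open>I\<close> both sides are \<open>undefined\<close>.\<close>
  have "(\<lambda>m. un m (fl m x)) \<longlonglongrightarrow> x"
  proof (subst limitin_canonical_iff[symmetric], subst euclidean_product_topology[symmetric],
      subst limitin_componentwise, intro conjI ballI, simp_all only: limitin_canonical_iff)
    fix i
    show "(\<lambda>m. un m (fl m x) i) \<longlonglongrightarrow> x i"
    proof (cases "i \<in> I")
      case True
      have bnd: "\<bar>of_int \<lfloor>real (Suc m) * y\<rfloor> / real (Suc m) - y\<bar> \<le> 1 / real (Suc m)" for m y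
      proof -
        have "\<bar>of_int \<lfloor>real (Suc m) * y\<rfloor> - real (Suc m) * y\<bar> \<le> 1" by linarith
        moreover have "of_int \<lfloor>real (Suc m) * y\<rfloor> / real (Suc m) - y
          = (of_int \<lfloor>real (Suc m) * y\<rfloor> - real (Suc m) * y) / real (Suc m)"
          by (simp add: field_simps)
        ultimately show ?thesis by (simp only: abs_divide abs_of_nat divide_right_mono of_nat_0_le_iff)
      qed
      have "(\<lambda>m. of_int \<lfloor>real (Suc m) * x i\<rfloor> / real (Suc m) - x i) \<longlonglongrightarrow> 0"
        by (rule Lim_null_comparison[OF always_eventually LIMSEQ_Suc[OF lim_1_over_n]])
           (simp only: real_norm_def bnd simp_thms)
      then have "(\<lambda>m. of_int \<lfloor>real (Suc m) * x i\<rfloor> / real (Suc m)) \<longlonglongrightarrow> x i"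
        by (simp only: LIM_zero_iff)
      with True show ?thesis by (simp add: un_def fl_def)
    next
      case False
      have "x i = undefined" using x False by (auto simp: space_PiM PiE_iff extensional_def)
      with False show ?thesis by (simp add: un_def)
    qed
  qed (simp_all add: extensional_def)
  moreover have "un m z \<in> PiE I (\<lambda>_. UNIV)" for m z by (simp add: un_def)
  ultimately show "(\<lambda>m. f (un m (fl m x))) \<longlonglongrightarrow> f x"
    using x by (intro continuous_on_tendsto_compose[OF f]) (auto simp: space_PiM)
qed

text \<open>Polynomials in the coordinates from \<open>I\<close>, generated so that induction meets
  only monomials and sums. At \<open>y i = exp (- x i)\<close> a monomial becomes a multiple of the
  exponential whose integral is a Laplace transform.\<close>

inductive_set monomial_sums :: "'i set \<Rightarrow> (('i \<Rightarrow> real) \<Rightarrow> real) set" for I where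
  monomial: "(\<lambda>y. c * (\<Prod>i\<in>I. y i ^ p i)) \<in> monomial_sums I"
| add: "f \<in> monomial_sums I \<Longrightarrow> g \<in> monomial_sums I \<Longrightarrow> (\<lambda>y. f y + g y) \<in> monomial_sums I"

lemma monomial_sums_mult:
  assumes "f \<in> monomial_sums I" "g \<in> monomial_sums I"
  shows "(\<lambda>y. f y * g y) \<in> monomial_sums I"
  using assms
proof (induction f)
  case (monomial c p)
  then show ?case
  proof (induction g)
    case (monomial c' p')
    have "(\<lambda>y. (c * c') * (\<Prod>i\<in>I. y i ^ (p i + p' i))) \<in> monomial_sums I"
      by (rule monomial_sums.monomial)
    then show ?case by (simp add: power_add prod.distrib mult_ac)
  next
    case (add f g)
    then show ?case by (simp add: distrib_left monomial_sums.add)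
  qed
next
  case (add f h)
  then show ?case by (simp add: distrib_right monomial_sums.add)
qed

lemma continuous_on_monomial_sums: "f \<in> monomial_sums I \<Longrightarrow> continuous_on S f"
  by (induction rule: monomial_sums.induct)
     (auto intro!: continuous_intros continuous_on_product_coordinates[THEN continuous_on_subset])

text \<open>Distinct extensional points differ in a coordinate \<open>i\<close> of \<open>I\<close>,
  and the monomial with exponent 1 at \<open>i\<close> and 0 elsewhere separates them.\<close>

lemma monomial_sums_dense:
  assumes I: "finite I" and g: "continuous_on (PiE I (\<lambda>_. {0..1})) g" and e: "0 < e"
  shows "\<exists>q\<in>monomial_sums I. \<forall>y\<in>PiE I (\<lambda>_. {0..1}). \<bar>g y - q y\<bar> < e"
proof -
  interpret function_ring_on "monomial_sums I" "PiE I (\<lambda>_. {0..1})"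
  proof
    fix c show "(\<lambda>_. c) \<in> monomial_sums I"
      using monomial_sums.monomial[of c "\<lambda>_. 0" I] by simp
  next
    fix x y :: "'a \<Rightarrow> real" assume xy: "x \<in> PiE I (\<lambda>_. {0..1})" "y \<in> PiE I (\<lambda>_. {0..1})" "x \<noteq> y"
    then obtain i where i: "i \<in> I" "x i \<noteq> y i" by (metis PiE_ext)
    have "(\<Prod>j\<in>I. z j ^ (if j = i then 1 else 0)) = z i" for z :: "'a \<Rightarrow> real"
      using I i by (subst prod.remove[of _ i]) (auto intro!: prod.neutral)
    then have m: "(\<lambda>z. z i) \<in> monomial_sums I"
      using monomial_sums.monomial[of 1 "\<lambda>j. if j = i then 1 else 0" I] by simp
    show "\<exists>f\<in>monomial_sums I. f x \<noteq> f y" by (rule bexI[OF _ m]) (rule i(2))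
  next
    show "compact (PiE I (\<lambda>_. {0..1::real}))" by (rule compact_PiE_Icc)
  next
    fix f assume "f \<in> monomial_sums I"
    then show "continuous_on (PiE I (\<lambda>_. {0..1})) f" by (rule continuous_on_monomial_sums)
  next
    fix f g assume "f \<in> monomial_sums I" "g \<in> monomial_sums I"
    then show "(\<lambda>x. f x + g x) \<in> monomial_sums I" "(\<lambda>x. f x * g x) \<in> monomial_sums I"
      by (fact monomial_sums.add, fact monomial_sums_mult)
  qed
  show ?thesis using Stone_Weierstrass_basic[OF g e] by simp
qed

text \<open>In the coordinates \<open>exp (- V n \<omega> i) \<in> {0..1}\<close>, the Laplace transform at integer points is the
  sequence of mixed moments, so Stone--Weierstrass applies; the bound on the means gives tightness.\<close>

theorem laplace_imp_converges_in_distribution: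
  fixes M :: "nat \<Rightarrow> 'w measure" and V :: "nat \<Rightarrow> 'w \<Rightarrow> 'i \<Rightarrow> real"
    and N :: "'v measure" and W :: "'v \<Rightarrow> 'i \<Rightarrow> real"
  assumes I: "finite I" and M: "\<And>n. prob_space (M n)" and N: "prob_space N"
    and V: "\<And>n. V n \<in> measurable (M n) (PiM I (\<lambda>_. borel))" and W: "W \<in> measurable N (PiM I (\<lambda>_. borel))"
    and V_nonneg: "\<And>n \<omega> i. i \<in> I \<Longrightarrow> 0 \<le> V n \<omega> i" and W_nonneg: "\<And>\<omega> i. i \<in> I \<Longrightarrow> 0 \<le> W \<omega> i"
    and V_int: "\<And>n i. n \<ge> n0 \<Longrightarrow> i \<in> I \<Longrightarrow> integrable (M n) (\<lambda>\<omega>. V n \<omega> i)"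
    and V_le: "\<And>n i. n \<ge> n0 \<Longrightarrow> i \<in> I \<Longrightarrow> (\<integral>\<omega>. V n \<omega> i \<partial>M n) \<le> K"
    and W_int: "\<And>i. i \<in> I \<Longrightarrow> integrable N (\<lambda>\<omega>. W \<omega> i)" and W_le: "\<And>i. i \<in> I \<Longrightarrow> (\<integral>\<omega>. W \<omega> i \<partial>N) \<le> K"
    and laplace: "\<And>p :: 'i \<Rightarrow> nat. (\<lambda>n. \<integral>\<omega>. exp (- (\<Sum>i\<in>I. real (p i) * V n \<omega> i)) \<partial>M n)
      \<longlonglongrightarrow> (\<integral>\<omega>. exp (- (\<Sum>i\<in>I. real (p i) * W \<omega> i)) \<partial>N)"
  shows "converges_in_distribution I M V N W"
  unfolding converges_in_distribution_def weak_conv_on_def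
proof (intro conjI allI impI V W)
  fix f :: "('i \<Rightarrow> real) \<Rightarrow> real"
  let ?B = "PiM I (\<lambda>_. borel :: real measure)"
  assume "continuous_on (PiE I (\<lambda>_. UNIV)) f \<and> bounded (f ` PiE I (\<lambda>_. UNIV))"
  then have f: "continuous_on (PiE I (\<lambda>_. UNIV)) f" and "bounded (f ` PiE I (\<lambda>_. UNIV))" by auto
  then obtain b0 where "\<And>x. x \<in> PiE I (\<lambda>_. UNIV) \<Longrightarrow> \<bar>f x\<bar> \<le> b0"
    unfolding bounded_iff by auto
  then obtain b where b: "0 < b" "\<And>x. x \<in> PiE I (\<lambda>_. UNIV) \<Longrightarrow> \<bar>f x\<bar> \<le> b"
    by (metis abs_ge_self abs_ge_zero dual_order.trans gt_ex linorder_not_le order_less_imp_le)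
  have fm: "f \<in> borel_measurable ?B" by (rule continuous_imp_measurable_PiM[OF I f])
  define ev where "ev x = (\<lambda>i\<in>I. exp (- x i))" for x :: "'i \<Rightarrow> real"
  define cut where "cut L x = (\<lambda>i\<in>I. min (x i) L)" for L and x :: "'i \<Rightarrow> real"
  \<comment> \<open>\<open>- ln\<close> inverts \<open>ev\<close>. The floor
    \<open>exp (- L)\<close> keeps the logarithm finite at the boundary of the cube, and amounts to
    capping the original coordinates at \<open>L\<close>.\<close>
  define g where "g L y = f (\<lambda>i\<in>I. - ln (max (y i) (exp (- L))))" for L y
  have g_ev: "g L (ev x) = f (cut L x)" for L x
  proof -
    have "- ln (max (exp (- x i)) (exp (- L))) = min (x i) L" for i
      by (simp add: max_def min_def)
    then have "(\<lambda>i\<in>I. - ln (max (ev x i) (exp (- L)))) = cut L x"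
      by (auto simp: ev_def cut_def)
    then show ?thesis by (simp add: g_def)
  qed
  have ev_in: "ev x \<in> PiE I (\<lambda>_. {0..1})" if "\<And>i. i \<in> I \<Longrightarrow> 0 \<le> x i" for x
    using that by (auto simp: ev_def)
  have g_cont: "continuous_on (PiE I (\<lambda>_. {0..1})) (g L)" for L
    unfolding g_def
  proof (rule continuous_on_compose2[OF f])
    show "continuous_on (PiE I (\<lambda>_. {0..1})) (\<lambda>y. \<lambda>i\<in>I. - ln (max (y i) (exp (- L))))"
    proof (rule continuous_on_coordinatewise_then_product)
      fix i
      show "continuous_on (PiE I (\<lambda>_. {0..1})) (\<lambda>y. (\<lambda>i\<in>I. - ln (max (y i) (exp (- L)))) i)"
      proof (cases "i \<in> I")
        case True
        have "continuous_on (PiE I (\<lambda>_. {0..1})) (\<lambda>y. - ln (max (y i) (exp (- L))))"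
          by (intro continuous_intros continuous_on_product_coordinates[THEN continuous_on_subset])
             (auto simp: max_def)
        with True show ?thesis by simp
      qed simp
    qed
  qed auto
  \<comment> \<open>A Markov-type bound: if capping changes anything, some coordinate exceeds
    \<open>L\<close>, the sum divided by \<open>L\<close> exceeds 1, and \<open>f\<close> varies by
    at most \<open>2 * b\<close>.\<close>
  have cutoff: "\<bar>f x - f (cut L x)\<bar> \<le> 2 * b / L * (\<Sum>i\<in>I. x i)"
    if "L > 0" "x \<in> PiE I (\<lambda>_. UNIV)" "\<And>i. i \<in> I \<Longrightarrow> 0 \<le> x i" for L x
  proof (cases "\<forall>i\<in>I. x i \<le> L")
    case True
    then have "cut L x = x"
      using that(2) by (auto simp: cut_def fun_eq_iff PiE_iff extensional_def min_def)
    with that b(1) show ?thesis by (simp add: sum_nonneg)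
  next
    case False
    then obtain i where i: "i \<in> I" "L < x i" by auto
    have "x i \<le> (\<Sum>i\<in>I. x i)" using i I that by (intro member_le_sum) auto
    with i have "L \<le> (\<Sum>i\<in>I. x i)" by simp
    then have "2 * b * 1 \<le> 2 * b * ((\<Sum>i\<in>I. x i) / L)"
      using b(1) that(1) by (intro mult_left_mono) simp_all
    moreover have "\<bar>f x - f (cut L x)\<bar> \<le> 2 * b"
      using b(2)[OF that(2)] b(2)[of "cut L x"] by (simp add: cut_def)
    ultimately show ?thesis by simp
  qed
  \<comment> \<open>For an arbitrary law with means at most \<open>K\<close>, so that it serves for
    every late \<open>M n\<close> and for \<open>N\<close> with the same error.\<close>
  have approx: "\<bar>(\<integral>\<omega>. f (U \<omega>) \<partial>P) - (\<integral>\<omega>. q (ev (U \<omega>)) \<partial>P)\<bar> \<le> 2 * b / L * (real (card I) * K) + e"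
    if P: "prob_space P" and U: "U \<in> measurable P ?B" "\<And>\<omega> i. i \<in> I \<Longrightarrow> 0 \<le> U \<omega> i"
      and U_int: "\<And>i. i \<in> I \<Longrightarrow> integrable P (\<lambda>\<omega>. U \<omega> i)" and U_le: "\<And>i. i \<in> I \<Longrightarrow> (\<integral>\<omega>. U \<omega> i \<partial>P) \<le> K"
      and L: "L > 0" and q: "q \<in> monomial_sums I" "\<And>y. y \<in> PiE I (\<lambda>_. {0..1}) \<Longrightarrow> \<bar>g L y - q y\<bar> < e"
    for P :: "'z measure" and U L q e
  proof -
    interpret prob_space P by fact
    have Usp: "U \<omega> \<in> PiE I (\<lambda>_. UNIV)" if "\<omega> \<in> space P" for \<omega>
      using measurable_space[OF U(1) that] by (simp add: space_PiM)
    have ev_m: "ev \<in> measurable ?B ?B" unfolding ev_def by measurable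
    have q_m: "q \<in> borel_measurable ?B"
      by (rule continuous_imp_measurable_PiM[OF I continuous_on_monomial_sums[OF q(1)]])
    have m1: "(\<lambda>\<omega>. f (U \<omega>)) \<in> borel_measurable P" by (rule measurable_compose[OF U(1) fm])
    have m2: "(\<lambda>\<omega>. q (ev (U \<omega>))) \<in> borel_measurable P"
      by (rule measurable_compose[OF measurable_compose[OF U(1) ev_m] q_m])
    have bd: "\<bar>f (U \<omega>) - q (ev (U \<omega>))\<bar> \<le> 2 * b / L * (\<Sum>i\<in>I. U \<omega> i) + e" if "\<omega> \<in> space P" for \<omega>
    proof -
      have "\<bar>f (U \<omega>) - f (cut L (U \<omega>))\<bar> \<le> 2 * b / L * (\<Sum>i\<in>I. U \<omega> i)"
        by (rule cutoff[OF L Usp[OF that]]) (rule U(2))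
      moreover have "\<bar>f (cut L (U \<omega>)) - q (ev (U \<omega>))\<bar> < e"
        unfolding g_ev[symmetric] by (rule q(2), rule ev_in) (rule U(2))
      ultimately show ?thesis by linarith
    qed
    have i1: "integrable P (\<lambda>\<omega>. f (U \<omega>))"
      using b Usp by (intro integrable_const_bound[where B = b] m1 AE_I2) auto
    have i3: "integrable P (\<lambda>\<omega>. 2 * b / L * (\<Sum>i\<in>I. U \<omega> i) + e)"
      using U_int by (intro Bochner_Integration.integrable_add integrable_mult_right
          Bochner_Integration.integrable_sum) auto
    have i2: "integrable P (\<lambda>\<omega>. f (U \<omega>) - q (ev (U \<omega>)))"
      by (rule Bochner_Integration.integrable_bound[OF i3]) (use m1 m2 bd in \<open>auto intro!: AE_I2 order_trans[OF _ abs_ge_self]\<close>)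
    have i4: "integrable P (\<lambda>\<omega>. q (ev (U \<omega>)))"
      using Bochner_Integration.integrable_diff[OF i1 i2] by simp
    have "\<bar>(\<integral>\<omega>. f (U \<omega>) \<partial>P) - (\<integral>\<omega>. q (ev (U \<omega>)) \<partial>P)\<bar> = \<bar>\<integral>\<omega>. f (U \<omega>) - q (ev (U \<omega>)) \<partial>P\<bar>"
      by (simp add: Bochner_Integration.integral_diff[OF i1 i4])
    also have "\<dots> \<le> (\<integral>\<omega>. \<bar>f (U \<omega>) - q (ev (U \<omega>))\<bar> \<partial>P)"
      using integral_norm_bound[of P "\<lambda>\<omega>. f (U \<omega>) - q (ev (U \<omega>))"] by simp
    also have "\<dots> \<le> (\<integral>\<omega>. 2 * b / L * (\<Sum>i\<in>I. U \<omega> i) + e \<partial>P)"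
      using i2 by (intro integral_mono i3 bd integrable_abs)
    also have "\<dots> = 2 * b / L * (\<Sum>i\<in>I. \<integral>\<omega>. U \<omega> i \<partial>P) + e"
      using U_int prob_space by (simp add: Bochner_Integration.integral_sum Bochner_Integration.integrable_sum
          del: integral_mult_right)
    also have "\<dots> \<le> 2 * b / L * (real (card I) * K) + e"
      using U_le L b(1) sum_bounded_above[of I "\<lambda>i. \<integral>\<omega>. U \<omega> i \<partial>P" K]
      by (intro add_mono mult_left_mono) auto
    finally show ?thesis .
  qed
  \<comment> \<open>On a monomial the claim is the hypothesis \<open>laplace\<close> times a
    constant; sums follow by linearity.\<close>
  have q_conv: "(\<forall>n. integrable (M n) (\<lambda>\<omega>. q (ev (V n \<omega>)))) \<and> integrable N (\<lambda>\<omega>. q (ev (W \<omega>)))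
      \<and> (\<lambda>n. \<integral>\<omega>. q (ev (V n \<omega>)) \<partial>M n) \<longlonglongrightarrow> (\<integral>\<omega>. q (ev (W \<omega>)) \<partial>N)"
    if "q \<in> monomial_sums I" for q
    using that
  proof (induction q)
    case (monomial c p)
    have eq: "c * (\<Prod>i\<in>I. ev x i ^ p i) = c * exp (- (\<Sum>i\<in>I. real (p i) * x i))" for x
    proof -
      have "(\<Prod>i\<in>I. ev x i ^ p i) = (\<Prod>i\<in>I. exp (- (real (p i) * x i)))"
        by (intro prod.cong) (simp_all add: ev_def flip: exp_of_nat_mult)
      also have "\<dots> = exp (\<Sum>i\<in>I. - (real (p i) * x i))" using I by (simp add: exp_sum)
      finally show ?thesis by (simp add: sum_negf)
    qed
    have int: "integrable P (\<lambda>\<omega>. c * exp (- (\<Sum>i\<in>I. real (p i) * U \<omega> i)))"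
      if P: "prob_space P" and U: "U \<in> measurable P ?B" "\<And>\<omega> i. i \<in> I \<Longrightarrow> 0 \<le> U \<omega> i"
      for P :: "'z measure" and U
    proof -
      interpret prob_space P by fact
      have "(\<lambda>\<omega>. U \<omega> i) \<in> borel_measurable P" if "i \<in> I" for i
        using measurable_compose[OF U(1) measurable_component_singleton[OF that]] .
      then show ?thesis using U(2)
        by (intro integrable_mult_right integrable_const_bound[where B = 1] AE_I2)
           (auto intro!: sum_nonneg)
    qed
    show ?case unfolding eq
      using int[OF M V V_nonneg] int[OF N W W_nonneg] laplace[of p]
      by (auto intro!: tendsto_mult_left)
  next
    case (add q q')
    then show ?case
      by (auto intro!: tendsto_add simp: Bochner_Integration.integral_add)
  qed
  have "(\<lambda>n. \<integral>\<omega>. f (V n \<omega>) \<partial>M n) \<longlonglongrightarrow> (\<integral>\<omega>. f (W \<omega>) \<partial>N)"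
  proof (rule LIMSEQ_I)
    fix e :: real assume e: "0 < e"
    \<comment> \<open>Makes the truncation error at most \<open>e / 8\<close>, with the summand 1
      ensuring \<open>L > 0\<close>. In total the error is \<open>e / 4\<close> on either side and
      less than \<open>e / 4\<close> from the convergence of \<open>q\<close>, so less than
      \<open>e\<close>.\<close>
    define L where "L = 1 + 2 * b * (real (card I) * \<bar>K\<bar>) * 8 / e"
    have L0: "L > 0" using b(1) e unfolding L_def by (intro add_pos_nonneg) auto
    have "2 * b * (real (card I) * \<bar>K\<bar>) * 8 / e \<le> L" by (simp add: L_def)
    then have "2 * b / L * (real (card I) * \<bar>K\<bar>) \<le> e / 8"
      using L0 e by (simp add: field_simps)
    moreover have "2 * b / L * (real (card I) * K) \<le> 2 * b / L * (real (card I) * \<bar>K\<bar>)"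
      using L0 b(1) by (intro mult_left_mono) auto
    ultimately have Le: "2 * b / L * (real (card I) * K) \<le> e / 8" by simp
    have e8: "0 < e / 8" using e by simp
    obtain q where q: "q \<in> monomial_sums I" "\<And>y. y \<in> PiE I (\<lambda>_. {0..1}) \<Longrightarrow> \<bar>g L y - q y\<bar> < e / 8"
      using monomial_sums_dense[OF I g_cont e8] by blast
    have "(\<lambda>n. \<integral>\<omega>. q (ev (V n \<omega>)) \<partial>M n) \<longlonglongrightarrow> (\<integral>\<omega>. q (ev (W \<omega>)) \<partial>N)"
      using q_conv[OF q(1)] by blast
    from LIMSEQ_D[OF this, of "e / 4"] e obtain n1 where
      n1: "\<And>n. n \<ge> n1 \<Longrightarrow> \<bar>(\<integral>\<omega>. q (ev (V n \<omega>)) \<partial>M n) - (\<integral>\<omega>. q (ev (W \<omega>)) \<partial>N)\<bar> < e / 4"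
      by auto
    have "norm ((\<integral>\<omega>. f (V n \<omega>) \<partial>M n) - (\<integral>\<omega>. f (W \<omega>) \<partial>N)) < e" if "n \<ge> max n0 n1" for n
    proof -
      have "\<bar>(\<integral>\<omega>. f (V n \<omega>) \<partial>M n) - (\<integral>\<omega>. q (ev (V n \<omega>)) \<partial>M n)\<bar> \<le> 2 * b / L * (real (card I) * K) + e / 8"
        by (rule approx[OF M V V_nonneg V_int V_le L0 q]) (use that in auto)
      moreover have "\<bar>(\<integral>\<omega>. f (W \<omega>) \<partial>N) - (\<integral>\<omega>. q (ev (W \<omega>)) \<partial>N)\<bar> \<le> 2 * b / L * (real (card I) * K) + e / 8"
        by (rule approx[OF N W W_nonneg W_int W_le L0 q])
      moreover have "n \<ge> n1" using that by simp
      then have "\<bar>(\<integral>\<omega>. q (ev (V n \<omega>)) \<partial>M n) - (\<integral>\<omega>. q (ev (W \<omega>)) \<partial>N)\<bar> < e / 4" by (rule n1)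
      ultimately show ?thesis using Le e unfolding real_norm_def by linarith
    qed
    then show "\<exists>no. \<forall>n\<ge>no. norm ((\<integral>\<omega>. f (V n \<omega>) \<partial>M n) - (\<integral>\<omega>. f (W \<omega>) \<partial>N)) < e"
      by blast
  qed
  then show "(\<lambda>n. \<integral>x. f x \<partial>distr (M n) ?B (V n)) \<longlonglongrightarrow> (\<integral>x. f x \<partial>distr N ?B W)"
    by (simp add: integral_distr[OF V fm] integral_distr[OF W fm])
qed

section \<open>The weight measures and Riemann sums\<close>

lemma sigma_finite_eucl: "sigma_finite_measure (eucl d)"
proof -
  interpret finite_product_sigma_finite "\<lambda>_ :: nat. lborel :: real measure" "{..<d}"
    by unfold_locales simp
  show ?thesis unfolding eucl_def by (rule sigma_finite_measure_axioms)
qed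

lemma measurable_enorm [measurable]: "enorm d \<in> borel_measurable (eucl d)"
  unfolding enorm_def[abs_def] L2_set_def by measurable

lemma enorm_nonneg: "0 \<le> enorm d t"
  by (simp add: enorm_def L2_set_nonneg)

lemma abs_le_enorm: "k < d \<Longrightarrow> \<bar>t k\<bar> \<le> enorm d t"
  unfolding enorm_def using member_le_L2_set[of "{..<d}" k "\<lambda>k. \<bar>t k\<bar>"]
  by (simp add: L2_set_def)

lemma sets_w_meas [simp, measurable_cong]: "sets (w_meas d) = sets (eucl d)"
  by (simp add: w_meas_def)

text \<open>The density is real-valued and so finite everywhere; at norm 0 division by zero gives
  the value 0.\<close>

lemma sigma_finite_w_meas: "sigma_finite_measure (w_meas d)"
proof -
  interpret sigma_finite_measure "eucl d" by (rule sigma_finite_eucl)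
  show ?thesis unfolding w_meas_def
    by (subst sigma_finite_iff_density_finite) auto
qed

lemma sets_w_prod [simp, measurable_cong]: "sets (w_prod d S) = sets (eucl_prod d S)"
  unfolding w_prod_def eucl_prod_def by (rule sets_PiM_cong) simp_all

lemma space_w_prod [simp]: "space (w_prod d S) = space (eucl_prod d S)"
  by (rule sets_eq_imp_space_eq) simp

lemma sigma_finite_w_prod: "finite S \<Longrightarrow> sigma_finite_measure (w_prod d S)"
proof -
  assume "finite S"
  interpret product_sigma_finite "\<lambda>i. w_meas (d i)"
    by (simp add: product_sigma_finite_def sigma_finite_w_meas)
  interpret finite_product_sigma_finite "\<lambda>i. w_meas (d i)" S
    by unfold_locales fact
  show ?thesis unfolding w_prod_def by (rule sigma_finite_measure_axioms)
qed

lemma c_const_pos: "0 < c_const d"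
  unfolding c_const_def by (intro divide_pos_pos Gamma_real_pos) auto

section \<open>Integrability of the truncated square against the weight\<close>

lemma integrable_powr_near_0:
  assumes "a > -1" shows "integrable lborel (\<lambda>x::real. indicator {-1..1} x * \<bar>x\<bar> powr a)"
proof -
  define f where "f x = indicator {0..1} x * \<bar>x\<bar> powr a" for x :: real
  have f_meas: "f \<in> borel_measurable borel" unfolding f_def[abs_def] by measurable
  have "((\<lambda>x. x powr a) has_integral (1 / (a + 1))) {0..1}"
    using has_integral_powr_from_0[OF assms, of 1] by simp
  then have "(f has_integral (1 / (a + 1))) UNIV"
    by (subst (asm) has_integral_restrict_UNIV[symmetric])
       (auto simp: f_def indicator_def elim!: has_integral_eq[rotated])
  then have "integral\<^sup>N lborel f = ennreal (1 / (a + 1))"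
    by (intro nn_integral_has_integral_lborel f_meas) (simp add: f_def)
  then have f: "integrable lborel f"
    using f_meas by (intro integrableI_nonneg) (auto simp: f_def)
  have "integrable lborel (\<lambda>x. f x + f (0 + (-1) * x))"
    by (intro Bochner_Integration.integrable_add f lborel_integrable_real_affine) simp
  then show ?thesis
    by (rule Bochner_Integration.integrable_bound) (auto simp: f_def indicator_def)
qed

lemma integrable_powr_at_inf:
  assumes "a < -1" shows "integrable lborel (\<lambda>x::real. max 1 \<bar>x\<bar> powr a)"
proof -
  define f where "f x = indicator {1..} x * \<bar>x\<bar> powr a" for x :: real
  have f_meas: "f \<in> borel_measurable borel" unfolding f_def[abs_def] by measurable
  have "((\<lambda>x. x powr a) has_integral (- 1 / (a + 1))) {1..}"
    using has_integral_powr_to_inf[OF assms, of 1] by simp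
  then have "(f has_integral (- 1 / (a + 1))) UNIV"
    by (subst (asm) has_integral_restrict_UNIV[symmetric])
       (auto simp: f_def indicator_def elim!: has_integral_eq[rotated])
  then have "integral\<^sup>N lborel f = ennreal (- 1 / (a + 1))"
    by (intro nn_integral_has_integral_lborel f_meas) (simp add: f_def)
  then have f: "integrable lborel f"
    using f_meas by (intro integrableI_nonneg) (auto simp: f_def)
  have "integrable lborel (\<lambda>x. (f x + f (0 + (-1) * x)) + indicator {-1..1} x)"
    by (intro Bochner_Integration.integrable_add f lborel_integrable_real_affine) simp_all
  then show ?thesis
    by (rule Bochner_Integration.integrable_bound) (auto simp: f_def indicator_def max_def)
qed

lemma integrable_eucl_prod_fun:
  assumes "integrable lborel f"
  shows "integrable (eucl e) (\<lambda>t. \<Prod>k<e. f (t k) :: real)"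
proof -
  interpret product_sigma_finite "\<lambda>_ :: nat. lborel :: real measure" ..
  show ?thesis unfolding eucl_def
    by (rule product_integrable_prod) (simp_all add: assms)
qed

text \<open>Needed because \<open>0 powr a\<close> is 0 also for negative \<open>a\<close>: a
  product of powers may fail to bound the weight where a coordinate vanishes.\<close>

lemma AE_eucl_nonzero: "AE t in eucl e. \<forall>k<e. t k \<noteq> 0"
proof -
  have "AE t in eucl e. t k \<noteq> 0" if "k < e" for k
  proof -
    have "(\<Sum>l<e. t l * (if l = k then 1 else 0)) = t k" for t :: "nat \<Rightarrow> real"
      using that by (simp add: if_distrib cong: if_cong)
    with AE_eucl_hyperplane[OF that, of "\<lambda>l. if l = k then 1 else 0" 0] show ?thesis by simp
  qed
  then have "AE t in eucl e. \<forall>k\<in>{..<e}. t k \<noteq> 0" by (intro AE_finite_allI) auto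
  then show ?thesis by eventually_elim auto
qed

text \<open>Up to a constant this bounds the variance of \<open>exp (i <t, U>)\<close> for
  \<open>U\<close> in the cube. The quadratic decay at 0 compensates the singularity of the weight;
  the bound 1 is enough at infinity.\<close>

definition trunc_sq :: "nat \<Rightarrow> (nat \<Rightarrow> real) \<Rightarrow> real" where
  "trunc_sq e t = min 1 ((enorm e t)\<^sup>2)"

lemma measurable_trunc_sq [measurable]: "trunc_sq e \<in> borel_measurable (eucl e)"
  unfolding trunc_sq_def[abs_def] by measurable

lemma trunc_sq_nonneg: "0 \<le> trunc_sq e t" and trunc_sq_le_1: "trunc_sq e t \<le> 1"
  by (simp_all add: trunc_sq_def)

text \<open>The radial weight is dominated by products of one-dimensional powers, since
  \<open>\<bar>t k\<bar> \<le> enorm e t\<close> for each of the \<open>e\<close> coordinates.\<close>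

lemma integrable_trunc_sq:
  assumes e: "1 \<le> e"
  shows "integrable (w_meas e) (trunc_sq e)"
proof -
  \<comment> \<open>The exponents satisfy \<open>e * ?a = 2 - (1 + e)\<close> and
    \<open>e * ?b = - (1 + e)\<close>, the powers of the norm near 0 and far from it. Distributed
    over \<open>e\<close> coordinates, \<open>?a > -1\<close> is integrable near 0 and
    \<open>?b < -1\<close> at infinity; neither is positive, so replacing the norm by a smaller
    coordinate enlarges the factor.\<close>
  let ?a = "1 / real e - 1" and ?b = "- (1 / real e) - 1"
  have e': "real e \<ge> 1" using e by simp
  have b: "?b \<le> 0" using divide_nonneg_nonneg[of 1 "real e"] by linarith
  have int: "integrable (eucl e) (\<lambda>t. (1 / c_const e) * ((\<Prod>k<e. indicator {-1..1} (t k) * \<bar>t k\<bar> powr ?a)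
      + (\<Prod>k<e. max 1 \<bar>t k\<bar> powr ?b)))"
    using e' by (intro integrable_mult_right Bochner_Integration.integrable_add integrable_eucl_prod_fun
      integrable_powr_near_0 integrable_powr_at_inf) auto
  have bound: "trunc_sq e t / enorm e t ^ (1 + e)
    \<le> (\<Prod>k<e. indicator {-1..1} (t k) * \<bar>t k\<bar> powr ?a) + (\<Prod>k<e. max 1 \<bar>t k\<bar> powr ?b)"
    if t: "\<forall>k<e. t k \<noteq> 0" for t
  proof -
    define s where "s = enorm e t"
    have tk: "0 < \<bar>t k\<bar>" "\<bar>t k\<bar> \<le> s" if "k < e" for k
      using t that abs_le_enorm[OF that, of t] by (auto simp: s_def)
    have s: "0 < s" using tk[of 0] e by linarith
    have pw: "s powr (x * real e) = (\<Prod>k<e. s powr x)" for x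
      using s by (simp add: powr_powr[symmetric] powr_realpow)
    have s_pow: "s ^ (1 + e) = s powr (1 + real e)" "s\<^sup>2 = s powr 2"
      using powr_realpow[OF s, of "1 + e"] powr_realpow[OF s, of 2] by simp_all
    have nn: "0 \<le> (\<Prod>k<e. indicator {-1..1} (t k) * \<bar>t k\<bar> powr ?a)" "0 \<le> (\<Prod>k<e. max 1 \<bar>t k\<bar> powr ?b)"
      by (auto intro!: prod_nonneg)
    show ?thesis
    proof (cases "s \<le> 1")
      case True
      have "trunc_sq e t = s\<^sup>2"
        using True s by (simp add: trunc_sq_def s_def[symmetric] power_le_one)
      then have "trunc_sq e t / s ^ (1 + e) = s powr 2 / s powr (1 + real e)"
        by (simp only: s_pow)
      also have "\<dots> = s powr (?a * real e)"
        using e' by (simp add: powr_diff[symmetric] algebra_simps)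
      also have "\<dots> \<le> (\<Prod>k<e. indicator {-1..1} (t k) * \<bar>t k\<bar> powr ?a)"
        unfolding pw
      proof (rule prod_mono)
        fix k assume "k \<in> {..<e}"
        then have k: "0 < \<bar>t k\<bar>" "\<bar>t k\<bar> \<le> s" using tk by auto
        then have "t k \<in> {-1..1}" using True by auto
        moreover have "s powr ?a \<le> \<bar>t k\<bar> powr ?a"
          using k e' by (intro powr_mono2') auto
        ultimately show "0 \<le> s powr ?a \<and> s powr ?a \<le> indicator {-1..1} (t k) * \<bar>t k\<bar> powr ?a" by simp
      qed
      finally show ?thesis using nn by (simp add: s_def)
    next
      case False
      have "trunc_sq e t = 1"
        using False by (simp add: trunc_sq_def s_def[symmetric])
      then have "trunc_sq e t / s ^ (1 + e) = 1 / s powr (1 + real e)"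
        by (simp only: s_pow)
      also have "\<dots> = s powr (?b * real e)"
        using e' by (simp add: powr_minus_divide[symmetric] algebra_simps)
      also have "\<dots> \<le> (\<Prod>k<e. max 1 \<bar>t k\<bar> powr ?b)"
        unfolding pw
      proof (rule prod_mono)
        fix k assume "k \<in> {..<e}"
        then have "max 1 \<bar>t k\<bar> \<le> s" using tk False by auto
        then have "s powr ?b \<le> max 1 \<bar>t k\<bar> powr ?b"
          by (intro powr_mono2'[OF b]) auto
        then show "0 \<le> s powr ?b \<and> s powr ?b \<le> max 1 \<bar>t k\<bar> powr ?b" by simp
      qed
      finally show ?thesis using nn by (simp add: s_def)
    qed
  qed
  have "integrable (eucl e) (\<lambda>t. (1 / (c_const e * enorm e t ^ (1 + e))) *\<^sub>R trunc_sq e t)"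
  proof (rule Bochner_Integration.integrable_bound[OF int])
    show "AE t in eucl e. norm ((1 / (c_const e * enorm e t ^ (1 + e))) *\<^sub>R trunc_sq e t)
      \<le> norm ((1 / c_const e) * ((\<Prod>k<e. indicator {-1..1} (t k) * \<bar>t k\<bar> powr ?a)
      + (\<Prod>k<e. max 1 \<bar>t k\<bar> powr ?b)))"
      using AE_eucl_nonzero[of e]
    proof eventually_elim
      case (elim t)
      have "norm ((1 / (c_const e * enorm e t ^ (1 + e))) *\<^sub>R trunc_sq e t)
          = (1 / c_const e) * (trunc_sq e t / enorm e t ^ (1 + e))"
        using c_const_pos[of e] enorm_nonneg[of e t] trunc_sq_nonneg[of e t] by simp
      also have "\<dots> \<le> (1 / c_const e) * ((\<Prod>k<e. indicator {-1..1} (t k) * \<bar>t k\<bar> powr ?a)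
          + (\<Prod>k<e. max 1 \<bar>t k\<bar> powr ?b))"
        using c_const_pos[of e] by (intro mult_left_mono bound elim) auto
      also have "\<dots> \<le> norm \<dots>" by (simp only: real_norm_def abs_ge_self)
      finally show ?case .
    qed
  qed measurable
  then show ?thesis
    unfolding w_meas_def
    by (subst integrable_density) (use c_const_pos[of e] enorm_nonneg[of e] in \<open>auto intro!: AE_I2\<close>)
qed

definition weight :: "(nat \<Rightarrow> nat) \<Rightarrow> nat set \<Rightarrow> (nat \<Rightarrow> nat \<Rightarrow> real) \<Rightarrow> real" where
  "weight d S t = (\<Prod>i\<in>S. trunc_sq (d i) (t i))"

lemma weight_nonneg: "0 \<le> weight d S t" and weight_le_1: "weight d S t \<le> 1"
  unfolding weight_def by (simp_all add: prod_nonneg prod_le_1 trunc_sq_nonneg trunc_sq_le_1)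

lemma measurable_eucl_prod_component: "i \<in> S \<Longrightarrow> (\<lambda>t. t i) \<in> measurable (eucl_prod d S) (eucl (d i))"
  unfolding eucl_prod_def by (rule measurable_component_singleton)

lemma measurable_eucl_prod_coordinate:
  "i \<in> S \<Longrightarrow> k < d i \<Longrightarrow> (\<lambda>t. t i k) \<in> borel_measurable (eucl_prod d S)"
  using measurable_compose[OF measurable_eucl_prod_component measurable_eucl_component] .

lemma measurable_weight: "finite S \<Longrightarrow> weight d S \<in> borel_measurable (eucl_prod d S)"
  unfolding weight_def[abs_def]
  by (intro borel_measurable_prod measurable_compose[OF measurable_eucl_prod_component measurable_trunc_sq])

lemma integrable_weight:
  assumes "finite S" "\<forall>i\<in>S. 1 \<le> d i"
  shows "integrable (w_prod d S) (weight d S)"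
proof -
  interpret product_sigma_finite "\<lambda>i. w_meas (d i)"
    by (simp add: product_sigma_finite_def sigma_finite_w_meas)
  show ?thesis unfolding w_prod_def weight_def[abs_def]
    by (rule product_integrable_prod) (use assms integrable_trunc_sq in auto)
qed

section \<open>Windows, nodes and Riemann sums\<close>

lemma space_eucl_prod: "space (eucl_prod d S) = (PiE S (\<lambda>i. PiE {..<d i} (\<lambda>_. UNIV)))"
  by (simp add: eucl_prod_def space_PiM space_eucl)

text \<open>Bounded frequencies all of whose blocks stay \<open>1 / L\<close> away from 0, where the
  weight of the block is singular.\<close>

definition window :: "(nat \<Rightarrow> nat) \<Rightarrow> nat set \<Rightarrow> nat \<Rightarrow> (nat \<Rightarrow> nat \<Rightarrow> real) set" where
  "window d S L = {t \<in> space (eucl_prod d S).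
     \<forall>i\<in>S. 1 / real L \<le> enorm (d i) (t i) \<and> (\<forall>k\<in>{..<d i}. \<bar>t i k\<bar> \<le> real L)}"

definition rnd :: "(nat \<Rightarrow> nat) \<Rightarrow> nat set \<Rightarrow> nat \<Rightarrow> (nat \<Rightarrow> nat \<Rightarrow> real) \<Rightarrow> nat \<Rightarrow> nat \<Rightarrow> real" where
  "rnd d S m t = (\<lambda>i\<in>S. \<lambda>k\<in>{..<d i}. of_int \<lfloor>real m * t i k\<rfloor> / real m)"

text \<open>Nodes are rounded points of the window and may lie slightly outside it. This is
  harmless, as the moment estimates hold on the whole space.\<close>

definition nodes :: "(nat \<Rightarrow> nat) \<Rightarrow> nat set \<Rightarrow> nat \<Rightarrow> nat \<Rightarrow> (nat \<Rightarrow> nat \<Rightarrow> real) set" where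
  "nodes d S L m = rnd d S m ` window d S L"

definition cell :: "(nat \<Rightarrow> nat) \<Rightarrow> nat set \<Rightarrow> nat \<Rightarrow> nat \<Rightarrow> (nat \<Rightarrow> nat \<Rightarrow> real) \<Rightarrow> (nat \<Rightarrow> nat \<Rightarrow> real) set" where
  "cell d S L m \<tau> = {t \<in> window d S L. rnd d S m t = \<tau>}"

text \<open>Depends on finitely many values of \<open>z\<close> only, with the mass of the cell as
  weight; this is what finite-dimensional convergence can handle.\<close>

definition riemann :: "(nat \<Rightarrow> nat) \<Rightarrow> nat set \<Rightarrow> nat \<Rightarrow> nat \<Rightarrow> ((nat \<Rightarrow> nat \<Rightarrow> real) \<Rightarrow> complex) \<Rightarrow> real" where
  "riemann d S L m z = (\<Sum>\<tau>\<in>nodes d S L m. measure (w_prod d S) (cell d S L m \<tau>) * (cmod (z \<tau>))\<^sup>2)"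

definition tail :: "(nat \<Rightarrow> nat) \<Rightarrow> nat set \<Rightarrow> nat \<Rightarrow> real" where
  "tail d S L = (\<integral>t. indicator (- window d S L) t * weight d S t \<partial>w_prod d S)"

text \<open>Discretization error relative to the moment constant: the part outside the window, and
  the mesh error inside it. The factor 3 arises from
  \<open>(1 + m) / m^2 + 1 / m <= 3 / m\<close>.\<close>

definition riemann_err :: "(nat \<Rightarrow> nat) \<Rightarrow> nat set \<Rightarrow> nat \<Rightarrow> nat \<Rightarrow> real" where
  "riemann_err d S L m = tail d S L + 3 / real m * measure (w_prod d S) (window d S L)"

lemma rnd_in_space: "rnd d S m t \<in> space (eucl_prod d S)"
  by (auto simp: rnd_def space_eucl_prod)

lemma rnd_close:
  assumes "1 \<le> m" "i \<in> S" "k < d i" shows "\<bar>t i k - rnd d S m t i k\<bar> \<le> 1 / real m"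
proof -
  have "\<bar>real m * t i k - of_int \<lfloor>real m * t i k\<rfloor>\<bar> \<le> 1" by linarith
  moreover have "t i k - rnd d S m t i k = (real m * t i k - of_int \<lfloor>real m * t i k\<rfloor>) / real m"
    using assms by (simp add: rnd_def diff_divide_distrib)
  ultimately show ?thesis by (simp add: abs_divide divide_right_mono)
qed

lemma window_sets: "finite S \<Longrightarrow> window d S L \<in> sets (eucl_prod d S)"
  unfolding window_def
  by (intro sets.sets_Collect_finite_All sets.sets_Collect_conj borel_measurable_le
      borel_measurable_abs borel_measurable_const measurable_eucl_prod_coordinate
      measurable_compose[OF measurable_eucl_prod_component measurable_enorm]) auto

lemma finite_nodes:
  assumes "finite S" shows "finite (nodes d S L m)"
proof (rule finite_subset)
  let ?F = "(\<lambda>z. of_int z / real m) ` {- int (m * L)..int (m * L)}"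
  show "nodes d S L m \<subseteq> PiE S (\<lambda>i. PiE {..<d i} (\<lambda>_. ?F))"
    unfolding nodes_def
  proof (rule image_subsetI)
    fix t assume t: "t \<in> window d S L"
    have "of_int \<lfloor>real m * t i k\<rfloor> / real m \<in> ?F" if "i \<in> S" "k < d i" for i k
    proof -
      have "\<bar>t i k\<bar> \<le> real L" using t that by (simp add: window_def)
      then have "\<bar>real m * t i k\<bar> \<le> real m * real L" by (simp add: abs_mult mult_left_mono)
      then have "- real_of_int (int (m * L)) \<le> real m * t i k" "real m * t i k \<le> real_of_int (int (m * L))"
        by auto
      then have "\<lfloor>real m * t i k\<rfloor> \<in> {- int (m * L)..int (m * L)}"
        by (simp only: atLeastAtMost_iff le_floor_iff floor_le_iff) linarith
      then show ?thesis by blast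
    qed
    then show "rnd d S m t \<in> PiE S (\<lambda>i. PiE {..<d i} (\<lambda>_. ?F))"
      unfolding rnd_def by (intro restrict_PiE_iff[THEN iffD2] ballI) auto
  qed
  show "finite (PiE S (\<lambda>i. PiE {..<d i} (\<lambda>_. ?F)))"
    using assms by (intro finite_PiE) auto
qed

text \<open>Extensionality reduces the equation \<open>rnd d S m t = \<tau>\<close> to finitely many
  measurable conditions on real coordinates.\<close>

lemma cell_sets:
  assumes S: "finite S" shows "cell d S L m \<tau> \<in> sets (eucl_prod d S)"
proof -
  have "rnd d S m t = \<tau> \<longleftrightarrow> \<tau> \<in> space (eucl_prod d S) \<and>
      (\<forall>i\<in>S. \<forall>k\<in>{..<d i}. of_int \<lfloor>real m * t i k\<rfloor> / real m = \<tau> i k)" (is "?l \<longleftrightarrow> ?r") for t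
  proof
    assume ?l
    then show ?r using rnd_in_space[of d S m t] by (auto simp: rnd_def)
  next
    assume r: ?r
    have sp: "rnd d S m t \<in> PiE S (\<lambda>i. PiE {..<d i} (\<lambda>_. UNIV))" "\<tau> \<in> PiE S (\<lambda>i. PiE {..<d i} (\<lambda>_. UNIV))"
      using r rnd_in_space[of d S m t] by (simp_all only: space_eucl_prod)
    have "rnd d S m t i = \<tau> i" if i: "i \<in> S" for i
    proof (rule PiE_ext[OF PiE_mem[OF sp(1) i] PiE_mem[OF sp(2) i]])
      fix k assume "k \<in> {..<d i}"
      with r i show "rnd d S m t i k = \<tau> i k" by (simp add: rnd_def)
    qed
    then show ?l by (rule PiE_ext[OF sp])
  qed
  then have "cell d S L m \<tau> = window d S L \<inter> {t \<in> space (eucl_prod d S). \<tau> \<in> space (eucl_prod d S) \<and>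
      (\<forall>i\<in>S. \<forall>k\<in>{..<d i}. of_int \<lfloor>real m * t i k\<rfloor> / real m = \<tau> i k)}"
    by (auto simp: cell_def window_def)
  also have "\<dots> \<in> sets (eucl_prod d S)"
  proof (intro sets.Int window_sets S sets.sets_Collect_conj sets.sets_Collect_const sets.sets_Collect_finite_All)
    fix i k assume "i \<in> S" "k \<in> {..<d i}"
    then have [measurable]: "(\<lambda>t. t i k) \<in> borel_measurable (eucl_prod d S)"
      by (simp add: measurable_eucl_prod_coordinate)
    show "{t \<in> space (eucl_prod d S). of_int \<lfloor>real m * t i k\<rfloor> / real m = \<tau> i k} \<in> sets (eucl_prod d S)"
      by measurable
  qed (use S in auto)
  finally show ?thesis .
qed

lemma window_imp_weight_ge:
  assumes "1 \<le> L" "t \<in> window d S L" shows "(1 / real L ^ 2) ^ card S \<le> weight d S t"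
proof -
  have "1 / real L ^ 2 \<le> trunc_sq (d i) (t i)" if "i \<in> S" for i
  proof -
    have "(1 / real L)\<^sup>2 \<le> (enorm (d i) (t i))\<^sup>2"
      using assms that by (intro power_mono) (auto simp: window_def)
    then show ?thesis using assms(1) by (simp add: trunc_sq_def power_divide)
  qed
  then have "(\<Prod>i\<in>S. 1 / real L ^ 2) \<le> (\<Prod>i\<in>S. trunc_sq (d i) (t i))"
    by (intro prod_mono) auto
  then show ?thesis by (simp add: weight_def)
qed

text \<open>On the window the integrable function \<open>weight\<close> is bounded below by a
  positive constant, so the indicator is dominated by a multiple of it.\<close>

lemma emeasure_window_finite:
  assumes S: "finite S" "\<forall>i\<in>S. 1 \<le> d i" and L: "1 \<le> L"
  shows "emeasure (w_prod d S) (window d S L) < \<infinity>"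
proof -
  define w where "w = (1 / real L ^ 2) ^ card S"
  have w: "0 < w" using L by (simp add: w_def)
  have "integrable (w_prod d S) (indicator (window d S L) :: _ \<Rightarrow> real)"
  proof (rule Bochner_Integration.integrable_bound)
    show "integrable (w_prod d S) (\<lambda>t. weight d S t / w)"
      using integrable_weight[OF S] by simp
    show "AE t in w_prod d S. norm (indicator (window d S L) t :: real) \<le> norm (weight d S t / w)"
    proof (rule AE_I2)
      fix t
      show "norm (indicator (window d S L) t :: real) \<le> norm (weight d S t / w)"
      proof (cases "t \<in> window d S L")
        case True
        have "w \<le> weight d S t" unfolding w_def by (rule window_imp_weight_ge[OF L True])
        with True w show ?thesis by simp
      qed simp
    qed
  qed (use window_sets[OF S(1)] in simp)
  then show ?thesis
    using window_sets[OF S(1)] by (simp add: integrable_indicator_iff)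
qed

lemma indicator_compl_window: "indicator (- window d S L) t * weight d S t
    = weight d S t - indicator (window d S L) t * weight d S t"
  by (simp add: indicator_def)

lemma integrable_tail:
  assumes S: "finite S" "\<forall>i\<in>S. 1 \<le> d i"
  shows "integrable (w_prod d S) (\<lambda>t. indicator (- window d S L) t * weight d S t)"
proof (rule Bochner_Integration.integrable_bound[OF integrable_weight[OF S]])
  show "(\<lambda>t. indicator (- window d S L) t * weight d S t) \<in> borel_measurable (w_prod d S)"
    unfolding indicator_compl_window
    using window_sets[OF S(1), of d L] measurable_weight[OF S(1), of d] by simp
  show "AE t in w_prod d S. norm (indicator (- window d S L) t * weight d S t) \<le> norm (weight d S t)"
    by (intro AE_I2) (simp add: indicator_def)
qed

text \<open>Dominated convergence with the majorant \<open>weight\<close>. A frequency without zero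
  blocks eventually belongs to the window; if a block has norm 0, the weight itself
  vanishes.\<close>

lemma tail_tendsto_0:
  assumes S: "finite S" "\<forall>i\<in>S. 1 \<le> d i"
  shows "(\<lambda>L. tail d S L) \<longlonglongrightarrow> 0"
proof -
  have "(\<lambda>L. tail d S L) \<longlonglongrightarrow> (\<integral>t. 0 \<partial>w_prod d S)"
    unfolding tail_def
  proof (rule integral_dominated_convergence[where w = "weight d S"])
    show "AE t in w_prod d S. (\<lambda>L. indicator (- window d S L) t * weight d S t) \<longlonglongrightarrow> 0"
    proof (rule AE_I2)
      fix t assume t: "t \<in> space (w_prod d S)"
      show "(\<lambda>L. indicator (- window d S L) t * weight d S t) \<longlonglongrightarrow> 0"
      proof (cases "\<forall>i\<in>S. enorm (d i) (t i) \<noteq> 0")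
        case True
        \<comment> \<open>Every \<open>L >= b\<close> dominates all reciprocal block norms and all
          coordinates, which are the two conditions of the window.\<close>
        define b where "b = (\<Sum>i\<in>S. 1 / enorm (d i) (t i)) + (\<Sum>i\<in>S. \<Sum>k<d i. \<bar>t i k\<bar>)"
        have pos: "0 < enorm (d i) (t i)" if "i \<in> S" for i
          using True that enorm_nonneg[of "d i" "t i"] by force
        have "t \<in> window d S L" if L: "b \<le> real L" for L
          unfolding window_def
        proof (intro CollectI conjI ballI)
          show "t \<in> space (eucl_prod d S)" using t by simp
          fix i assume i: "i \<in> S"
          have sums: "0 \<le> (\<Sum>i\<in>S. 1 / enorm (d i) (t i))" "0 \<le> (\<Sum>i\<in>S. \<Sum>k<d i. \<bar>t i k\<bar>)"
            by (auto intro!: sum_nonneg enorm_nonneg)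
          have "1 / enorm (d i) (t i) \<le> (\<Sum>i\<in>S. 1 / enorm (d i) (t i))"
            using i S(1) enorm_nonneg by (intro member_le_sum) auto
          then have le: "1 / enorm (d i) (t i) \<le> real L" using L sums by (simp add: b_def)
          moreover have "0 < 1 / enorm (d i) (t i)" using pos[OF i] by simp
          ultimately have "0 < real L" by linarith
          with le pos[OF i] show "1 / real L \<le> enorm (d i) (t i)" by (simp add: field_simps)
          fix k assume k: "k \<in> {..<d i}"
          have "\<bar>t i k\<bar> \<le> (\<Sum>k<d i. \<bar>t i k\<bar>)" using k by (intro member_le_sum) auto
          also have "\<dots> \<le> (\<Sum>i\<in>S. \<Sum>k<d i. \<bar>t i k\<bar>)"
            using i S(1) by (intro member_le_sum) (auto intro!: sum_nonneg)
          finally show "\<bar>t i k\<bar> \<le> real L" using L sums by (simp add: b_def)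
        qed
        then have "eventually (\<lambda>L. indicator (- window d S L) t * weight d S t = 0) sequentially"
          by (intro eventually_sequentiallyI[of "nat \<lceil>b\<rceil>"]) (simp add: nat_le_iff ceiling_le_iff)
        then show ?thesis by (rule tendsto_eventually)
      next
        case False
        then obtain i where "i \<in> S" "trunc_sq (d i) (t i) = 0" by (auto simp: trunc_sq_def)
        then have "weight d S t = 0"
          unfolding weight_def using S(1) by (intro prod_zero) blast+
        then show ?thesis by simp
      qed
    qed
    show "AE t in w_prod d S. norm (indicator (- window d S L) t * weight d S t) \<le> weight d S t" for L
      by (intro AE_I2) (simp add: indicator_def weight_nonneg)
    show "(\<lambda>t. indicator (- window d S L) t * weight d S t) \<in> borel_measurable (w_prod d S)" for L
      using integrable_tail[OF S, of L] by (rule borel_measurable_integrable)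
  qed (use integrable_weight[OF S] in auto)
  then show ?thesis by simp
qed

text \<open>Each point of the window lies in exactly one cell, that of its rounded point, so
  composition with the rounding is a step function.\<close>

lemma indicator_window_rnd:
  assumes S: "finite S"
  shows "indicator (window d S L) t * f (rnd d S m t)
    = (\<Sum>\<tau>\<in>nodes d S L m. indicator (cell d S L m \<tau>) t * (f \<tau> :: real))"
proof (cases "t \<in> window d S L")
  case True
  then have "(\<Sum>\<tau>\<in>nodes d S L m. indicator (cell d S L m \<tau>) t * f \<tau>)
    = (\<Sum>\<tau>\<in>nodes d S L m. if \<tau> = rnd d S m t then f \<tau> else 0)"
    by (intro sum.cong) (auto simp: cell_def indicator_def)
  also have "\<dots> = f (rnd d S m t)"
    using True finite_nodes[OF S] by (simp add: nodes_def)
  finally show ?thesis using True by simp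
next
  case False
  then show ?thesis by (simp add: cell_def indicator_def)
qed

lemma riemann_eq_integral:
  assumes S: "finite S" "\<forall>i\<in>S. 1 \<le> d i" and L: "1 \<le> L"
  shows "integrable (w_prod d S) (\<lambda>t. indicator (window d S L) t * (cmod (z (rnd d S m t)))\<^sup>2)" (is ?A)
    and "(\<integral>t. indicator (window d S L) t * (cmod (z (rnd d S m t)))\<^sup>2 \<partial>w_prod d S) = riemann d S L m z" (is ?B)
proof -
  let ?W = "w_prod d S"
  have fin: "emeasure ?W (cell d S L m \<tau>) < \<infinity>" for \<tau>
  proof -
    have "emeasure ?W (cell d S L m \<tau>) \<le> emeasure ?W (window d S L)"
      using window_sets[OF S(1)] by (intro emeasure_mono) (auto simp: cell_def)
    also note emeasure_window_finite[OF S L]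
    finally show ?thesis .
  qed
  have eq: "indicator (window d S L) t * (cmod (z (rnd d S m t)))\<^sup>2
    = (\<Sum>\<tau>\<in>nodes d S L m. indicator (cell d S L m \<tau>) t * (cmod (z \<tau>))\<^sup>2)" for t
    by (rule indicator_window_rnd[OF S(1), where f = "\<lambda>\<tau>. (cmod (z \<tau>))\<^sup>2"])
  have int: "integrable ?W (\<lambda>t. indicator (cell d S L m \<tau>) t * (cmod (z \<tau>))\<^sup>2)" for \<tau>
    using cell_sets[OF S(1)] fin by (intro integrable_mult_left) (simp add: integrable_indicator_iff)
  show ?A unfolding eq using int by (rule Bochner_Integration.integrable_sum)
  show ?B unfolding eq riemann_def using int cell_sets[OF S(1)] sets.sets_into_space[OF cell_sets[OF S(1)]]
    by (simp add: Bochner_Integration.integral_sum Int_absorb2)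
qed

text \<open>Young's inequality \<open>2 h |y| <= m h^2 + |y|^2 / m\<close>. With \<open>m\<close>
  the inverse mesh, \<open>h^2\<close> is of order \<open>1 / m^2\<close> on average and both terms
  are of order \<open>1 / m\<close>.\<close>

lemma abs_diff_squares_le:
  fixes x y :: complex assumes "0 < m"
  shows "\<bar>(cmod x)\<^sup>2 - (cmod y)\<^sup>2\<bar> \<le> (1 + m) * (cmod (x - y))\<^sup>2 + (cmod y)\<^sup>2 / m"
proof -
  define h where "h = cmod (x - y)"
  have h: "\<bar>cmod x - cmod y\<bar> \<le> h" unfolding h_def by (rule norm_triangle_ineq3)
  have "(cmod x)\<^sup>2 - (cmod y)\<^sup>2 = (cmod x - cmod y) * (cmod x - cmod y + 2 * cmod y)"
    by (simp add: power2_eq_square algebra_simps)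
  then have "\<bar>(cmod x)\<^sup>2 - (cmod y)\<^sup>2\<bar> = \<bar>cmod x - cmod y\<bar> * \<bar>cmod x - cmod y + 2 * cmod y\<bar>"
    by (simp only: abs_mult)
  also have "\<dots> \<le> h * (h + 2 * cmod y)"
    using h by (intro mult_mono) auto
  also have "\<dots> \<le> (1 + m) * h\<^sup>2 + (cmod y)\<^sup>2 / m"
  proof -
    have "0 \<le> (m * h - cmod y)\<^sup>2 / m" using assms by simp
    also have "\<dots> = m * h\<^sup>2 - 2 * h * cmod y + (cmod y)\<^sup>2 / m"
      using assms by (simp add: power2_eq_square field_simps)
    finally show ?thesis by (simp add: power2_eq_square algebra_simps)
  qed
  finally show ?thesis by (simp add: h_def)
qed

text \<open>The bound is uniform over all processes satisfying the two second-moment estimates; it applies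
  both to the empirical processes and to the limit.\<close>

locale regular_process = prob_space \<Omega> for \<Omega> :: "'o measure" +
  fixes d :: "nat \<Rightarrow> nat" and S :: "nat set" and Z :: "(nat \<Rightarrow> nat \<Rightarrow> real) \<Rightarrow> 'o \<Rightarrow> complex" and A :: real
  assumes finite_S: "finite S" and dims: "\<forall>i\<in>S. 1 \<le> d i" and A_nonneg: "0 \<le> A"
    and meas_Z: "(\<lambda>(t, \<omega>). Z t \<omega>) \<in> borel_measurable (eucl_prod d S \<Otimes>\<^sub>M \<Omega>)"
    and int_Z: "t \<in> space (eucl_prod d S) \<Longrightarrow> integrable \<Omega> (\<lambda>\<omega>. (cmod (Z t \<omega>))\<^sup>2)"
    and Z_le: "t \<in> space (eucl_prod d S) \<Longrightarrow> (\<integral>\<omega>. (cmod (Z t \<omega>))\<^sup>2 \<partial>\<Omega>) \<le> A * weight d S t"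
    and Z_diff_le: "t \<in> space (eucl_prod d S) \<Longrightarrow> t' \<in> space (eucl_prod d S) \<Longrightarrow> 0 \<le> \<delta> \<Longrightarrow>
      (\<And>i k. i \<in> S \<Longrightarrow> k < d i \<Longrightarrow> \<bar>t i k - t' i k\<bar> \<le> \<delta>) \<Longrightarrow>
      (\<integral>\<omega>. (cmod (Z t \<omega> - Z t' \<omega>))\<^sup>2 \<partial>\<Omega>) \<le> A * \<delta>\<^sup>2"
begin

lemma meas_Z_t: "t \<in> space (eucl_prod d S) \<Longrightarrow> Z t \<in> borel_measurable \<Omega>"
  using measurable_compose[OF measurable_Pair1' meas_Z] by simp

lemma int_Z_diff:
  assumes "t \<in> space (eucl_prod d S)" "t' \<in> space (eucl_prod d S)"
  shows "integrable \<Omega> (\<lambda>\<omega>. (cmod (Z t \<omega> - Z t' \<omega>))\<^sup>2)"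
proof (rule Bochner_Integration.integrable_bound)
  show "integrable \<Omega> (\<lambda>\<omega>. 2 * (cmod (Z t \<omega>))\<^sup>2 + 2 * (cmod (Z t' \<omega>))\<^sup>2)"
    using int_Z assms by simp
  have "(cmod (x - y))\<^sup>2 \<le> 2 * (cmod x)\<^sup>2 + 2 * (cmod y)\<^sup>2" for x y
  proof -
    have "(cmod (x - y))\<^sup>2 \<le> (cmod x + cmod y)\<^sup>2"
      by (intro power_mono norm_triangle_ineq4) simp
    also have "\<dots> \<le> 2 * (cmod x)\<^sup>2 + 2 * (cmod y)\<^sup>2"
      using zero_le_power2[of "cmod x - cmod y"] by (simp add: power2_eq_square algebra_simps)
    finally show ?thesis .
  qed
  then show "AE \<omega> in \<Omega>. norm ((cmod (Z t \<omega> - Z t' \<omega>))\<^sup>2) \<le> norm (2 * (cmod (Z t \<omega>))\<^sup>2 + 2 * (cmod (Z t' \<omega>))\<^sup>2)"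
    by (intro AE_I2) simp
qed (use meas_Z_t assms in measurable)

sublocale W: pair_sigma_finite "w_prod d S" \<Omega>
  by (simp add: pair_sigma_finite_def sigma_finite_w_prod finite_S sigma_finite_measure_axioms)

lemma int_pair: "integrable (w_prod d S \<Otimes>\<^sub>M \<Omega>) (\<lambda>(t, \<omega>). (cmod (Z t \<omega>))\<^sup>2)"
proof (rule W.Fubini_integrable)
  have [measurable]: "(\<lambda>(t, \<omega>). Z t \<omega>) \<in> borel_measurable (w_prod d S \<Otimes>\<^sub>M \<Omega>)"
    using meas_Z by (simp cong: measurable_cong_sets sets_pair_measure_cong)
  have "(\<lambda>x. (cmod ((\<lambda>(t, \<omega>). Z t \<omega>) x))\<^sup>2) \<in> borel_measurable (w_prod d S \<Otimes>\<^sub>M \<Omega>)" by measurable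
  then show m: "(\<lambda>(t, \<omega>). (cmod (Z t \<omega>))\<^sup>2) \<in> borel_measurable (w_prod d S \<Otimes>\<^sub>M \<Omega>)"
    by (simp add: split_def)
  have m': "(\<lambda>t. \<integral>\<omega>. (cmod (Z t \<omega>))\<^sup>2 \<partial>\<Omega>) \<in> borel_measurable (w_prod d S)"
    by (rule borel_measurable_lebesgue_integral[OF m])
  show "integrable (w_prod d S) (\<lambda>t. \<integral>\<omega>. norm (case (t, \<omega>) of (t, \<omega>) \<Rightarrow> (cmod (Z t \<omega>))\<^sup>2) \<partial>\<Omega>)"
  proof (rule Bochner_Integration.integrable_bound)
    show "integrable (w_prod d S) (\<lambda>t. A * weight d S t)"
      using integrable_weight[OF finite_S dims] by simp
    show "AE t in w_prod d S. norm (\<integral>\<omega>. norm (case (t, \<omega>) of (t, \<omega>) \<Rightarrow> (cmod (Z t \<omega>))\<^sup>2) \<partial>\<Omega>) \<le> norm (A * weight d S t)"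
      using Z_le A_nonneg weight_nonneg by (intro AE_I2) simp
  qed (use m' in simp)
  show "AE t in w_prod d S. integrable \<Omega> (\<lambda>\<omega>. case (t, \<omega>) of (t, \<omega>) \<Rightarrow> (cmod (Z t \<omega>))\<^sup>2)"
    using int_Z by (intro AE_I2) simp
qed

lemma integrable_limit_integral: "integrable \<Omega> (limit_integral d S Z)"
  using W.integrable_snd[of "\<lambda>t \<omega>. (cmod (Z t \<omega>))\<^sup>2"] int_pair by (simp add: limit_integral_def[abs_def])

lemma integral_limit_integral_le: "(\<integral>\<omega>. limit_integral d S Z \<omega> \<partial>\<Omega>) \<le> A * (\<integral>t. weight d S t \<partial>w_prod d S)"
proof -
  have "(\<integral>\<omega>. limit_integral d S Z \<omega> \<partial>\<Omega>) = (\<integral>t. (\<integral>\<omega>. (cmod (Z t \<omega>))\<^sup>2 \<partial>\<Omega>) \<partial>w_prod d S)"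
    unfolding limit_integral_def by (rule W.Fubini_integral[OF int_pair])
  also have "\<dots> \<le> (\<integral>t. A * weight d S t \<partial>w_prod d S)"
    using integrable_weight[OF finite_S dims] W.integrable_fst[OF int_pair] Z_le
    by (intro integral_mono) auto
  finally show ?thesis by simp
qed

lemma integrable_riemann: "integrable \<Omega> (\<lambda>\<omega>. riemann d S L m (\<lambda>t. Z t \<omega>))"
  unfolding riemann_def
  using int_Z rnd_in_space by (intro Bochner_Integration.integrable_sum integrable_mult_right) (auto simp: nodes_def)

text \<open>Fubini moves the expectation inside the integral over frequencies. Outside the window
  the second moment gives \<open>tail\<close>; inside it, \<open>abs_diff_squares_le\<close>
  compares the process with its value at the rounded point, and the increment bound with
  \<open>\<delta> = 1 / m\<close> applies.\<close>

theorem riemann_error: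
  assumes L: "1 \<le> L" and m: "1 \<le> m"
  shows "(\<integral>\<omega>. \<bar>limit_integral d S Z \<omega> - riemann d S L m (\<lambda>t. Z t \<omega>)\<bar> \<partial>\<Omega>) \<le> A * riemann_err d S L m"
proof -
  let ?W = "w_prod d S" and ?b = "indicator (window d S L) :: _ \<Rightarrow> real" and ?r = "rnd d S m"
  define f where "f t \<omega> = (cmod (Z t \<omega>))\<^sup>2" for t \<omega>
  define g where "g t \<omega> = ?b t * (cmod (Z (?r t) \<omega>))\<^sup>2" for t \<omega>
  have window [measurable]: "window d S L \<in> sets ?W" using window_sets[OF finite_S] by simp
  have g_eq: "g t \<omega> = (\<Sum>\<tau>\<in>nodes d S L m. indicator (cell d S L m \<tau>) t * (cmod (Z \<tau> \<omega>))\<^sup>2)" for t \<omega>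
    unfolding g_def by (rule indicator_window_rnd[OF finite_S, where f = "\<lambda>\<tau>. (cmod (Z \<tau> \<omega>))\<^sup>2"])
  have node_sp: "\<tau> \<in> space (eucl_prod d S)" if "\<tau> \<in> nodes d S L m" for \<tau>
    using that rnd_in_space by (auto simp: nodes_def)
  have f_int: "integrable (?W \<Otimes>\<^sub>M \<Omega>) (\<lambda>(t, \<omega>). f t \<omega>)"
    using int_pair by (simp add: f_def)
  have g_meas: "(\<lambda>(t, \<omega>). g t \<omega>) \<in> borel_measurable (?W \<Otimes>\<^sub>M \<Omega>)"
    unfolding g_eq split_def
  proof (intro borel_measurable_sum)
    fix \<tau> assume "\<tau> \<in> nodes d S L m"
    then have [measurable]: "Z \<tau> \<in> borel_measurable \<Omega>" using meas_Z_t node_sp by blast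
    have [measurable]: "cell d S L m \<tau> \<in> sets ?W" using cell_sets[OF finite_S] by simp
    show "(\<lambda>x. indicator (cell d S L m \<tau>) (fst x) * (cmod (Z \<tau> (snd x)))\<^sup>2) \<in> borel_measurable (?W \<Otimes>\<^sub>M \<Omega>)"
      by measurable
  qed
  have g_int_t: "integrable \<Omega> (g t)" for t
    unfolding g_def[abs_def] using int_Z[OF rnd_in_space] by (rule integrable_mult_right)
  have winint: "integrable ?W (\<lambda>t. A * ?b t)"
    using window emeasure_window_finite[OF finite_S dims L] by (intro integrable_mult_right) (simp add: integrable_indicator_iff)
  have rnd_le: "(\<integral>\<omega>. (cmod (Z (?r t) \<omega>))\<^sup>2 \<partial>\<Omega>) \<le> A" for t
  proof -
    have "A * weight d S (?r t) \<le> A * 1" by (intro mult_left_mono weight_le_1 A_nonneg)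
    with Z_le[OF rnd_in_space, of m t] show ?thesis by simp
  qed
  have g_int: "integrable (?W \<Otimes>\<^sub>M \<Omega>) (\<lambda>(t, \<omega>). g t \<omega>)"
  proof (rule W.Fubini_integrable[OF g_meas])
    show "integrable ?W (\<lambda>t. \<integral>\<omega>. norm (case (t, \<omega>) of (t, \<omega>) \<Rightarrow> g t \<omega>) \<partial>\<Omega>)"
    proof (rule Bochner_Integration.integrable_bound[OF winint])
      have "(\<lambda>t. \<integral>\<omega>. g t \<omega> \<partial>\<Omega>) \<in> borel_measurable ?W"
        by (rule borel_measurable_lebesgue_integral[OF g_meas])
      moreover have "norm (g t \<omega>) = g t \<omega>" for t \<omega> by (simp add: g_def)
      ultimately show "(\<lambda>t. \<integral>\<omega>. norm (case (t, \<omega>) of (t, \<omega>) \<Rightarrow> g t \<omega>) \<partial>\<Omega>) \<in> borel_measurable ?W"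
        by simp
      show "AE t in ?W. norm (\<integral>\<omega>. norm (case (t, \<omega>) of (t, \<omega>) \<Rightarrow> g t \<omega>) \<partial>\<Omega>) \<le> norm (A * ?b t)"
        using rnd_le A_nonneg by (intro AE_I2) (simp add: g_def indicator_def)
    qed
    show "AE t in ?W. integrable \<Omega> (\<lambda>\<omega>. case (t, \<omega>) of (t, \<omega>) \<Rightarrow> g t \<omega>)"
      using g_int_t by simp
  qed
  have fg_int: "integrable (?W \<Otimes>\<^sub>M \<Omega>) (\<lambda>(t, \<omega>). f t \<omega> - g t \<omega>)"
    using Bochner_Integration.integrable_diff[OF f_int g_int] by (simp add: split_def)
  then have abs_int: "integrable (?W \<Otimes>\<^sub>M \<Omega>) (\<lambda>(t, \<omega>). \<bar>f t \<omega> - g t \<omega>\<bar>)"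
    using integrable_abs[OF fg_int] by (simp add: split_def)
  have inner: "(\<integral>\<omega>. \<bar>f t \<omega> - g t \<omega>\<bar> \<partial>\<Omega>)
      \<le> A * (indicator (- window d S L) t * weight d S t) + (3 * A / m) * ?b t"
    if t: "t \<in> space ?W" for t
  proof (cases "t \<in> window d S L")
    case False
    then have "(\<integral>\<omega>. \<bar>f t \<omega> - g t \<omega>\<bar> \<partial>\<Omega>) = (\<integral>\<omega>. (cmod (Z t \<omega>))\<^sup>2 \<partial>\<Omega>)"
      by (simp add: f_def g_def)
    with Z_le[of t] t False show ?thesis by simp
  next
    case True
    have t': "t \<in> space (eucl_prod d S)" using t by simp
    have "(\<integral>\<omega>. \<bar>f t \<omega> - g t \<omega>\<bar> \<partial>\<Omega>)
      \<le> (\<integral>\<omega>. (1 + real m) * (cmod (Z t \<omega> - Z (?r t) \<omega>))\<^sup>2 + (cmod (Z (?r t) \<omega>))\<^sup>2 / real m \<partial>\<Omega>)"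
    proof (rule integral_mono)
      show "integrable \<Omega> (\<lambda>\<omega>. \<bar>f t \<omega> - g t \<omega>\<bar>)"
        using int_Z[OF t'] g_int_t[of t] unfolding f_def
        by (intro integrable_abs Bochner_Integration.integrable_diff)
      show "integrable \<Omega> (\<lambda>\<omega>. (1 + real m) * (cmod (Z t \<omega> - Z (?r t) \<omega>))\<^sup>2 + (cmod (Z (?r t) \<omega>))\<^sup>2 / real m)"
        using int_Z_diff[OF t' rnd_in_space] int_Z[OF rnd_in_space] by simp
      show "\<bar>f t \<omega> - g t \<omega>\<bar> \<le> (1 + real m) * (cmod (Z t \<omega> - Z (?r t) \<omega>))\<^sup>2 + (cmod (Z (?r t) \<omega>))\<^sup>2 / real m" for \<omega>
        using True m abs_diff_squares_le[of "real m" "Z t \<omega>" "Z (?r t) \<omega>"] by (simp add: f_def g_def)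
    qed
    also have "\<dots> = (1 + real m) * (\<integral>\<omega>. (cmod (Z t \<omega> - Z (?r t) \<omega>))\<^sup>2 \<partial>\<Omega>) + (\<integral>\<omega>. (cmod (Z (?r t) \<omega>))\<^sup>2 \<partial>\<Omega>) / real m"
      using int_Z_diff[OF t' rnd_in_space] int_Z[OF rnd_in_space] by simp
    also have "\<dots> \<le> (1 + real m) * (A * (1 / real m)\<^sup>2) + A / real m"
      using rnd_close[OF m] by (intro add_mono mult_left_mono divide_right_mono rnd_le Z_diff_le[OF t' rnd_in_space]) auto
    also have "\<dots> \<le> 3 * A / m"
    proof -
      have "A * 1 \<le> A * real m" using m A_nonneg by (intro mult_left_mono) auto
      then have "A / real m \<le> A" using m by (simp add: divide_le_eq)
      then have "A / real m / real m \<le> A / real m" by (rule divide_right_mono) simp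
      moreover have "(1 + real m) * (A * (1 / real m)\<^sup>2) = A / real m / real m + A / real m"
        using m by (simp add: power2_eq_square field_simps)
      ultimately show ?thesis by simp
    qed
    finally show ?thesis using True by simp
  qed
  \<comment> \<open>Only almost surely: where a path is not square-integrable,
    \<open>limit_integral\<close> takes the default value 0 and the difference cannot be written as
    one integral.\<close>
  have AE: "AE \<omega> in \<Omega>. limit_integral d S Z \<omega> - riemann d S L m (\<lambda>t. Z t \<omega>) = (\<integral>t. f t \<omega> - g t \<omega> \<partial>?W)"
    using W.AE_integrable_snd[OF f_int]
  proof eventually_elim
    case (elim \<omega>)
    have r: "integrable ?W (\<lambda>t. g t \<omega>)" "(\<integral>t. g t \<omega> \<partial>?W) = riemann d S L m (\<lambda>t. Z t \<omega>)"
      unfolding g_def by (rule riemann_eq_integral[OF finite_S dims L, of "\<lambda>t. Z t \<omega>"]; assumption)+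
    show ?case
      using Bochner_Integration.integral_diff[OF elim r(1)] by (simp add: r(2) limit_integral_def f_def)
  qed
  have "(\<integral>\<omega>. \<bar>limit_integral d S Z \<omega> - riemann d S L m (\<lambda>t. Z t \<omega>)\<bar> \<partial>\<Omega>) = (\<integral>\<omega>. \<bar>\<integral>t. f t \<omega> - g t \<omega> \<partial>?W\<bar> \<partial>\<Omega>)"
  proof (rule integral_cong_AE)
    show "(\<lambda>\<omega>. \<bar>\<integral>t. f t \<omega> - g t \<omega> \<partial>?W\<bar>) \<in> borel_measurable \<Omega>"
      using borel_measurable_integrable[OF W.integrable_snd[OF fg_int]] by simp
    show "(\<lambda>\<omega>. \<bar>limit_integral d S Z \<omega> - riemann d S L m (\<lambda>t. Z t \<omega>)\<bar>) \<in> borel_measurable \<Omega>"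
      using borel_measurable_integrable[OF integrable_limit_integral] borel_measurable_integrable[OF integrable_riemann]
      by measurable
  qed (use AE in eventually_elim, simp)
  also have "\<dots> \<le> (\<integral>\<omega>. (\<integral>t. \<bar>f t \<omega> - g t \<omega>\<bar> \<partial>?W) \<partial>\<Omega>)"
  proof (rule integral_mono)
    show "integrable \<Omega> (\<lambda>\<omega>. \<bar>\<integral>t. f t \<omega> - g t \<omega> \<partial>?W\<bar>)"
      using W.integrable_snd[OF fg_int] by (rule integrable_abs)
    show "\<bar>\<integral>t. f t \<omega> - g t \<omega> \<partial>?W\<bar> \<le> (\<integral>t. \<bar>f t \<omega> - g t \<omega>\<bar> \<partial>?W)" for \<omega>
      using integral_norm_bound[of ?W "\<lambda>t. f t \<omega> - g t \<omega>"] by simp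
  qed (rule W.integrable_snd[OF abs_int])
  also have "\<dots> = (\<integral>t. (\<integral>\<omega>. \<bar>f t \<omega> - g t \<omega>\<bar> \<partial>\<Omega>) \<partial>?W)"
    by (rule W.Fubini_integral[OF abs_int])
  also have "\<dots> \<le> (\<integral>t. A * (indicator (- window d S L) t * weight d S t) + (3 * A / m) * ?b t \<partial>?W)"
  proof (rule integral_mono[OF W.integrable_fst[OF abs_int] _ inner])
    show "integrable ?W (\<lambda>t. A * (indicator (- window d S L) t * weight d S t) + (3 * A / m) * ?b t)"
      using integrable_tail[OF finite_S dims, of L] emeasure_window_finite[OF finite_S dims L] window
      by (intro Bochner_Integration.integrable_add integrable_mult_right) (simp_all add: integrable_indicator_iff)
  qed
  also have "\<dots> = A * riemann_err d S L m"
    using integrable_tail[OF finite_S dims, of L] emeasure_window_finite[OF finite_S dims L] window sets.sets_into_space[OF window]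
    by (simp add: riemann_err_def tail_def integrable_indicator_iff Int_absorb2 distrib_left del: space_w_prod)
  finally show ?thesis .
qed

end

section \<open>The empirical process\<close>

text \<open>The mean minimizes the mean square deviation; the freedom in \<open>c\<close> gives two
  variance bounds later.\<close>

lemma avg_variance_le:
  fixes f :: "'a \<Rightarrow> complex"
  assumes "finite A" "A \<noteq> {}"
  shows "avg A (\<lambda>j. (cmod (f j - avg A f))\<^sup>2) \<le> avg A (\<lambda>j. (cmod (f j - c))\<^sup>2)"
proof -
  have "avg A (\<lambda>j. f j - c) = avg A f - c" using assms by (simp add: avg_diff avg_const)
  then show ?thesis
    using avg_variance[OF assms, of "\<lambda>j. f j - c"] zero_le_power2[of "cmod (avg A f - c)"] by simp
qed

section \<open>Centred exponentials on the grid\<close>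

definition gchar :: "nat \<Rightarrow> nat \<Rightarrow> (nat \<Rightarrow> nat \<Rightarrow> real) \<Rightarrow> (nat \<Rightarrow> real) \<Rightarrow> complex" where
  "gchar n e \<gamma> t = avg {1..n} (\<lambda>j. iexp (ip e t (\<gamma> j)))"

definition gdev :: "nat \<Rightarrow> nat \<Rightarrow> (nat \<Rightarrow> nat \<Rightarrow> real) \<Rightarrow> (nat \<Rightarrow> real) \<Rightarrow> nat \<Rightarrow> complex" where
  "gdev n e \<gamma> t j = gchar n e \<gamma> t - iexp (ip e t (\<gamma> j))"

definition gcov :: "nat \<Rightarrow> nat \<Rightarrow> (nat \<Rightarrow> nat \<Rightarrow> real) \<Rightarrow> (nat \<Rightarrow> real) \<Rightarrow> (nat \<Rightarrow> real) \<Rightarrow> complex" where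
  "gcov n e \<gamma> t t' = gchar n e \<gamma> (\<lambda>k. t k - t' k) - gchar n e \<gamma> t * gchar n e \<gamma> (\<lambda>k. - t' k)"

text \<open>\<open>sqrt n\<close> times the expression inside the modulus of \<open>RdCov2\<close>,
  with arbitrary permutations in place of the optimal ones. The mean over the observations has
  become the grid mean \<open>gchar\<close>, which no permutation changes.\<close>

definition emp_process :: "nat \<Rightarrow> (nat \<Rightarrow> nat) \<Rightarrow> (nat \<Rightarrow> nat \<Rightarrow> nat \<Rightarrow> real) \<Rightarrow> nat set \<Rightarrow>
    (nat \<Rightarrow> nat \<Rightarrow> real) \<Rightarrow> (nat \<Rightarrow> nat \<Rightarrow> nat) \<Rightarrow> complex" where
  "emp_process n d g S t \<pi> = (\<Sum>b=1..n. \<Prod>i\<in>S. gdev n (d i) (g i) (t i) (\<pi> i b)) / of_real (sqrt n)"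

lemma iexp_neg: "iexp (- x) = cnj (iexp x)"
  by (simp add: exp_cnj)

lemma iexp_diff: "iexp (x - y) = iexp x * cnj (iexp y)"
  by (simp add: exp_cnj right_diff_distrib exp_diff exp_minus field_simps)

lemma ip_neg: "ip e (\<lambda>k. - t k) u = - ip e t u"
  by (simp add: ip_def sum_negf)

lemma ip_diff: "ip e (\<lambda>k. t k - t' k) u = ip e t u - ip e t' u"
  by (simp add: ip_def sum_subtractf left_diff_distrib)

lemma gchar_neg: "gchar n e \<gamma> (\<lambda>k. - t k) = cnj (gchar n e \<gamma> t)"
  unfolding gchar_def cnj_avg ip_neg iexp_neg ..

lemma gdev_neg: "gdev n e \<gamma> (\<lambda>k. - t k) j = cnj (gdev n e \<gamma> t j)"
  unfolding gdev_def gchar_neg ip_neg iexp_neg by simp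

lemma gdev_centered: "1 \<le> n \<Longrightarrow> (\<Sum>j=1..n. gdev n e \<gamma> t j) = 0"
  by (simp add: gdev_def sum_subtractf gchar_def avg_def)

lemma norm_gchar_le: "1 \<le> n \<Longrightarrow> cmod (gchar n e \<gamma> t) \<le> 1"
  unfolding gchar_def by (rule norm_avg_le_const) auto

lemma norm_gdev_le: "1 \<le> n \<Longrightarrow> cmod (gdev n e \<gamma> t j) \<le> 2"
  unfolding gdev_def
  using norm_triangle_ineq4[of "gchar n e \<gamma> t" "iexp (ip e t (\<gamma> j))"] norm_gchar_le[of n e \<gamma> t] by simp

lemma gcov_eq:
  assumes "1 \<le> n"
  shows "avg {1..n} (\<lambda>j. gdev n e \<gamma> t j * cnj (gdev n e \<gamma> t' j)) = gcov n e \<gamma> t t'"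
proof -
  let ?x = "\<lambda>t j. iexp (ip e t (\<gamma> j))"
  have ne: "{1..n} \<noteq> {}" using assms by simp
  have "avg {1..n} (\<lambda>j. gdev n e \<gamma> t j * cnj (gdev n e \<gamma> t' j))
    = avg {1..n} (\<lambda>j. gchar n e \<gamma> t * cnj (gchar n e \<gamma> t') - gchar n e \<gamma> t * cnj (?x t' j)
        - ?x t j * cnj (gchar n e \<gamma> t') + ?x (\<lambda>k. t k - t' k) j)"
    unfolding gdev_def ip_diff iexp_diff by (intro avg_cong) (simp only: complex_cnj_diff, simp only: algebra_simps)
  also have "\<dots> = gchar n e \<gamma> t * cnj (gchar n e \<gamma> t') - gchar n e \<gamma> t * cnj (gchar n e \<gamma> t')
      - gchar n e \<gamma> t * cnj (gchar n e \<gamma> t') + gchar n e \<gamma> (\<lambda>k. t k - t' k)"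
    by (simp only: avg_add avg_diff avg_cmult avg_cmult_right avg_const[OF finite_atLeastAtMost ne])
       (simp only: cnj_avg[symmetric] gchar_def[symmetric])
  finally show ?thesis by (simp add: gcov_def gchar_neg)
qed

text \<open>Negating the frequency conjugates the deviation, so products without conjugation are
  covariances at \<open>- t'\<close>: the empirical form of the relation function of the
  limit.\<close>

lemma gcov_neg_eq:
  assumes "1 \<le> n"
  shows "avg {1..n} (\<lambda>j. gdev n e \<gamma> t j * gdev n e \<gamma> t' j) = gcov n e \<gamma> t (\<lambda>k. - t' k)"
  using gcov_eq[OF assms, of e \<gamma> t "\<lambda>k. - t' k"] by (simp only: gdev_neg complex_cnj_cnj)

lemma gcov_self:
  "1 \<le> n \<Longrightarrow> gcov n e \<gamma> t t = of_real (avg {1..n} (\<lambda>j. (cmod (gdev n e \<gamma> t j))\<^sup>2))"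
  by (simp only: gcov_eq[symmetric] avg_of_real[symmetric] complex_norm_square)

lemma norm_iexp_diff_le: "cmod (iexp x - iexp y) \<le> \<bar>x - y\<bar>"
proof -
  have "iexp x - iexp y = iexp y * (iexp (x - y) - 1)"
    by (simp add: algebra_simps flip: exp_add)
  then have "cmod (iexp x - iexp y) = cmod (iexp (x - y) - 1)" by (simp add: norm_mult)
  also have "\<dots> \<le> \<bar>x - y\<bar>" using iexp_approx1[of "x - y" 0] by simp
  finally show ?thesis .
qed

lemma abs_ip_le:
  assumes "\<And>k. k < e \<Longrightarrow> \<bar>t k\<bar> \<le> \<delta>" "\<And>k. k < e \<Longrightarrow> \<bar>u k\<bar> \<le> 1"
  shows "\<bar>ip e t u\<bar> \<le> real e * \<delta>"
proof -
  have "\<bar>ip e t u\<bar> \<le> (\<Sum>k<e. \<bar>t k * u k\<bar>)" unfolding ip_def by (rule sum_abs)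
  also have "\<dots> \<le> (\<Sum>k<e. \<delta>)"
  proof (rule sum_mono)
    fix k assume k: "k \<in> {..<e}"
    have "\<bar>t k\<bar> * \<bar>u k\<bar> \<le> \<delta> * 1"
      using assms[of k] k by (intro mult_mono) auto
    then show "\<bar>t k * u k\<bar> \<le> \<delta>" by (simp add: abs_mult)
  qed
  finally show ?thesis by simp
qed

lemma gdev_lipschitz:
  assumes n: "1 \<le> n" and \<gamma>: "\<And>j k. j \<in> {1..n} \<Longrightarrow> k < e \<Longrightarrow> \<bar>\<gamma> j k\<bar> \<le> 1" and j: "j \<in> {1..n}"
    and \<delta>: "\<And>k. k < e \<Longrightarrow> \<bar>t k - t' k\<bar> \<le> \<delta>"
  shows "cmod (gdev n e \<gamma> t j - gdev n e \<gamma> t' j) \<le> 2 * (real e * \<delta>)"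
proof -
  have x: "cmod (iexp (ip e t (\<gamma> j)) - iexp (ip e t' (\<gamma> j))) \<le> real e * \<delta>" if "j \<in> {1..n}" for j
    using norm_iexp_diff_le[of "ip e t (\<gamma> j)" "ip e t' (\<gamma> j)"] abs_ip_le[of e "\<lambda>k. t k - t' k" \<delta> "\<gamma> j"] \<delta> \<gamma>[OF that]
    by (simp add: ip_diff)
  have "gchar n e \<gamma> t - gchar n e \<gamma> t' = avg {1..n} (\<lambda>j. iexp (ip e t (\<gamma> j)) - iexp (ip e t' (\<gamma> j)))"
    by (simp add: gchar_def avg_diff)
  also have "cmod \<dots> \<le> real e * \<delta>" by (rule norm_avg_le_const) (use n x in auto)
  finally have g: "cmod (gchar n e \<gamma> t - gchar n e \<gamma> t') \<le> real e * \<delta>" .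
  have "gdev n e \<gamma> t j - gdev n e \<gamma> t' j
      = (gchar n e \<gamma> t - gchar n e \<gamma> t') - (iexp (ip e t (\<gamma> j)) - iexp (ip e t' (\<gamma> j)))"
    by (simp add: gdev_def)
  also have "cmod \<dots> \<le> real e * \<delta> + real e * \<delta>"
    by (rule order_trans[OF norm_triangle_ineq4]) (intro add_mono g x j)
  finally show ?thesis by (simp only: mult_2)
qed

text \<open>The variance of the exponentials is at most their mean square distance from any
  constant. Distance from 0 gives the bound 1; distance from 1 gives the squared norm of
  \<open>t\<close>, with the factor \<open>e\<close> from a coordinatewise estimate of the inner
  product.\<close>

lemma gdev_second_moment_le:
  assumes n: "1 \<le> n" and e: "1 \<le> e" and \<gamma>: "\<And>j k. j \<in> {1..n} \<Longrightarrow> k < e \<Longrightarrow> \<bar>\<gamma> j k\<bar> \<le> 1"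
  shows "avg {1..n} (\<lambda>j. (cmod (gdev n e \<gamma> t j))\<^sup>2) \<le> (real e)\<^sup>2 * trunc_sq e t"
proof -
  let ?x = "\<lambda>j. iexp (ip e t (\<gamma> j))"
  have ne: "finite {1..n}" "{1..n} \<noteq> {}" using n by auto
  have e1: "1 \<le> (real e)\<^sup>2" using e by simp
  have v: "avg {1..n} (\<lambda>j. (cmod (gdev n e \<gamma> t j))\<^sup>2) \<le> avg {1..n} (\<lambda>j. (cmod (?x j - c))\<^sup>2)" for c
    using avg_variance_le[OF ne, of ?x c] by (simp add: gdev_def gchar_def norm_minus_commute)
  have "avg {1..n} (\<lambda>j. (cmod (?x j - 0))\<^sup>2) \<le> 1" by (rule avg_le_const) (use ne in auto)
  with v[of 0] e1 have 1: "avg {1..n} (\<lambda>j. (cmod (gdev n e \<gamma> t j))\<^sup>2) \<le> (real e)\<^sup>2 * 1" by linarith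
  have "avg {1..n} (\<lambda>j. (cmod (?x j - 1))\<^sup>2) \<le> (real e * enorm e t)\<^sup>2"
  proof (rule avg_le_const)
    fix j assume j: "j \<in> {1..n}"
    have "cmod (?x j - 1) \<le> \<bar>ip e t (\<gamma> j)\<bar>" using norm_iexp_diff_le[of "ip e t (\<gamma> j)" 0] by simp
    also have "\<dots> \<le> real e * enorm e t" by (rule abs_ip_le) (use abs_le_enorm \<gamma>[OF j] in auto)
    finally show "(cmod (?x j - 1))\<^sup>2 \<le> (real e * enorm e t)\<^sup>2" by (intro power_mono) auto
  qed (use ne in auto)
  with v[of 1] have 2: "avg {1..n} (\<lambda>j. (cmod (gdev n e \<gamma> t j))\<^sup>2) \<le> (real e)\<^sup>2 * (enorm e t)\<^sup>2"
    by (simp add: power_mult_distrib)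
  show ?thesis unfolding trunc_sq_def using 1 2 by (simp add: min_def)
qed

text \<open>The correction factor for the sums below: \<open>s\<close> independent permutations each contribute
  a correlation \<open>- 1 / (n - 1)\<close> between distinct positions.\<close>

definition corr_factor :: "nat \<Rightarrow> nat \<Rightarrow> real" where
  "corr_factor n s = 1 + real (n - 1) * (- 1 / real (n - 1)) ^ s"

text \<open>For \<open>s = 1\<close> the factor would be 0, as centred values over all positions
  cancel. From \<open>s = 2\<close> on, the \<open>n - 1\<close> correlations together are at most
  \<open>1 / (n - 1)\<close>.\<close>

lemma abs_corr_factor_le:
  assumes "2 \<le> n" "2 \<le> s" shows "\<bar>corr_factor n s - 1\<bar> \<le> 1 / real (n - 1)"
proof -
  have m: "real (n - 1) \<ge> 1" using assms by simp
  have "\<bar>corr_factor n s - 1\<bar> = real (n - 1) * (1 / real (n - 1)) ^ s"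
    by (simp add: corr_factor_def abs_mult power_abs)
  also have "\<dots> \<le> real (n - 1) * (1 / real (n - 1)) ^ 2"
    using m assms by (intro mult_left_mono power_decreasing) (auto simp del: of_nat_diff)
  also have "\<dots> = 1 / real (n - 1)" using m by (simp add: power2_eq_square)
  finally show ?thesis .
qed

lemma corr_factor_le_2: "2 \<le> n \<Longrightarrow> 2 \<le> s \<Longrightarrow> corr_factor n s \<le> 2"
proof -
  assume a: "2 \<le> n" "2 \<le> s"
  have "1 / real (n - 1) \<le> 1" using a by simp
  then have "corr_factor n s - 1 \<le> 1"
    by (rule order_trans[OF abs_ge_self order_trans[OF abs_corr_factor_le[OF a]]])
  then show ?thesis by simp
qed

lemma corr_factor_tendsto:
  assumes "2 \<le> s" shows "(\<lambda>n. corr_factor n s) \<longlonglongrightarrow> 1"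
proof -
  have "(\<lambda>n. corr_factor n s - 1) \<longlonglongrightarrow> 0"
  proof (rule Lim_null_comparison)
    show "eventually (\<lambda>n. norm (corr_factor n s - 1) \<le> 1 / real (n - 1)) sequentially"
      using abs_corr_factor_le[OF _ assms] by (intro eventually_sequentiallyI[of 2]) simp
    show "(\<lambda>n. 1 / real (n - 1)) \<longlonglongrightarrow> 0"
      using LIMSEQ_imp_Suc[of "\<lambda>n. 1 / real (n - 1)" 0] lim_1_over_n by simp
  qed
  then show ?thesis by (simp add: LIM_zero_iff)
qed

text \<open>In the double sum over positions, equal positions behave as independent draws. For
  distinct ones each of the \<open>card S\<close> independent permutations contributes a factor
  \<open>- 1 / (n - 1)\<close>.\<close>

lemma avg_sum_prod_sum_prod:
  fixes f h :: "nat \<Rightarrow> nat \<Rightarrow> complex"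
  assumes I: "finite I" "S \<subseteq> I" and n: "1 \<le> n" and h: "\<And>i. i \<in> S \<Longrightarrow> (\<Sum>j=1..n. h i j) = 0"
  shows "avg (perm_tuples I n) (\<lambda>\<pi>. (\<Sum>b=1..n. \<Prod>i\<in>S. f i (\<pi> i b)) * (\<Sum>b=1..n. \<Prod>i\<in>S. h i (\<pi> i b)))
    = of_real (real n * corr_factor n (card S)) * (\<Prod>i\<in>S. avg {1..n} (\<lambda>j. f i j * h i j))"
proof -
  let ?k = "\<Prod>i\<in>S. avg {1..n} (\<lambda>j. f i j * h i j)" and ?PT = "perm_tuples I n"
  let ?q = "complex_of_real ((- 1 / real (n - 1)) ^ card S)"
  have pair: "avg ?PT (\<lambda>\<pi>. (\<Prod>i\<in>S. f i (\<pi> i b)) * (\<Prod>i\<in>S. h i (\<pi> i b'))) = (if b = b' then ?k else ?q * ?k)"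
    if b: "b \<in> {1..n}" "b' \<in> {1..n}" for b b'
  proof -
    have "avg ?PT (\<lambda>\<pi>. (\<Prod>i\<in>S. f i (\<pi> i b)) * (\<Prod>i\<in>S. h i (\<pi> i b')))
      = avg ?PT (\<lambda>\<pi>. \<Prod>i\<in>S. (\<lambda>p. f i (p b) * h i (p b')) (\<pi> i))"
      by (simp add: prod.distrib)
    also have "\<dots> = (\<Prod>i\<in>S. avg (perms n) (\<lambda>p. f i (p b) * h i (p b')))"
      unfolding perm_tuples_def by (rule avg_PiE_prod_subset) (use I in auto)
    also have "\<dots> = (if b = b' then ?k else ?q * ?k)"
    proof (cases "b = b'")
      case True
      have "avg (perms n) (\<lambda>p. f i (p b) * h i (p b)) = avg {1..n} (\<lambda>j. f i j * h i j)" for i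
        by (rule avg_perms_point[OF b(1), of "\<lambda>j. f i j * h i j"])
      with True show ?thesis by simp
    next
      case False
      have "(\<Prod>i\<in>S. avg (perms n) (\<lambda>p. f i (p b) * h i (p b')))
        = (\<Prod>i\<in>S. complex_of_real (- 1 / real (n - 1)) * avg {1..n} (\<lambda>j. f i j * h i j))"
      proof (rule prod.cong[OF refl])
        fix i assume "i \<in> S"
        from avg_perms_pair[OF b False h[OF this], of "f i"]
        show "avg (perms n) (\<lambda>p. f i (p b) * h i (p b'))
          = complex_of_real (- 1 / real (n - 1)) * avg {1..n} (\<lambda>j. f i j * h i j)"
          by (simp del: of_nat_diff)
      qed
      also have "\<dots> = ?q * ?k"
        by (simp only: prod.distrib prod_constant of_real_power)
      finally show ?thesis using False by simp
    qed
    finally show ?thesis .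
  qed
  have "avg ?PT (\<lambda>\<pi>. (\<Sum>b=1..n. \<Prod>i\<in>S. f i (\<pi> i b)) * (\<Sum>b=1..n. \<Prod>i\<in>S. h i (\<pi> i b)))
    = (\<Sum>b=1..n. \<Sum>b'=1..n. avg ?PT (\<lambda>\<pi>. (\<Prod>i\<in>S. f i (\<pi> i b)) * (\<Prod>i\<in>S. h i (\<pi> i b'))))"
    by (simp only: sum_product avg_sum)
  also have "\<dots> = (\<Sum>b=1..n. \<Sum>b'=1..n. if b = b' then ?k else ?q * ?k)"
    by (intro sum.cong refl pair)
  also have "\<dots> = (\<Sum>b=1..n. ?k + of_nat (n - 1) * (?q * ?k))"
  proof (rule sum.cong[OF refl])
    fix b assume b: "b \<in> {1..n}"
    then have "(\<Sum>b'=1..n. if b = b' then ?k else ?q * ?k) = ?k + (\<Sum>b'\<in>{1..n} - {b}. if b = b' then ?k else ?q * ?k)"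
      by (subst sum.remove[of _ b]) simp_all
    also have "(\<Sum>b'\<in>{1..n} - {b}. if b = b' then ?k else ?q * ?k) = (\<Sum>b'\<in>{1..n} - {b}. ?q * ?k)"
      by (intro sum.cong) auto
    finally show "(\<Sum>b'=1..n. if b = b' then ?k else ?q * ?k) = ?k + of_nat (n - 1) * (?q * ?k)"
      using b by simp
  qed
  also have "\<dots> = of_real (real n * corr_factor n (card S)) * ?k"
    by (simp add: corr_factor_def algebra_simps del: of_nat_diff of_real_power)
  finally show ?thesis .
qed

section \<open>Moment bounds for the empirical process\<close>

locale grid_array =
  fixes I :: "nat set" and d :: "nat \<Rightarrow> nat" and g :: "nat \<Rightarrow> nat \<Rightarrow> nat \<Rightarrow> real" and n :: nat and S :: "nat set"
  assumes finite_I: "finite I" and S_sub: "S \<subseteq> I" and card_S: "2 \<le> card S" and n2: "2 \<le> n"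
    and dims: "\<forall>i\<in>S. 1 \<le> d i"
    and grid_le: "\<And>i j k. i \<in> S \<Longrightarrow> j \<in> {1..n} \<Longrightarrow> k < d i \<Longrightarrow> \<bar>g i j k\<bar> \<le> 1"
begin

abbreviation "em \<equiv> emp_process n d g S"

lemma n1: "1 \<le> n" using n2 by simp

lemma finite_S: "finite S" using finite_subset[OF S_sub finite_I] .

lemma avg_emp_mult_cnj:
  "avg (perm_tuples I n) (\<lambda>\<pi>. em t \<pi> * cnj (em t' \<pi>))
    = of_real (corr_factor n (card S)) * (\<Prod>i\<in>S. gcov n (d i) (g i) (t i) (t' i))"
proof -
  let ?f = "\<lambda>i j. gdev n (d i) (g i) (t i) j" and ?h = "\<lambda>i j. cnj (gdev n (d i) (g i) (t' i) j)"
  have c: "(\<Sum>j=1..n. ?h i j) = 0" for i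
    using gdev_centered[OF n1, of "d i" "g i" "t' i"] by (metis cnj_sum complex_cnj_zero)
  have "em t \<pi> * cnj (em t' \<pi>) = (\<Sum>b=1..n. \<Prod>i\<in>S. ?f i (\<pi> i b)) * (\<Sum>b=1..n. \<Prod>i\<in>S. ?h i (\<pi> i b)) / of_nat n" for \<pi>
  proof -
    have "complex_of_real (sqrt n) * complex_of_real (sqrt n) = of_nat n"
      by (simp flip: of_real_mult)
    then show ?thesis by (simp add: emp_process_def)
  qed
  then have "avg (perm_tuples I n) (\<lambda>\<pi>. em t \<pi> * cnj (em t' \<pi>))
    = avg (perm_tuples I n) (\<lambda>\<pi>. (\<Sum>b=1..n. \<Prod>i\<in>S. ?f i (\<pi> i b)) * (\<Sum>b=1..n. \<Prod>i\<in>S. ?h i (\<pi> i b))) / of_nat n"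
    by (simp only: avg_divide)
  also have "\<dots> = of_real (real n * corr_factor n (card S)) * (\<Prod>i\<in>S. avg {1..n} (\<lambda>j. ?f i j * ?h i j)) / of_nat n"
    by (subst avg_sum_prod_sum_prod[OF finite_I S_sub n1 c]) simp
  also have "\<dots> = of_real (corr_factor n (card S)) * (\<Prod>i\<in>S. gcov n (d i) (g i) (t i) (t' i))"
    unfolding gcov_eq[OF n1] using n1 by simp
  finally show ?thesis .
qed

lemma avg_emp_diff:
  "avg (perm_tuples I n) (\<lambda>\<pi>. (cmod (em t \<pi> - em t' \<pi>))\<^sup>2) = corr_factor n (card S) *
    Re ((\<Prod>i\<in>S. gcov n (d i) (g i) (t i) (t i)) - 2 * (\<Prod>i\<in>S. gcov n (d i) (g i) (t i) (t' i))
      + (\<Prod>i\<in>S. gcov n (d i) (g i) (t' i) (t' i)))"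
proof -
  have sq: "(cmod (x - y))\<^sup>2 = Re (x * cnj x) - 2 * Re (x * cnj y) + Re (y * cnj y)" for x y
    by (simp add: cmod_power2, simp add: power2_eq_square algebra_simps)
  have "avg (perm_tuples I n) (\<lambda>\<pi>. (cmod (em t \<pi> - em t' \<pi>))\<^sup>2)
    = Re (avg (perm_tuples I n) (\<lambda>\<pi>. em t \<pi> * cnj (em t \<pi>)))
      - 2 * Re (avg (perm_tuples I n) (\<lambda>\<pi>. em t \<pi> * cnj (em t' \<pi>)))
      + Re (avg (perm_tuples I n) (\<lambda>\<pi>. em t' \<pi> * cnj (em t' \<pi>)))"
    by (simp only: sq avg_add avg_diff avg_cmult Re_avg)
  also have "\<dots> = corr_factor n (card S) *
    Re ((\<Prod>i\<in>S. gcov n (d i) (g i) (t i) (t i)) - 2 * (\<Prod>i\<in>S. gcov n (d i) (g i) (t i) (t' i))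
      + (\<Prod>i\<in>S. gcov n (d i) (g i) (t' i) (t' i)))"
    unfolding avg_emp_mult_cnj by (simp add: algebra_simps)
  finally show ?thesis .
qed

text \<open>The first summand serves the second moments, the second one the increments; the leading
  2 in both bounds \<open>corr_factor\<close>. It depends on neither \<open>n\<close> nor the grid,
  so it can be passed on to the limit.\<close>

definition moment_bound :: real where
  "moment_bound = 2 * (\<Prod>i\<in>S. (real (d i))\<^sup>2) + 2 * (2 ^ card S * (\<Sum>i\<in>S. real (d i)))\<^sup>2"

lemma moment_bound_nonneg: "0 \<le> moment_bound"
  unfolding moment_bound_def by (intro add_nonneg_nonneg mult_nonneg_nonneg prod_nonneg) auto

lemma emp_second_moment:
  "avg (perm_tuples I n) (\<lambda>\<pi>. (cmod (em t \<pi>))\<^sup>2) \<le> moment_bound * weight d S t"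
proof -
  define v where "v i = avg {1..n} (\<lambda>j. (cmod (gdev n (d i) (g i) (t i) j))\<^sup>2)" for i
  have "complex_of_real (avg (perm_tuples I n) (\<lambda>\<pi>. (cmod (em t \<pi>))\<^sup>2))
    = avg (perm_tuples I n) (\<lambda>\<pi>. em t \<pi> * cnj (em t \<pi>))"
    by (simp only: avg_of_real[symmetric] complex_norm_square)
  also have "\<dots> = of_real (corr_factor n (card S) * (\<Prod>i\<in>S. v i))"
    by (simp add: avg_emp_mult_cnj gcov_self[OF n1] v_def)
  finally have "avg (perm_tuples I n) (\<lambda>\<pi>. (cmod (em t \<pi>))\<^sup>2) = corr_factor n (card S) * (\<Prod>i\<in>S. v i)"
    by (simp only: of_real_eq_iff)
  also have "\<dots> \<le> 2 * (\<Prod>i\<in>S. (real (d i))\<^sup>2 * trunc_sq (d i) (t i))"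
  proof (rule mult_mono)
    show "(\<Prod>i\<in>S. v i) \<le> (\<Prod>i\<in>S. (real (d i))\<^sup>2 * trunc_sq (d i) (t i))"
    proof (rule prod_mono)
      fix i assume i: "i \<in> S"
      show "0 \<le> v i \<and> v i \<le> (real (d i))\<^sup>2 * trunc_sq (d i) (t i)"
        unfolding v_def using gdev_second_moment_le[OF n1, of "d i" "g i" "t i"] dims grid_le i
        by (auto intro!: avg_nonneg)
    qed
    show "0 \<le> (\<Prod>i\<in>S. v i)" unfolding v_def by (intro prod_nonneg avg_nonneg) auto
  qed (use corr_factor_le_2[OF n2 card_S] in auto)
  also have "\<dots> = 2 * (\<Prod>i\<in>S. (real (d i))\<^sup>2) * weight d S t"
    by (simp add: prod.distrib weight_def)
  also have "\<dots> \<le> moment_bound * weight d S t"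
    by (intro mult_right_mono weight_nonneg) (simp add: moment_bound_def)
  finally show ?thesis .
qed

text \<open>Up to the common factor \<open>corr_factor\<close>, the second moment under permutations
  equals the one under independent uniform coordinates, where a pointwise Lipschitz estimate is
  possible. Halving the deviations makes differences of products telescope and costs
  \<open>2 ^ card S\<close>.\<close>

lemma emp_increment:
  assumes \<delta>: "\<And>i k. i \<in> S \<Longrightarrow> k < d i \<Longrightarrow> \<bar>t i k - t' i k\<bar> \<le> \<delta>" and \<delta>0: "0 \<le> \<delta>"
  shows "avg (perm_tuples I n) (\<lambda>\<pi>. (cmod (em t \<pi> - em t' \<pi>))\<^sup>2) \<le> moment_bound * \<delta>\<^sup>2"
proof -
  let ?J = "PiE S (\<lambda>_. {1..n})"
  let ?a = "\<lambda>t j. \<Prod>i\<in>S. gdev n (d i) (g i) (t i) (j i)"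
  let ?D = "2 ^ card S * (\<Sum>i\<in>S. real (d i))"
  have finJ: "finite ?J" "?J \<noteq> {}" using finite_S n1 by (auto intro: finite_PiE simp: PiE_eq_empty_iff)
  have cov: "avg ?J (\<lambda>j. ?a t j * cnj (?a t' j)) = (\<Prod>i\<in>S. gcov n (d i) (g i) (t i) (t' i))" for t t'
  proof -
    have "avg ?J (\<lambda>j. ?a t j * cnj (?a t' j))
      = avg ?J (\<lambda>j. \<Prod>i\<in>S. gdev n (d i) (g i) (t i) (j i) * cnj (gdev n (d i) (g i) (t' i) (j i)))"
      by (simp add: prod.distrib)
    also have "\<dots> = (\<Prod>i\<in>S. gcov n (d i) (g i) (t i) (t' i))"
      using avg_PiE_prod[of S "\<lambda>_. {1..n}" "\<lambda>i j. gdev n (d i) (g i) (t i) j * cnj (gdev n (d i) (g i) (t' i) j)"]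
        finite_S by (simp only: gcov_eq[OF n1] finite_atLeastAtMost)
    finally show ?thesis .
  qed
  have sq: "(cmod (x - y))\<^sup>2 = Re (x * cnj x - 2 * (x * cnj y) + y * cnj y)" for x y
    by (simp add: cmod_power2, simp add: power2_eq_square algebra_simps)
  have "Re ((\<Prod>i\<in>S. gcov n (d i) (g i) (t i) (t i)) - 2 * (\<Prod>i\<in>S. gcov n (d i) (g i) (t i) (t' i))
      + (\<Prod>i\<in>S. gcov n (d i) (g i) (t' i) (t' i))) = avg ?J (\<lambda>j. (cmod (?a t j - ?a t' j))\<^sup>2)"
    unfolding sq by (simp only: Re_avg[symmetric] avg_add avg_diff avg_cmult cov)
  moreover have "avg ?J (\<lambda>j. (cmod (?a t j - ?a t' j))\<^sup>2) \<le> (?D * \<delta>)\<^sup>2"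
  proof (rule avg_le_const[OF finJ])
    fix j assume j: "j \<in> ?J"
    have ji: "j i \<in> {1..n}" if "i \<in> S" for i using PiE_mem[OF j that] .
    have half: "?a t j = 2 ^ card S * (\<Prod>i\<in>S. gdev n (d i) (g i) (t i) (j i) / 2)" for t
      by (simp add: prod_dividef)
    have "cmod ((\<Prod>i\<in>S. gdev n (d i) (g i) (t i) (j i) / 2) - (\<Prod>i\<in>S. gdev n (d i) (g i) (t' i) (j i) / 2))
      \<le> (\<Sum>i\<in>S. cmod (gdev n (d i) (g i) (t i) (j i) / 2 - gdev n (d i) (g i) (t' i) (j i) / 2))"
      using norm_gdev_le[OF n1] by (intro norm_prod_diff) (simp_all add: norm_divide)
    also have "\<dots> \<le> (\<Sum>i\<in>S. real (d i) * \<delta>)"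
    proof (rule sum_mono)
      fix i assume i: "i \<in> S"
      have "cmod (gdev n (d i) (g i) (t i) (j i) - gdev n (d i) (g i) (t' i) (j i)) \<le> 2 * (real (d i) * \<delta>)"
        by (rule gdev_lipschitz[OF n1 _ ji[OF i]]) (use grid_le \<delta> i in auto)
      then show "cmod (gdev n (d i) (g i) (t i) (j i) / 2 - gdev n (d i) (g i) (t' i) (j i) / 2) \<le> real (d i) * \<delta>"
        by (simp add: norm_divide flip: diff_divide_distrib)
    qed
    finally have "cmod (?a t j - ?a t' j) \<le> 2 ^ card S * (\<Sum>i\<in>S. real (d i) * \<delta>)"
      unfolding half right_diff_distrib[symmetric] norm_mult by (simp add: norm_power)
    then have "cmod (?a t j - ?a t' j) \<le> ?D * \<delta>" by (simp add: sum_distrib_right mult.assoc)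
    then show "(cmod (?a t j - ?a t' j))\<^sup>2 \<le> (?D * \<delta>)\<^sup>2" by (intro power_mono) auto
  qed
  moreover have "0 \<le> avg ?J (\<lambda>j. (cmod (?a t j - ?a t' j))\<^sup>2)" by (rule avg_nonneg) simp
  ultimately have "avg (perm_tuples I n) (\<lambda>\<pi>. (cmod (em t \<pi> - em t' \<pi>))\<^sup>2) \<le> 2 * (?D * \<delta>)\<^sup>2"
    unfolding avg_emp_diff using corr_factor_le_2[OF n2 card_S] by (intro mult_mono) auto
  also have "\<dots> = 2 * ?D\<^sup>2 * \<delta>\<^sup>2" by (simp add: power_mult_distrib)
  also have "\<dots> \<le> moment_bound * \<delta>\<^sup>2"
    by (intro mult_right_mono) (simp_all add: moment_bound_def prod_nonneg)
  finally show ?thesis .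
qed

lemma measurable_ip: "(\<lambda>t. ip e t u) \<in> borel_measurable (eucl e)"
  unfolding ip_def by measurable

lemma measurable_emp: "(\<lambda>t. em t \<pi>) \<in> borel_measurable (eucl_prod d S)"
proof -
  have [measurable]: "(\<lambda>t. ip (d i) (t i) u) \<in> borel_measurable (eucl_prod d S)" if "i \<in> S" for i u
    using measurable_compose[OF measurable_eucl_prod_component[OF that] measurable_ip] .
  show ?thesis
    unfolding emp_process_def gdev_def gchar_def avg_def by measurable
qed

theorem regular_emp: "regular_process (uniform_count_measure (perm_tuples I n)) d S em moment_bound"
proof -
  let ?PT = "perm_tuples I n"
  let ?\<Omega> = "uniform_count_measure ?PT"
  have fin: "finite ?PT" using finite_I by simp
  interpret P: prob_space ?\<Omega>
    by (rule prob_space_uniform_count_measure) (use fin in auto)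
  have int: "(\<integral>\<pi>. f \<pi> \<partial>?\<Omega>) = avg ?PT f" for f :: "_ \<Rightarrow> real"
    using integral_uniform_count_measure[OF fin, of f] by (simp add: avg_def)
  show ?thesis
  proof
    show "(\<lambda>(t, \<pi>). em t \<pi>) \<in> borel_measurable (eucl_prod d S \<Otimes>\<^sub>M ?\<Omega>)"
    proof -
      \<comment> \<open>Joint measurability follows from measurability in the frequency alone,
        because there are finitely many tuples of permutations.\<close>
      have "(\<lambda>x. em (fst x) (snd x)) \<in> borel_measurable (eucl_prod d S \<Otimes>\<^sub>M count_space ?PT)"
        by (rule measurable_compose_countable'[where f = "\<lambda>\<pi> x. em (fst x) \<pi>" and g = snd and I = ?PT])
           (use measurable_compose[OF measurable_fst measurable_emp] fin in \<open>auto intro: countable_finite\<close>)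
      then show ?thesis
        by (simp add: split_def measurable_cong_sets[OF sets_pair_measure_cong[OF refl sets_uniform_count_measure_count_space] refl])
    qed
    show "integrable ?\<Omega> (\<lambda>\<pi>. (cmod (em t \<pi>))\<^sup>2)" for t
      unfolding uniform_count_measure_def by (rule integrable_point_measure_finite[OF fin])
    show "(\<integral>\<pi>. (cmod (em t \<pi>))\<^sup>2 \<partial>?\<Omega>) \<le> moment_bound * weight d S t" for t
      unfolding int by (rule emp_second_moment)
    show "(\<integral>\<pi>. (cmod (em t \<pi> - em t' \<pi>))\<^sup>2 \<partial>?\<Omega>) \<le> moment_bound * \<delta>\<^sup>2"
      if "0 \<le> \<delta>" "\<And>i k. i \<in> S \<Longrightarrow> k < d i \<Longrightarrow> \<bar>t i k - t' i k\<bar> \<le> \<delta>" for t t' \<delta>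
      unfolding int by (rule emp_increment) (use that in auto)
  qed (use finite_S dims moment_bound_nonneg in auto)
qed

end

section \<open>Convergence of the finite-dimensional laws\<close>

lemma measurable_grid:
  assumes "\<And>j. j \<in> {1..n} \<Longrightarrow> \<gamma> j \<in> PiE {..<e} (\<lambda>_. {0..1::real})"
  shows "\<gamma> \<in> measurable (uniform_count_measure {1..n}) (eucl e)"
proof -
  have "\<gamma> \<in> measurable (count_space {1..n}) (eucl e)"
    using assms by (auto simp: space_eucl PiE_iff)
  then show ?thesis
    by (simp add: measurable_cong_sets[OF sets_uniform_count_measure_count_space refl])
qed

lemma integral_empirical:
  fixes f :: "(nat \<Rightarrow> real) \<Rightarrow> real"
  assumes "\<And>j. j \<in> {1..n} \<Longrightarrow> \<gamma> j \<in> PiE {..<e} (\<lambda>_. {0..1::real})" and f: "f \<in> borel_measurable (eucl e)"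
  shows "(\<integral>u. f u \<partial>empirical e n \<gamma>) = avg {1..n} (\<lambda>j. f (\<gamma> j))"
proof -
  have "\<gamma> \<in> measurable (uniform_count_measure {1..n}) (eucl e)"
    by (rule measurable_grid) (rule assms(1))
  from integral_distr[OF this f] show ?thesis
    unfolding empirical_def by (simp only: integral_uniform_count_measure[OF finite_atLeastAtMost] avg_def)
qed

lemma prob_space_unif_cube: "prob_space (unif_cube e)"
proof -
  interpret product_sigma_finite "\<lambda>_ :: nat. lborel :: real measure" ..
  have "emeasure (eucl e) (PiE {..<e} (\<lambda>_. {0..1})) = 1"
    unfolding eucl_def by (subst emeasure_PiM) simp_all
  then show ?thesis
    unfolding unif_cube_def by (intro prob_space_uniform_measure) simp_all
qed

lemma measurable_ip2: "ip e t \<in> borel_measurable (eucl e)"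
  unfolding ip_def[abs_def] by measurable

lemma continuous_on_ip: "continuous_on A (ip e t)"
  unfolding ip_def[abs_def]
  by (intro continuous_intros continuous_on_product_coordinates[THEN continuous_on_subset]) simp

text \<open>Weak convergence is stated for real test functions, so real and imaginary parts are
  treated with cosine and sine.\<close>

lemma gchar_tendsto:
  assumes grid: "\<And>n j. j \<in> {1..n} \<Longrightarrow> \<gamma> n j \<in> PiE {..<e} (\<lambda>_. {0..1::real})"
    and conv: "weak_conv_on {..<e} (\<lambda>n. empirical e n (\<gamma> n)) (unif_cube e)"
  shows "(\<lambda>n. gchar n e (\<gamma> n) t) \<longlonglongrightarrow> unif_char e t"
proof -
  interpret prob_space "unif_cube e" by (rule prob_space_unif_cube)
  have sets: "sets (unif_cube e) = sets (eucl e)" by (simp add: unif_cube_def)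
  have lim: "(\<lambda>n. avg {1..n} (\<lambda>j. f (ip e t (\<gamma> n j)))) \<longlonglongrightarrow> (\<integral>u. f (ip e t u) \<partial>unif_cube e)"
    if f: "continuous_on UNIV f" "\<And>x. \<bar>f x\<bar> \<le> 1" for f :: "real \<Rightarrow> real"
  proof -
    have "continuous_on (PiE {..<e} (\<lambda>_. UNIV)) (\<lambda>u. f (ip e t u))"
      by (rule continuous_on_compose2[OF f(1) continuous_on_ip]) simp
    moreover have "bounded ((\<lambda>u. f (ip e t u)) ` PiE {..<e} (\<lambda>_. UNIV))"
      unfolding bounded_iff using f(2) by (intro exI[of _ 1]) auto
    ultimately have "(\<lambda>n. \<integral>u. f (ip e t u) \<partial>empirical e n (\<gamma> n)) \<longlonglongrightarrow> (\<integral>u. f (ip e t u) \<partial>unif_cube e)"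
      using conv unfolding weak_conv_on_def by (elim allE[of _ "\<lambda>u. f (ip e t u)"]) blast
    moreover have "(\<lambda>u. f (ip e t u)) \<in> borel_measurable (eucl e)"
      using f(1) measurable_ip2 by (intro measurable_compose[OF measurable_ip2 borel_measurable_continuous_onI])
    then have "(\<integral>u. f (ip e t u) \<partial>empirical e n (\<gamma> n)) = avg {1..n} (\<lambda>j. f (ip e t (\<gamma> n j)))" for n
      by (intro integral_empirical) (rule grid)
    ultimately show ?thesis by simp
  qed
  have m: "(\<lambda>u. iexp (ip e t u)) \<in> borel_measurable (unif_cube e)"
    unfolding measurable_cong_sets[OF sets refl] using measurable_ip2 by measurable
  have int: "integrable (unif_cube e) (\<lambda>u. iexp (ip e t u))"
    by (rule integrable_const_bound[where B = 1]) (use m in auto)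
  have re: "Re (iexp x) = cos x" and im: "Im (iexp x) = sin x" for x
    by (simp_all add: Re_exp Im_exp)
  show ?thesis
  proof (rule tendsto_complex_iff[THEN iffD2], rule conjI)
    have "Re (unif_char e t) = (\<integral>u. cos (ip e t u) \<partial>unif_cube e)"
      unfolding unif_char_def using integral_Re[OF int] by (simp only: re)
    moreover have "Re (gchar n e (\<gamma> n) t) = avg {1..n} (\<lambda>j. cos (ip e t (\<gamma> n j)))" for n
      by (simp only: gchar_def Re_avg re)
    ultimately show "(\<lambda>n. Re (gchar n e (\<gamma> n) t)) \<longlonglongrightarrow> Re (unif_char e t)"
      using lim[of cos] by (simp add: continuous_on_cos)
    have "Im (unif_char e t) = (\<integral>u. sin (ip e t u) \<partial>unif_cube e)"
      unfolding unif_char_def using integral_Im[OF int] by (simp only: im)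
    moreover have "Im (gchar n e (\<gamma> n) t) = avg {1..n} (\<lambda>j. sin (ip e t (\<gamma> n j)))" for n
      by (simp only: gchar_def Im_avg im)
    ultimately show "(\<lambda>n. Im (gchar n e (\<gamma> n) t)) \<longlonglongrightarrow> Im (unif_char e t)"
      using lim[of sin] by (simp add: continuous_on_sin)
  qed
qed

text \<open>If the index sets differ, some coordinate occurs in only one of the two products and its
  centred factor averages to 0. This orthogonality is the origin of the independence of the limit
  processes for different sets.\<close>

lemma avg_PiE_prod_prod:
  fixes f h :: "'i \<Rightarrow> 'a \<Rightarrow> complex"
  assumes I: "finite I" "S \<subseteq> I" "S' \<subseteq> I" and A: "finite A" "A \<noteq> {}"
    and f: "\<And>i. i \<in> S \<Longrightarrow> avg A (f i) = 0" and h: "\<And>i. i \<in> S' \<Longrightarrow> avg A (h i) = 0"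
  shows "avg (PiE I (\<lambda>_. A)) (\<lambda>j. (\<Prod>i\<in>S. f i (j i)) * (\<Prod>i\<in>S'. h i (j i)))
    = (if S = S' then \<Prod>i\<in>S. avg A (\<lambda>a. f i a * h i a) else 0)"
proof -
  let ?F = "\<lambda>i a. (if i \<in> S then f i a else 1) * (if i \<in> S' then h i a else 1)"
  have fin: "finite (S \<union> S')" using I finite_subset by blast
  have ext: "(\<Prod>i\<in>S. F i) = (\<Prod>i\<in>S \<union> S'. if i \<in> S then F i else 1)"
    "(\<Prod>i\<in>S'. F i) = (\<Prod>i\<in>S \<union> S'. if i \<in> S' then F i else 1)" for F :: "'i \<Rightarrow> complex"
    using fin by (simp_all add: prod.inter_restrict[symmetric] Int_absorb1)
  have "avg (PiE I (\<lambda>_. A)) (\<lambda>j. (\<Prod>i\<in>S. f i (j i)) * (\<Prod>i\<in>S'. h i (j i)))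
    = avg (PiE I (\<lambda>_. A)) (\<lambda>j. \<Prod>i\<in>S \<union> S'. ?F i (j i))"
    by (simp only: ext prod.distrib)
  also have "\<dots> = (\<Prod>i\<in>S \<union> S'. avg A (?F i))"
    by (rule avg_PiE_prod_subset[where f = ?F]) (use I A in auto)
  also have "\<dots> = (if S = S' then \<Prod>i\<in>S. avg A (\<lambda>a. f i a * h i a) else 0)"
  proof (cases "S = S'")
    case False
    then obtain i where i: "i \<in> S \<union> S'" "\<not> (i \<in> S \<and> i \<in> S')" by blast
    then have "avg A (?F i) = 0" using f[of i] h[of i] by (cases "i \<in> S") auto
    then have "(\<Prod>i\<in>S \<union> S'. avg A (?F i)) = 0"
      by (intro prod_zero[OF fin] bexI[of _ i] i)
    with False show ?thesis by simp
  qed simp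
  finally show ?thesis .
qed

text \<open>The variance of \<open>Re L\<close> for \<open>L\<close> the sum of
  \<open>c p * Z (fst p) (snd p)\<close>, by \<open>(Re L)^2 = Re (L * cnj L + L * L) / 2\<close>;
  processes for different sets are uncorrelated. Both the covariance and the relation function
  enter.\<close>

definition cov_form :: "(nat \<Rightarrow> nat) \<Rightarrow> (nat set \<times> (nat \<Rightarrow> nat \<Rightarrow> real)) set \<Rightarrow>
    (nat set \<times> (nat \<Rightarrow> nat \<Rightarrow> real) \<Rightarrow> complex) \<Rightarrow> real" where
  "cov_form d P c = Re (\<Sum>p\<in>P. \<Sum>q\<in>P. if fst p = fst q
     then c p * cnj (c q) * C_cov d (fst p) (snd p) (snd q)
        + c p * c q * C_cov d (fst p) (snd p) (\<lambda>i k. - snd q i k) else 0) / 2"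

lemma gcov_prod_tendsto:
  fixes h :: "nat \<Rightarrow> nat \<Rightarrow> nat \<Rightarrow> nat \<Rightarrow> real"
  assumes grid: "\<And>n i j. i \<in> S \<Longrightarrow> j \<in> {1..n} \<Longrightarrow> h n (d i) j \<in> PiE {..<d i} (\<lambda>_. {0..1})"
    and conv: "\<And>i. i \<in> S \<Longrightarrow> weak_conv_on {..<d i} (\<lambda>n. empirical (d i) n (h n (d i))) (unif_cube (d i))"
  shows "(\<lambda>n. \<Prod>i\<in>S. gcov n (d i) (h n (d i)) (t i) (t' i)) \<longlonglongrightarrow> C_cov d S t t'"
  unfolding C_cov_def gcov_def
  by (intro tendsto_prod tendsto_diff tendsto_mult gchar_tendsto grid conv)

text \<open>For each \<open>n\<close> the functional is an instance of
  \<open>centered_array\<close>, whose variance is \<open>cov_form\<close> with grid covariances in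
  place of \<open>C_cov\<close>. The error bound tends to 0 and the grid covariances
  converge.\<close>

theorem emp_process_CLT:
  fixes h :: "nat \<Rightarrow> nat \<Rightarrow> nat \<Rightarrow> nat \<Rightarrow> real"
  assumes I: "finite I" and P: "finite P" and S_sub: "\<And>p. p \<in> P \<Longrightarrow> fst p \<subseteq> I"
    and S_card: "\<And>p. p \<in> P \<Longrightarrow> 2 \<le> card (fst p)"
    and grid: "\<And>n i j. i \<in> I \<Longrightarrow> j \<in> {1..n} \<Longrightarrow> h n (d i) j \<in> PiE {..<d i} (\<lambda>_. {0..1})"
    and conv: "\<And>i. i \<in> I \<Longrightarrow> weak_conv_on {..<d i} (\<lambda>n. empirical (d i) n (h n (d i))) (unif_cube (d i))"
  shows "(\<lambda>n. avg (perm_tuples I n) (\<lambda>\<pi>. iexp (Re (\<Sum>p\<in>P. c p * emp_process n d (\<lambda>i. h n (d i)) (fst p) (snd p) \<pi>))))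
    \<longlonglongrightarrow> of_real (exp (- (cov_form d P c / 2)))"
proof -
  define D0 where "D0 = (\<Sum>p\<in>P. cmod (c p * 2 ^ card (fst p)))"
  define v where "v n = Re (\<Sum>p\<in>P. \<Sum>q\<in>P. if fst p = fst q
     then c p * cnj (c q) * (\<Prod>i\<in>fst p. gcov n (d i) (h n (d i)) (snd p i) (snd q i))
        + c p * c q * (\<Prod>i\<in>fst p. gcov n (d i) (h n (d i)) (snd p i) (\<lambda>k. - snd q i k)) else 0) / 2" for n
  define ch where "ch n = avg (perm_tuples I n)
    (\<lambda>\<pi>. iexp (Re (\<Sum>p\<in>P. c p * emp_process n d (\<lambda>i. h n (d i)) (fst p) (snd p) \<pi>)))" for n
  define B where "B n = D0 ^ 3 / (6 * sqrt (real n)) + D0 * (ln (real n) + 1) / sqrt (real n)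
    + D0\<^sup>2 * real (card I) / sqrt (real n) + D0 ^ 4 / (4 * real n)" for n :: nat
  have bound: "cmod (ch n - of_real (exp (- (v n / 2)))) \<le> B n" if n: "1 \<le> n" for n
  proof -
    \<comment> \<open>A deviation has modulus at most 2; the halves satisfy the bound of the locale,
      and \<open>2 ^ card (fst p)\<close> in the coefficients restores the product.\<close>
    define \<alpha> where "\<alpha> p i j = gdev n (d i) (h n (d i)) (snd p i) j / 2" for p :: "nat set \<times> (nat \<Rightarrow> nat \<Rightarrow> real)" and i j
    interpret centered_array I P fst "\<lambda>p. c p * 2 ^ card (fst p)" \<alpha> n
    proof
      show "cmod (\<alpha> p i j) \<le> 1" for p i j
        using norm_gdev_le[OF n, of "d i" "h n (d i)" "snd p i" j] by (simp add: \<alpha>_def norm_divide)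
      show "(\<Sum>j=1..n. \<alpha> p i j) = 0" for p i
        using gdev_centered[OF n, of "d i" "h n (d i)" "snd p i"] by (simp only: \<alpha>_def sum_divide_distrib[symmetric] div_0)
    qed (use I P n S_sub S_card in auto)
    have H_eq: "H j = (\<Sum>p\<in>P. c p * (\<Prod>i\<in>fst p. gdev n (d i) (h n (d i)) (snd p i) (j i)))" for j
      unfolding H_def \<alpha>_def by (intro sum.cong refl) (simp add: prod_dividef)
    have lin: "(\<Sum>b=1..n. G (\<lambda>i. \<pi> i b)) / sqrt n
      = Re (\<Sum>p\<in>P. c p * emp_process n d (\<lambda>i. h n (d i)) (fst p) (snd p) \<pi>)" for \<pi>
    proof -
      have "(\<Sum>p\<in>P. c p * emp_process n d (\<lambda>i. h n (d i)) (fst p) (snd p) \<pi>)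
        = (\<Sum>b=1..n. H (\<lambda>i. \<pi> i b)) / of_real (sqrt n)"
        unfolding H_eq emp_process_def
        by (subst sum.swap) (simp add: sum_divide_distrib sum_distrib_left)
      then show ?thesis by (simp only: Re_divide_of_real Re_sum G_def)
    qed
    have cnt: "avg {1..n} (gdev n e \<gamma> t) = 0" "avg {1..n} (\<lambda>j. cnj (gdev n e \<gamma> t j)) = 0" for e \<gamma> t
      using gdev_centered[OF n, of e \<gamma> t] by (simp_all add: avg_def flip: cnj_sum)
    let ?N = "PiE I (\<lambda>_. {1..n})"
    let ?a = "\<lambda>p j. \<Prod>i\<in>fst p. gdev n (d i) (h n (d i)) (snd p i) (j i)"
    have pr: "avg ?N (\<lambda>j. ?a p j * cnj (?a q j))
        = (if fst p = fst q then \<Prod>i\<in>fst p. gcov n (d i) (h n (d i)) (snd p i) (snd q i) else 0)"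
      "avg ?N (\<lambda>j. ?a p j * ?a q j)
        = (if fst p = fst q then \<Prod>i\<in>fst p. gcov n (d i) (h n (d i)) (snd p i) (\<lambda>k. - snd q i k) else 0)"
      if pq: "p \<in> P" "q \<in> P" for p q
    proof -
      have ne: "finite {1..n}" "{1..n} \<noteq> {}" using n by auto
      show "avg ?N (\<lambda>j. ?a p j * cnj (?a q j))
        = (if fst p = fst q then \<Prod>i\<in>fst p. gcov n (d i) (h n (d i)) (snd p i) (snd q i) else 0)"
        using avg_PiE_prod_prod[OF I S_sub[OF pq(1)] S_sub[OF pq(2)] ne,
          of "\<lambda>i. gdev n (d i) (h n (d i)) (snd p i)" "\<lambda>i j. cnj (gdev n (d i) (h n (d i)) (snd q i) j)"] cnt
        by (simp only: gcov_eq[OF n] cnj_prod)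
      show "avg ?N (\<lambda>j. ?a p j * ?a q j)
        = (if fst p = fst q then \<Prod>i\<in>fst p. gcov n (d i) (h n (d i)) (snd p i) (\<lambda>k. - snd q i k) else 0)"
        using avg_PiE_prod_prod[OF I S_sub[OF pq(1)] S_sub[OF pq(2)] ne,
          of "\<lambda>i. gdev n (d i) (h n (d i)) (snd p i)" "\<lambda>i. gdev n (d i) (h n (d i)) (snd q i)"] cnt
        by (simp only: gcov_neg_eq[OF n])
    qed
    have sq: "(Re z)\<^sup>2 = Re (z * cnj z + z * z) / 2" for z
      by (simp add: power2_eq_square)
    have HH: "H j * cnj (H j) + H j * H j
      = (\<Sum>p\<in>P. \<Sum>q\<in>P. c p * cnj (c q) * (?a p j * cnj (?a q j)) + c p * c q * (?a p j * ?a q j))" for j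
      unfolding H_eq cnj_sum complex_cnj_mult sum_product sum.distrib by (simp only: mult_ac)
    have "var = Re (\<Sum>p\<in>P. \<Sum>q\<in>P. c p * cnj (c q) * avg ?N (\<lambda>j. ?a p j * cnj (?a q j))
        + c p * c q * avg ?N (\<lambda>j. ?a p j * ?a q j)) / 2"
      unfolding var_def G_def sq HH by (simp only: avg_divide Re_avg[symmetric] avg_add avg_sum avg_cmult)
    also have "\<dots> = v n"
      unfolding v_def
      by (intro arg_cong[where f = "\<lambda>z. Re z / 2"] sum.cong refl) (simp only: pr, simp)
    finally have var: "var = v n" .
    have "D0 = D" by (simp only: D0_def D_def)
    then show ?thesis
      unfolding B_def ch_def using combinatorial_CLT_bound unfolding lin var by (simp only:)
  qed
  have B_lim: "B \<longlonglongrightarrow> 0"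
  proof -
    have s: "(\<lambda>n. 1 / sqrt (real n)) \<longlonglongrightarrow> 0" "(\<lambda>n. ln (real n) / sqrt (real n)) \<longlonglongrightarrow> 0" "(\<lambda>n. 1 / real n) \<longlonglongrightarrow> 0"
      by real_asymp+
    have "(\<lambda>n. D0 ^ 3 / 6 * (1 / sqrt (real n)) + D0 * (ln (real n) / sqrt (real n) + 1 / sqrt (real n))
      + D0\<^sup>2 * real (card I) * (1 / sqrt (real n)) + D0 ^ 4 / 4 * (1 / real n))
      \<longlonglongrightarrow> D0 ^ 3 / 6 * 0 + D0 * (0 + 0) + D0\<^sup>2 * real (card I) * 0 + D0 ^ 4 / 4 * 0"
      by (intro tendsto_intros s)
    then show ?thesis by (simp add: B_def[abs_def] add_divide_distrib distrib_left)
  qed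
  have gcov_lim: "(\<lambda>n. \<Prod>i\<in>S. gcov n (d i) (h n (d i)) (t i) (t' i)) \<longlonglongrightarrow> C_cov d S t t'"
    if "S \<subseteq> I" for S t t'
    using that by (intro gcov_prod_tendsto grid conv) auto
  have v_lim: "v \<longlonglongrightarrow> cov_form d P c"
    unfolding v_def[abs_def] cov_form_def
  proof (intro tendsto_divide tendsto_Re tendsto_sum tendsto_const)
    fix p q assume "p \<in> P" "q \<in> P"
    then have p: "fst p \<subseteq> I" by (simp add: S_sub)
    show "(\<lambda>n. if fst p = fst q
     then c p * cnj (c q) * (\<Prod>i\<in>fst p. gcov n (d i) (h n (d i)) (snd p i) (snd q i))
        + c p * c q * (\<Prod>i\<in>fst p. gcov n (d i) (h n (d i)) (snd p i) (\<lambda>k. - snd q i k)) else 0)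
     \<longlonglongrightarrow> (if fst p = fst q
     then c p * cnj (c q) * C_cov d (fst p) (snd p) (snd q)
        + c p * c q * C_cov d (fst p) (snd p) (\<lambda>i k. - snd q i k) else 0)"
      using gcov_lim[OF p, of "snd p" "snd q"] gcov_lim[OF p, of "snd p" "\<lambda>i k. - snd q i k"]
      by (cases "fst p = fst q") (auto intro!: tendsto_intros)
  qed simp
  have "(\<lambda>n. ch n - of_real (exp (- (v n / 2)))) \<longlonglongrightarrow> 0"
    by (rule Lim_null_comparison[OF _ B_lim]) (use bound in \<open>intro eventually_sequentiallyI[of 1]\<close>)
  moreover have "(\<lambda>n. complex_of_real (exp (- (v n / 2)))) \<longlonglongrightarrow> of_real (exp (- (cov_form d P c / 2)))"
    by (intro tendsto_intros v_lim) simp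
  ultimately have "(\<lambda>n. ch n - of_real (exp (- (v n / 2))) + of_real (exp (- (v n / 2))))
    \<longlonglongrightarrow> 0 + of_real (exp (- (cov_form d P c / 2)))"
    by (rule tendsto_add)
  then show ?thesis by (simp add: ch_def)
qed

section \<open>The limit process\<close>

text \<open>The law is a point mass or a normal law. In the first case mean 0 forces the value 0; in
  the second, rescaling by \<open>s\<close> leads to the standard normal characteristic function at
  \<open>s\<close>.\<close>

lemma gaussian_rv_moments:
  assumes N: "prob_space N" and V: "gaussian_rv N V"
  shows "integrable N V" and "integrable N (\<lambda>\<omega>. (V \<omega>)\<^sup>2)"
    and "(\<integral>\<omega>. V \<omega> \<partial>N) = 0 \<Longrightarrow> (\<integral>\<omega>. iexp (V \<omega>) \<partial>N) = of_real (exp (- ((\<integral>\<omega>. (V \<omega>)\<^sup>2 \<partial>N) / 2)))"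
proof -
  interpret prob_space N by fact
  have Vm [measurable]: "V \<in> borel_measurable N" using V by (simp add: gaussian_rv_def)
  have int_iff: "integrable N (\<lambda>\<omega>. f (V \<omega>)) \<longleftrightarrow> integrable (distr N borel V) f"
    if "f \<in> borel_measurable borel" for f :: "real \<Rightarrow> real"
    using that by (simp add: integrable_distr_eq)
  have int_eq: "(\<integral>\<omega>. f (V \<omega>) \<partial>N) = (\<integral>x. f x \<partial>distr N borel V)"
    if "f \<in> borel_measurable borel" for f :: "real \<Rightarrow> real"
    using that by (simp add: integral_distr)
  obtain m where "distr N borel V = return borel m \<or>
      (\<exists>s>0. distr N borel V = density lborel (\<lambda>x. ennreal (normal_density m s x)))"
    using V unfolding gaussian_rv_def by blast
  then have *: "integrable N V \<and> integrable N (\<lambda>\<omega>. (V \<omega>)\<^sup>2) \<and> ((\<integral>\<omega>. V \<omega> \<partial>N) = 0 \<longrightarrow>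
    (\<integral>\<omega>. iexp (V \<omega>) \<partial>N) = of_real (exp (- ((\<integral>\<omega>. (V \<omega>)\<^sup>2 \<partial>N) / 2))))"
  proof
    assume d: "distr N borel V = return borel m"
    have "AE x in distr N borel V. x = m" unfolding d by (simp add: AE_return)
    then have ae: "AE \<omega> in N. V \<omega> = m" by (subst (asm) AE_distr_iff) simp_all
    have i1: "integrable N V"
      by (rule integrable_const_bound[where B = "\<bar>m\<bar>"]) (use ae in \<open>eventually_elim, simp\<close>, simp)
    have i2: "integrable N (\<lambda>\<omega>. (V \<omega>)\<^sup>2)"
      by (rule integrable_const_bound[where B = "m\<^sup>2"]) (use ae in \<open>eventually_elim, simp\<close>, simp)
    have "(\<integral>\<omega>. V \<omega> \<partial>N) = (\<integral>\<omega>. m \<partial>N)" by (rule integral_cong_AE) (use ae in simp_all)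
    moreover have "(\<integral>\<omega>. (V \<omega>)\<^sup>2 \<partial>N) = (\<integral>\<omega>. m\<^sup>2 \<partial>N)"
      by (rule integral_cong_AE) (simp_all, use ae in \<open>eventually_elim, simp\<close>)
    moreover have "(\<integral>\<omega>. iexp (V \<omega>) \<partial>N) = (\<integral>\<omega>. iexp m \<partial>N)"
      by (rule integral_cong_AE) (simp_all, use ae in \<open>eventually_elim, simp\<close>)
    ultimately show ?thesis using i1 i2 by (simp add: prob_space)
  next
    assume "\<exists>s>0. distr N borel V = density lborel (\<lambda>x. ennreal (normal_density m s x))"
    then obtain s where s: "0 < s" and d: "distr N borel V = density lborel (\<lambda>x. ennreal (normal_density m s x))"
      by blast
    have id: "integrable (distr N borel V) f \<longleftrightarrow> integrable lborel (\<lambda>x. normal_density m s x * f x)"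
      if "f \<in> borel_measurable borel" for f :: "real \<Rightarrow> real"
      unfolding d using that by (subst integrable_density) simp_all
    have ed: "(\<integral>x. f x \<partial>distr N borel V) = (\<integral>x. normal_density m s x * f x \<partial>lborel)"
      if "f \<in> borel_measurable borel" for f :: "real \<Rightarrow> real"
      unfolding d using that by (subst integral_density) simp_all
    have i1: "integrable N V"
      using int_iff[of "\<lambda>x. x"] id[of "\<lambda>x. x"] integrable_normal_moment_nz_1[OF s] by simp
    have EV: "(\<integral>\<omega>. V \<omega> \<partial>N) = m"
      using int_eq[of "\<lambda>x. x"] ed[of "\<lambda>x. x"] integral_normal_moment_nz_1[OF s] by simp
    have "integrable lborel (\<lambda>x. normal_density m s x * (x - m)\<^sup>2 + 2 * m * (normal_density m s x * x)
        - m\<^sup>2 * normal_density m s x)"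
      using integrable_normal_moment[OF s, of m 2] integrable_normal_moment_nz_1[OF s, of m] s by simp
    also have "(\<lambda>x. normal_density m s x * (x - m)\<^sup>2 + 2 * m * (normal_density m s x * x)
        - m\<^sup>2 * normal_density m s x) = (\<lambda>x. normal_density m s x * x\<^sup>2)"
      by (simp add: fun_eq_iff power2_eq_square algebra_simps)
    finally have i2: "integrable N (\<lambda>\<omega>. (V \<omega>)\<^sup>2)"
      using int_iff[of "\<lambda>x. x\<^sup>2"] id[of "\<lambda>x. x\<^sup>2"] by simp
    have ch: "(\<integral>\<omega>. iexp (V \<omega>) \<partial>N) = of_real (exp (- ((\<integral>\<omega>. (V \<omega>)\<^sup>2 \<partial>N) / 2)))" if "(\<integral>\<omega>. V \<omega> \<partial>N) = 0"
    proof -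
      have m0: "m = 0" using that EV by simp
      have EV2: "(\<integral>\<omega>. (V \<omega>)\<^sup>2 \<partial>N) = s\<^sup>2"
        using int_eq[of "\<lambda>x. x\<^sup>2"] ed[of "\<lambda>x. x\<^sup>2"] integral_normal_moment_even[OF s, of 0 1] s
        by (simp add: m0)
      have "distributed N lborel V (normal_density 0 s)"
        unfolding distributed_def using d m0 by (simp cong: distr_cong)
      then have std: "distributed N lborel (\<lambda>\<omega>. (V \<omega> - 0) / s) std_normal_density"
        by (simp only: normal_standard_normal_convert[OF s])
      have "distr N borel (\<lambda>\<omega>. V \<omega> / s) = std_normal_distribution"
        using std unfolding distributed_def by (simp cong: distr_cong)
      then have "char (distr N borel (\<lambda>\<omega>. V \<omega> / s)) s = of_real (exp (- (s\<^sup>2) / 2))"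
        by (simp add: char_std_normal_distribution)
      moreover have "char (distr N borel (\<lambda>\<omega>. V \<omega> / s)) s = (\<integral>\<omega>. iexp (s * (V \<omega> / s)) \<partial>N)"
        unfolding char_def by (subst integral_distr) auto
      ultimately show ?thesis using s by (simp add: EV2)
    qed
    show ?thesis using i1 i2 ch by blast
  qed
  show "integrable N V" "integrable N (\<lambda>\<omega>. (V \<omega>)\<^sup>2)"
    "(\<integral>\<omega>. V \<omega> \<partial>N) = 0 \<Longrightarrow> (\<integral>\<omega>. iexp (V \<omega>) \<partial>N) = of_real (exp (- ((\<integral>\<omega>. (V \<omega>)\<^sup>2 \<partial>N) / 2)))"
    using * by blast+
qed

section \<open>Laplace transforms by Gaussian averaging\<close>

lemma integral_iexp_std_normal_product:
  assumes "finite J"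
  shows "(\<integral>x. iexp (\<Sum>j\<in>J. y j * x j) \<partial>PiM J (\<lambda>_. std_normal_distribution)) = of_real (exp (- ((\<Sum>j\<in>J. (y j)\<^sup>2) / 2)))"
proof -
  interpret S: real_distribution std_normal_distribution by (rule real_dist_normal_dist)
  interpret product_sigma_finite "\<lambda>_. std_normal_distribution"
    by (simp add: product_sigma_finite_def S.sigma_finite_measure_axioms)
  have int: "integrable std_normal_distribution (\<lambda>x. iexp (a * x))" for a
    by (rule S.integrable_const_bound[where B = 1]) auto
  have "(\<integral>x. iexp (\<Sum>j\<in>J. y j * x j) \<partial>PiM J (\<lambda>_. std_normal_distribution))
    = (\<integral>x. (\<Prod>j\<in>J. iexp (y j * x j)) \<partial>PiM J (\<lambda>_. std_normal_distribution))"
    using assms by (simp add: exp_sum[symmetric] sum_distrib_left)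
  also have "\<dots> = (\<Prod>j\<in>J. \<integral>x. iexp (y j * x) \<partial>std_normal_distribution)"
    by (rule product_integral_prod[OF assms int])
  also have "\<dots> = (\<Prod>j\<in>J. of_real (exp (- ((y j)\<^sup>2 / 2))))"
    using char_std_normal_distribution by (simp add: char_def fun_eq_iff)
  also have "\<dots> = of_real (exp (- ((\<Sum>j\<in>J. (y j)\<^sup>2) / 2)))"
    using assms by (simp add: exp_sum[symmetric] sum_negf sum_divide_distrib flip: of_real_prod exp_of_real)
  finally show ?thesis .
qed

text \<open>A Gaussian average of the linear functionals \<open>Re (\<Sum>p\<in>P. gauss_coeff v x p * z p)\<close> turns
  their characteristic functions into the Laplace transform of a positive quadratic form.\<close>

definition gauss_coeff :: "('p \<Rightarrow> real) \<Rightarrow> ('p \<times> bool \<Rightarrow> real) \<Rightarrow> 'p \<Rightarrow> complex" where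
  "gauss_coeff v x p = of_real (sqrt (v p)) * Complex (x (p, True)) (- x (p, False))"

text \<open>For real \<open>a\<close> and \<open>b\<close>, \<open>Re ((a - i b) z)\<close> equals
  \<open>a * Re z + b * Im z\<close>, which explains the sign in \<open>gauss_coeff\<close>. With
  independent standard normal \<open>a\<close>, \<open>b\<close> this is normal with variance
  \<open>|z|^2\<close>, and \<open>sqrt (v p)\<close> scales it to
  \<open>v p * |z p|^2\<close>.\<close>

lemma gaussian_linearization:
  fixes z :: "'p \<Rightarrow> complex"
  assumes P: "finite P" and v: "\<And>p. p \<in> P \<Longrightarrow> 0 \<le> v p"
  shows "(\<integral>x. iexp (Re (\<Sum>p\<in>P. gauss_coeff v x p * z p)) \<partial>PiM (P \<times> UNIV) (\<lambda>_. std_normal_distribution))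
    = of_real (exp (- ((\<Sum>p\<in>P. v p * (cmod (z p))\<^sup>2) / 2)))"
proof -
  define y where "y pb = sqrt (v (fst pb)) * (if snd pb then Re (z (fst pb)) else Im (z (fst pb)))" for pb
  have spl: "(\<Sum>pb\<in>P \<times> UNIV. F pb) = (\<Sum>p\<in>P. F (p, True) + F (p, False))" for F :: "'p \<times> bool \<Rightarrow> real"
    using sum.cartesian_product[of "\<lambda>p b. F (p, b)" UNIV P] by (simp add: UNIV_bool add.commute)
  have lin: "Re (\<Sum>p\<in>P. gauss_coeff v x p * z p) = (\<Sum>pb\<in>P \<times> UNIV. y pb * x pb)" for x
    unfolding spl by (simp add: gauss_coeff_def y_def algebra_simps)
  have "(\<Sum>pb\<in>P \<times> UNIV. (y pb)\<^sup>2) = (\<Sum>p\<in>P. v p * (cmod (z p))\<^sup>2)"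
    unfolding spl y_def using v by (intro sum.cong refl) (simp add: power_mult_distrib cmod_power2 distrib_left)
  then show ?thesis
    unfolding lin using P by (subst integral_iexp_std_normal_product) auto
qed

text \<open>Fubini exchanges the auxiliary Gaussian average with the expectation, leaving
  characteristic functions at random coefficients.\<close>

lemma integral_exp_quadratic:
  fixes z :: "'p \<Rightarrow> 'o \<Rightarrow> complex"
  assumes \<Omega>: "prob_space \<Omega>" and P: "finite P" and v: "\<And>p. p \<in> P \<Longrightarrow> 0 \<le> v p"
    and z: "\<And>p. p \<in> P \<Longrightarrow> z p \<in> borel_measurable \<Omega>"
  shows "of_real (\<integral>\<omega>. exp (- ((\<Sum>p\<in>P. v p * (cmod (z p \<omega>))\<^sup>2) / 2)) \<partial>\<Omega>)
    = (\<integral>x. (\<integral>\<omega>. iexp (Re (\<Sum>p\<in>P. gauss_coeff v x p * z p \<omega>)) \<partial>\<Omega>) \<partial>PiM (P \<times> UNIV) (\<lambda>_. std_normal_distribution))"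
    and "(\<lambda>x. \<integral>\<omega>. iexp (Re (\<Sum>p\<in>P. gauss_coeff v x p * z p \<omega>)) \<partial>\<Omega>)
      \<in> borel_measurable (PiM (P \<times> UNIV) (\<lambda>_. std_normal_distribution))"
proof -
  let ?\<Gamma> = "PiM (P \<times> UNIV) (\<lambda>_ :: 'p \<times> bool. std_normal_distribution)"
  interpret S: real_distribution std_normal_distribution by (rule real_dist_normal_dist)
  interpret O: prob_space \<Omega> by fact
  interpret G: prob_space ?\<Gamma> by (rule prob_space_PiM) (rule S.prob_space_axioms)
  interpret GO: pair_prob_space ?\<Gamma> \<Omega> ..
  have meas: "(\<lambda>(x, \<omega>). iexp (Re (\<Sum>p\<in>P. gauss_coeff v x p * z p \<omega>))) \<in> borel_measurable (?\<Gamma> \<Otimes>\<^sub>M \<Omega>)"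
  proof -
    have [measurable]: "(\<lambda>x. x (p, b)) \<in> borel_measurable ?\<Gamma>" if "p \<in> P" for p b
      using measurable_component_singleton[of "(p, b)" "P \<times> UNIV" "\<lambda>_. std_normal_distribution"] that by simp
    note z[measurable]
    have "(\<lambda>y. Re (gauss_coeff v (fst y) p * z p (snd y))) \<in> borel_measurable (?\<Gamma> \<Otimes>\<^sub>M \<Omega>)" if [simp]: "p \<in> P" for p
      unfolding gauss_coeff_def by (simp add: algebra_simps) measurable
    then have "(\<lambda>y. \<Sum>p\<in>P. Re (gauss_coeff v (fst y) p * z p (snd y))) \<in> borel_measurable (?\<Gamma> \<Otimes>\<^sub>M \<Omega>)"
      by (rule borel_measurable_sum)
    then have "(\<lambda>y. iexp (\<Sum>p\<in>P. Re (gauss_coeff v (fst y) p * z p (snd y)))) \<in> borel_measurable (?\<Gamma> \<Otimes>\<^sub>M \<Omega>)"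
      by measurable
    then show ?thesis by (simp only: split_def Re_sum)
  qed
  have int: "integrable (?\<Gamma> \<Otimes>\<^sub>M \<Omega>) (\<lambda>(x, \<omega>). iexp (Re (\<Sum>p\<in>P. gauss_coeff v x p * z p \<omega>)))"
    by (rule GO.P.integrable_const_bound[where B = 1]) (use meas in auto)
  show "(\<lambda>x. \<integral>\<omega>. iexp (Re (\<Sum>p\<in>P. gauss_coeff v x p * z p \<omega>)) \<partial>\<Omega>) \<in> borel_measurable ?\<Gamma>"
    by (rule O.borel_measurable_lebesgue_integral[OF meas])
  have "of_real (\<integral>\<omega>. exp (- ((\<Sum>p\<in>P. v p * (cmod (z p \<omega>))\<^sup>2) / 2)) \<partial>\<Omega>)
    = (\<integral>\<omega>. (\<integral>x. iexp (Re (\<Sum>p\<in>P. gauss_coeff v x p * z p \<omega>)) \<partial>?\<Gamma>) \<partial>\<Omega>)"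
    by (simp only: gaussian_linearization[OF P v] integral_complex_of_real)
  also have "\<dots> = (\<integral>x. (\<integral>\<omega>. iexp (Re (\<Sum>p\<in>P. gauss_coeff v x p * z p \<omega>)) \<partial>\<Omega>) \<partial>?\<Gamma>)"
    by (rule GO.Fubini_integral[OF int])
  finally show "of_real (\<integral>\<omega>. exp (- ((\<Sum>p\<in>P. v p * (cmod (z p \<omega>))\<^sup>2) / 2)) \<partial>\<Omega>)
    = (\<integral>x. (\<integral>\<omega>. iexp (Re (\<Sum>p\<in>P. gauss_coeff v x p * z p \<omega>)) \<partial>\<Omega>) \<partial>?\<Gamma>)" .
qed

text \<open>Characteristic functions are bounded by 1, so dominated convergence over the Gaussian
  coefficients needs no uniformity in \<open>c\<close>.\<close>

lemma char_conv_imp_laplace_conv: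
  fixes z :: "nat \<Rightarrow> 'p \<Rightarrow> 'o \<Rightarrow> complex" and y :: "'p \<Rightarrow> 'v \<Rightarrow> complex"
  assumes \<Omega>: "\<And>n. prob_space (\<Omega> n)" and N: "prob_space N" and P: "finite P" and v: "\<And>p. p \<in> P \<Longrightarrow> 0 \<le> v p"
    and z: "\<And>n p. p \<in> P \<Longrightarrow> z n p \<in> borel_measurable (\<Omega> n)" and y: "\<And>p. p \<in> P \<Longrightarrow> y p \<in> borel_measurable N"
    and conv: "\<And>c. (\<lambda>n. \<integral>\<omega>. iexp (Re (\<Sum>p\<in>P. c p * z n p \<omega>)) \<partial>\<Omega> n) \<longlonglongrightarrow> (\<integral>\<omega>. iexp (Re (\<Sum>p\<in>P. c p * y p \<omega>)) \<partial>N)"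
  shows "(\<lambda>n. \<integral>\<omega>. exp (- ((\<Sum>p\<in>P. v p * (cmod (z n p \<omega>))\<^sup>2) / 2)) \<partial>\<Omega> n)
    \<longlonglongrightarrow> (\<integral>\<omega>. exp (- ((\<Sum>p\<in>P. v p * (cmod (y p \<omega>))\<^sup>2) / 2)) \<partial>N)"
proof -
  let ?\<Gamma> = "PiM (P \<times> UNIV) (\<lambda>_ :: 'p \<times> bool. std_normal_distribution)"
  interpret S: real_distribution std_normal_distribution by (rule real_dist_normal_dist)
  interpret G: prob_space ?\<Gamma> by (rule prob_space_PiM) (rule S.prob_space_axioms)
  have eqs: "complex_of_real (\<integral>\<omega>. exp (- ((\<Sum>p\<in>P. v p * (cmod (z n p \<omega>))\<^sup>2) / 2)) \<partial>\<Omega> n)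
      = (\<integral>x. (\<integral>\<omega>. iexp (Re (\<Sum>p\<in>P. gauss_coeff v x p * z n p \<omega>)) \<partial>\<Omega> n) \<partial>?\<Gamma>)"
    "complex_of_real (\<integral>\<omega>. exp (- ((\<Sum>p\<in>P. v p * (cmod (y p \<omega>))\<^sup>2) / 2)) \<partial>N)
      = (\<integral>x. (\<integral>\<omega>. iexp (Re (\<Sum>p\<in>P. gauss_coeff v x p * y p \<omega>)) \<partial>N) \<partial>?\<Gamma>)" for n
    by (rule integral_exp_quadratic(1)[OF \<Omega> P], fact v, fact z)
       (rule integral_exp_quadratic(1)[OF N P], fact v, fact y)
  have meas: "(\<lambda>x. \<integral>\<omega>. iexp (Re (\<Sum>p\<in>P. gauss_coeff v x p * z n p \<omega>)) \<partial>\<Omega> n) \<in> borel_measurable ?\<Gamma>"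
    "(\<lambda>x. \<integral>\<omega>. iexp (Re (\<Sum>p\<in>P. gauss_coeff v x p * y p \<omega>)) \<partial>N) \<in> borel_measurable ?\<Gamma>" for n
    by (rule integral_exp_quadratic(2)[OF \<Omega> P], fact v, fact z)
       (rule integral_exp_quadratic(2)[OF N P], fact v, fact y)
  have "(\<lambda>n. complex_of_real (\<integral>\<omega>. exp (- ((\<Sum>p\<in>P. v p * (cmod (z n p \<omega>))\<^sup>2) / 2)) \<partial>\<Omega> n))
    \<longlonglongrightarrow> of_real (\<integral>\<omega>. exp (- ((\<Sum>p\<in>P. v p * (cmod (y p \<omega>))\<^sup>2) / 2)) \<partial>N)"
    unfolding eqs
  proof (rule integral_dominated_convergence[where w = "\<lambda>_. 1"])
    show "AE x in ?\<Gamma>. norm (\<integral>\<omega>. iexp (Re (\<Sum>p\<in>P. gauss_coeff v x p * z n p \<omega>)) \<partial>\<Omega> n) \<le> 1" for n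
    proof (rule AE_I2)
      interpret prob_space "\<Omega> n" by (rule \<Omega>)
      fix x
      have "norm (\<integral>\<omega>. iexp (Re (\<Sum>p\<in>P. gauss_coeff v x p * z n p \<omega>)) \<partial>\<Omega> n)
        \<le> (\<integral>\<omega>. norm (iexp (Re (\<Sum>p\<in>P. gauss_coeff v x p * z n p \<omega>))) \<partial>\<Omega> n)"
        by (rule integral_norm_bound)
      then show "norm (\<integral>\<omega>. iexp (Re (\<Sum>p\<in>P. gauss_coeff v x p * z n p \<omega>)) \<partial>\<Omega> n) \<le> 1"
        by (simp add: prob_space)
    qed
  qed (use meas conv in auto)
  then show ?thesis by (simp only: tendsto_of_real_iff)
qed

section \<open>Moments and characteristic functions of the limit process\<close>

locale gaussian_limit = prob_space N for N :: "'v measure" +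
  fixes d :: "nat \<Rightarrow> nat" and S :: "nat set" and Z :: "(nat \<Rightarrow> nat \<Rightarrow> real) \<Rightarrow> 'v \<Rightarrow> complex"
  assumes lim: "limit_process N d S Z"
begin

abbreviation "E \<equiv> space (eucl_prod d S)"

lemma meas_Z: "t \<in> E \<Longrightarrow> Z t \<in> borel_measurable N"
  using lim by (simp add: limit_process_def complex_gaussian_process_def)

lemma gauss: "finite F \<Longrightarrow> F \<subseteq> E \<Longrightarrow> gaussian_rv N (\<lambda>\<omega>. Re (\<Sum>t\<in>F. c t * Z t \<omega>))"
  using lim by (simp add: limit_process_def complex_gaussian_process_def)

lemma lim_process_meas: "(\<lambda>(t, \<omega>). Z t \<omega>) \<in> borel_measurable (eucl_prod d S \<Otimes>\<^sub>M N)"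
  using lim by (simp add: limit_process_def)

lemma mean_0: "t \<in> E \<Longrightarrow> (\<integral>\<omega>. Z t \<omega> \<partial>N) = 0"
  using lim by (simp add: limit_process_def)

lemma cov: "t \<in> E \<Longrightarrow> t' \<in> E \<Longrightarrow> (\<integral>\<omega>. Z t \<omega> * cnj (Z t' \<omega>) \<partial>N) = C_cov d S t t'"
  and rel: "t \<in> E \<Longrightarrow> t' \<in> E \<Longrightarrow> (\<integral>\<omega>. Z t \<omega> * Z t' \<omega> \<partial>N) = C_cov d S t (\<lambda>i k. - t' i k)"
  using lim by (simp_all add: limit_process_def)

text \<open>Integrability must come from Gaussianity: a covariance equation between Bochner
  integrals does not imply it, as these are 0 for non-integrable functions.\<close>

lemma int_Z2: "t \<in> E \<Longrightarrow> integrable N (\<lambda>\<omega>. (cmod (Z t \<omega>))\<^sup>2)"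
proof -
  assume t: "t \<in> E"
  \<comment> \<open>The coefficient \<open>- i\<close> turns the real part into the imaginary
    part.\<close>
  have "gaussian_rv N (\<lambda>\<omega>. Re (Z t \<omega>))" "gaussian_rv N (\<lambda>\<omega>. Im (Z t \<omega>))"
    using gauss[of "{t}" "\<lambda>_. 1"] gauss[of "{t}" "\<lambda>_. - \<i>"] t by simp_all
  then have "integrable N (\<lambda>\<omega>. (Re (Z t \<omega>))\<^sup>2)" "integrable N (\<lambda>\<omega>. (Im (Z t \<omega>))\<^sup>2)"
    by (auto intro: gaussian_rv_moments(2)[OF prob_space_axioms])
  then show ?thesis by (simp add: cmod_power2)
qed

lemma int_Z: "t \<in> E \<Longrightarrow> integrable N (Z t)"
proof (rule Bochner_Integration.integrable_bound)
  assume t: "t \<in> E"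
  show "integrable N (\<lambda>\<omega>. 1 + (cmod (Z t \<omega>))\<^sup>2)" using int_Z2[OF t] by simp
  have "x \<le> 1 + x\<^sup>2" if "0 \<le> x" for x :: real
    using zero_le_power2[of "x - 1"] that by (simp add: power2_eq_square algebra_simps)
  then show "AE \<omega> in N. norm (Z t \<omega>) \<le> norm (1 + (cmod (Z t \<omega>))\<^sup>2)"
    by (intro AE_I2) (simp add: abs_of_nonneg add_nonneg_nonneg)
qed (rule meas_Z)

lemma int_ZZ:
  assumes t: "t \<in> E" "t' \<in> E"
  shows "integrable N (\<lambda>\<omega>. Z t \<omega> * cnj (Z t' \<omega>))" "integrable N (\<lambda>\<omega>. Z t \<omega> * Z t' \<omega>)"
proof -
  note [measurable] = meas_Z[OF t(1)] meas_Z[OF t(2)]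
  have [measurable]: "(\<lambda>\<omega>. cnj (Z t' \<omega>)) \<in> borel_measurable N"
    by (rule measurable_compose[OF meas_Z[OF t(2)] borel_measurable_continuous_onI])
       (intro continuous_intros)
  have i: "integrable N (\<lambda>\<omega>. (cmod (Z t \<omega>))\<^sup>2 + (cmod (Z t' \<omega>))\<^sup>2)"
    using int_Z2 t by simp
  have b: "cmod x * cmod y \<le> (cmod x)\<^sup>2 + (cmod y)\<^sup>2" for x y
  proof -
    have "2 * (cmod x * cmod y) \<le> (cmod x)\<^sup>2 + (cmod y)\<^sup>2"
      using zero_le_power2[of "cmod x - cmod y"] by (simp add: power2_eq_square algebra_simps)
    moreover have "0 \<le> cmod x * cmod y" by simp
    ultimately show ?thesis by linarith
  qed
  show "integrable N (\<lambda>\<omega>. Z t \<omega> * cnj (Z t' \<omega>))"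
    by (rule Bochner_Integration.integrable_bound[OF i]) (simp_all add: norm_mult b)
  show "integrable N (\<lambda>\<omega>. Z t \<omega> * Z t' \<omega>)"
    by (rule Bochner_Integration.integrable_bound[OF i]) (simp_all add: norm_mult b)
qed

text \<open>The functional is centred Gaussian, so only its variance matters. Of the two divisions
  by 2, one stems from writing the squared real part through \<open>L * cnj L + L * L\<close>, the
  other from the Gaussian exponent.\<close>

lemma char_linear_functional:
  assumes F: "finite F" "F \<subseteq> E"
  shows "(\<integral>\<omega>. iexp (Re (\<Sum>t\<in>F. c t * Z t \<omega>)) \<partial>N) = of_real (exp (- (Re (\<Sum>t\<in>F. \<Sum>t'\<in>F.
    c t * cnj (c t') * C_cov d S t t' + c t * c t' * C_cov d S t (\<lambda>i k. - t' i k)) / 2 / 2)))"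
proof -
  define L where "L \<omega> = (\<Sum>t\<in>F. c t * Z t \<omega>)" for \<omega>
  have g: "gaussian_rv N (\<lambda>\<omega>. Re (L \<omega>))" unfolding L_def by (rule gauss[OF F])
  have tE: "t \<in> E" if "t \<in> F" for t using that F by blast
  have iL: "integrable N L" unfolding L_def
    using int_Z tE by (intro Bochner_Integration.integrable_sum integrable_mult_right) auto
  have "(\<integral>\<omega>. L \<omega> \<partial>N) = 0" unfolding L_def
    using int_Z tE mean_0 by (subst Bochner_Integration.integral_sum) auto
  then have mean: "(\<integral>\<omega>. Re (L \<omega>) \<partial>N) = 0" using integral_Re[OF iL] by simp
  have sq: "(Re z)\<^sup>2 = Re (z * cnj z + z * z) / 2" for z
    by (simp add: power2_eq_square)
  have LL: "L \<omega> * cnj (L \<omega>) + L \<omega> * L \<omega> = (\<Sum>t\<in>F. \<Sum>t'\<in>F. c t * cnj (c t') * (Z t \<omega> * cnj (Z t' \<omega>))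
      + c t * c t' * (Z t \<omega> * Z t' \<omega>))" for \<omega>
    unfolding L_def cnj_sum complex_cnj_mult sum_product sum.distrib by (simp only: mult_ac)
  have int: "integrable N (\<lambda>\<omega>. c t * cnj (c t') * (Z t \<omega> * cnj (Z t' \<omega>)) + c t * c t' * (Z t \<omega> * Z t' \<omega>))"
    if "t \<in> F" "t' \<in> F" for t t'
    using int_ZZ[OF tE[OF that(1)] tE[OF that(2)]] by simp
  have intLL: "integrable N (\<lambda>\<omega>. L \<omega> * cnj (L \<omega>) + L \<omega> * L \<omega>)"
    unfolding LL by (intro Bochner_Integration.integrable_sum int)
  have "(\<integral>\<omega>. L \<omega> * cnj (L \<omega>) + L \<omega> * L \<omega> \<partial>N) = (\<Sum>t\<in>F. \<Sum>t'\<in>F.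
    c t * cnj (c t') * C_cov d S t t' + c t * c t' * C_cov d S t (\<lambda>i k. - t' i k))"
  proof -
    have "(\<integral>\<omega>. c t * cnj (c t') * (Z t \<omega> * cnj (Z t' \<omega>)) + c t * c t' * (Z t \<omega> * Z t' \<omega>) \<partial>N)
      = c t * cnj (c t') * C_cov d S t t' + c t * c t' * C_cov d S t (\<lambda>i k. - t' i k)" if "t \<in> F" "t' \<in> F" for t t'
      using int_ZZ[OF tE[OF that(1)] tE[OF that(2)]] tE that
      by (subst Bochner_Integration.integral_add) (simp_all add: cov rel)
    then show ?thesis
      unfolding LL using int by (simp add: Bochner_Integration.integral_sum Bochner_Integration.integrable_sum
          del: Bochner_Integration.integral_add integral_mult_right_zero)
  qed
  then have "(\<integral>\<omega>. (Re (L \<omega>))\<^sup>2 \<partial>N) = Re (\<Sum>t\<in>F. \<Sum>t'\<in>F.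
    c t * cnj (c t') * C_cov d S t t' + c t * c t' * C_cov d S t (\<lambda>i k. - t' i k)) / 2"
    unfolding sq using integral_Re[OF intLL] by simp
  then show ?thesis
    using gaussian_rv_moments(3)[OF prob_space_axioms g mean] by (simp add: L_def)
qed

lemma second_moment: "t \<in> E \<Longrightarrow> (\<integral>\<omega>. (cmod (Z t \<omega>))\<^sup>2 \<partial>N) = Re (C_cov d S t t)"
proof -
  assume t: "t \<in> E"
  have "of_real (\<integral>\<omega>. (cmod (Z t \<omega>))\<^sup>2 \<partial>N) = (\<integral>\<omega>. Z t \<omega> * cnj (Z t \<omega>) \<partial>N)"
    by (simp only: integral_complex_of_real[symmetric] complex_norm_square)
  then show ?thesis using cov[OF t t] by (metis Re_complex_of_real)
qed

lemma increment:
  assumes t: "t \<in> E" "t' \<in> E"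
  shows "(\<integral>\<omega>. (cmod (Z t \<omega> - Z t' \<omega>))\<^sup>2 \<partial>N) = Re (C_cov d S t t - 2 * C_cov d S t t' + C_cov d S t' t')"
proof -
  have sq: "(cmod (x - y))\<^sup>2 = Re (x * cnj x - 2 * (x * cnj y) + y * cnj y)" for x y
    by (simp add: cmod_power2, simp add: power2_eq_square algebra_simps)
  have i: "integrable N (\<lambda>\<omega>. Z t \<omega> * cnj (Z t \<omega>) - 2 * (Z t \<omega> * cnj (Z t' \<omega>)) + Z t' \<omega> * cnj (Z t' \<omega>))"
    using int_ZZ t by (intro Bochner_Integration.integrable_add Bochner_Integration.integrable_diff integrable_mult_right) auto
  have "(\<integral>\<omega>. Z t \<omega> * cnj (Z t \<omega>) - 2 * (Z t \<omega> * cnj (Z t' \<omega>)) + Z t' \<omega> * cnj (Z t' \<omega>) \<partial>N)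
    = C_cov d S t t - 2 * C_cov d S t t' + C_cov d S t' t'"
    using int_ZZ(1)[OF t(1) t(1)] int_ZZ(1)[OF t] int_ZZ(1)[OF t(2) t(2)] t cov
    by (simp add: Bochner_Integration.integral_add Bochner_Integration.integral_diff)
  then show ?thesis unfolding sq using integral_Re[OF i] by simp
qed

end

section \<open>Convergence of the integrals\<close>

text \<open>Grouping \<open>P\<close> by its first components, independence splits the
  characteristic function into one factor for each set. The exponents add up to
  \<open>cov_form\<close>, which has no cross terms, so this is exactly the limit found in
  \<open>emp_process_CLT\<close>.\<close>

lemma char_limit_functional:
  assumes N: "prob_space N" and T: "finite T"
    and Z_proc: "\<And>S. S \<in> T \<Longrightarrow> limit_process N d S (Z S)"
    and Z_indep: "prob_space.indep_vars N (\<lambda>S. PiM (space (eucl_prod d S)) (\<lambda>_. borel))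
        (\<lambda>S \<omega>. \<lambda>t\<in>space (eucl_prod d S). Z S t \<omega>) T"
    and P: "finite P" "P \<subseteq> Sigma T (\<lambda>S. space (eucl_prod d S))"
  shows "(\<integral>\<omega>. iexp (Re (\<Sum>p\<in>P. c p * Z (fst p) (snd p) \<omega>)) \<partial>N) = of_real (exp (- (cov_form d P c / 2)))"
proof -
  interpret prob_space N by fact
  define F where "F S = {t. (S, t) \<in> P}" for S
  have P_eq: "P = Sigma T F" using P(2) by (auto simp: F_def)
  have "F S \<subseteq> snd ` P" for S by (force simp: F_def)
  then have finF: "finite (F S)" for S using P(1) finite_subset by blast
  have F_sub: "F S \<subseteq> space (eucl_prod d S)" for S using P(2) by (auto simp: F_def)
  have sum_P: "(\<Sum>p\<in>P. f p) = (\<Sum>S\<in>T. \<Sum>t\<in>F S. f (S, t))" for f :: "_ \<Rightarrow> complex"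
    unfolding P_eq using sum.Sigma[of T F "\<lambda>S t. f (S, t)"] T finF by (simp add: split_def)
  define X where "X S \<omega> = iexp (Re (\<Sum>t\<in>F S. c (S, t) * Z S t \<omega>))" for S \<omega>
  define Y where "Y S x = iexp (Re (\<Sum>t\<in>F S. c (S, t) * x t))" for S and x :: "(nat \<Rightarrow> nat \<Rightarrow> real) \<Rightarrow> complex"
  have Y: "Y S \<in> borel_measurable (PiM (space (eucl_prod d S)) (\<lambda>_. borel))" for S
  proof -
    have [measurable]: "(\<lambda>x. x t) \<in> borel_measurable (PiM (space (eucl_prod d S)) (\<lambda>_. borel))" if "t \<in> F S" for t
      using F_sub that by (intro measurable_component_singleton) auto
    show ?thesis unfolding Y_def[abs_def] by measurable
  qed
  have XY: "X S = (\<lambda>\<omega>. Y S (\<lambda>t\<in>space (eucl_prod d S). Z S t \<omega>))" for S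
    unfolding X_def Y_def using F_sub[of S]
    by (intro ext arg_cong[where f = "\<lambda>z. iexp (Re z)"] sum.cong refl) (auto simp: subset_iff)
  have X_indep: "indep_vars (\<lambda>_. borel) X T"
    unfolding XY by (rule indep_vars_compose2[OF Z_indep Y])
  have X_meas: "X S \<in> borel_measurable N" if "S \<in> T" for S
    using X_indep that by (simp add: indep_vars_def)
  have X_int: "integrable N (X S)" if "S \<in> T" for S
    by (rule integrable_const_bound[where B = 1, OF _ X_meas[OF that]]) (simp add: X_def)
  define cf where "cf S = (\<Sum>t\<in>F S. \<Sum>t'\<in>F S. c (S, t) * cnj (c (S, t')) * C_cov d S t t'
      + c (S, t) * c (S, t') * C_cov d S t (\<lambda>i k. - t' i k))" for S
  have EX: "(\<integral>\<omega>. X S \<omega> \<partial>N) = of_real (exp (- (Re (cf S) / 2 / 2)))" if "S \<in> T" for S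
  proof -
    interpret gaussian_limit N d S "Z S"
      by unfold_locales (rule Z_proc[OF that])
    show ?thesis
      unfolding X_def cf_def by (rule char_linear_functional[OF finF F_sub])
  qed
  have "cov_form d P c = Re (\<Sum>S\<in>T. cf S) / 2"
  proof -
    define K where "K p q = (if fst p = fst q then c p * cnj (c q) * C_cov d (fst p) (snd p) (snd q)
        + c p * c q * C_cov d (fst p) (snd p) (\<lambda>i k. - snd q i k) else 0)" for p q
    have "(\<Sum>q\<in>P. K (S, t) q) = (\<Sum>t'\<in>F S. K (S, t) (S, t'))" if "S \<in> T" for S t
    proof -
      have "(\<Sum>q\<in>P. K (S, t) q) = (\<Sum>S'\<in>T. if S' = S then (\<Sum>t'\<in>F S. K (S, t) (S, t')) else 0)"
        unfolding sum_P by (intro sum.cong) (auto simp: K_def)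
      also have "\<dots> = (\<Sum>t'\<in>F S. K (S, t) (S, t'))"
        using that by (simp only: sum.delta[OF T] if_True)
      finally show ?thesis .
    qed
    then have "(\<Sum>p\<in>P. \<Sum>q\<in>P. K p q) = (\<Sum>S\<in>T. cf S)"
      unfolding sum_P[of "\<lambda>p. \<Sum>q\<in>P. K p q"] cf_def by (intro sum.cong refl) (simp add: K_def)
    then show ?thesis unfolding cov_form_def K_def by (simp only:)
  qed
  then have "(\<Prod>S\<in>T. complex_of_real (exp (- (Re (cf S) / 2 / 2)))) = of_real (exp (- (cov_form d P c / 2)))"
    using T by (simp add: exp_sum[symmetric] sum_negf sum_divide_distrib flip: of_real_prod exp_of_real)
  moreover have "(\<integral>\<omega>. (\<Prod>S\<in>T. X S \<omega>) \<partial>N) = (\<Prod>S\<in>T. complex_of_real (exp (- (Re (cf S) / 2 / 2))))"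
    using indep_vars_lebesgue_integral[OF T X_indep X_int] by (simp add: EX)
  moreover have "(\<Prod>S\<in>T. X S \<omega>) = iexp (Re (\<Sum>p\<in>P. c p * Z (fst p) (snd p) \<omega>))" for \<omega>
    unfolding sum_P X_def Re_sum[of _ T] using T
    by (simp only: exp_sum[OF T, symmetric] of_real_sum sum_distrib_left fst_conv snd_conv)
  ultimately show ?thesis by simp
qed

text \<open>Second moments and increments of the limit are limits of \<open>corr_factor\<close>
  times the same expressions in grid covariances. These are the moments of the empirical process, so
  its bounds carry over with the same constant.\<close>

lemma regular_limit:
  fixes h :: "nat \<Rightarrow> nat \<Rightarrow> nat \<Rightarrow> nat \<Rightarrow> real"
  assumes N: "prob_space N" and lim: "limit_process N d S Z"
    and S: "finite S" "2 \<le> card S" and dims: "\<forall>i\<in>S. 1 \<le> d i"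
    and grid: "\<And>n i j. i \<in> S \<Longrightarrow> j \<in> {1..n} \<Longrightarrow> h n (d i) j \<in> PiE {..<d i} (\<lambda>_. {0..1})"
    and conv: "\<And>i. i \<in> S \<Longrightarrow> weak_conv_on {..<d i} (\<lambda>n. empirical (d i) n (h n (d i))) (unif_cube (d i))"
  shows "regular_process N d S Z (grid_array.moment_bound d S)"
proof -
  interpret gaussian_limit N d S Z
    using N lim by (simp add: gaussian_limit_def gaussian_limit_axioms_def)
  let ?A = "grid_array.moment_bound d S"
  define g where "g n i = h n (d i)" for n i
  have arr: "grid_array S d (g n) n S" if "2 \<le> n" for n
  proof
    show "\<bar>g n i j k\<bar> \<le> 1" if "i \<in> S" "j \<in> {1..n}" "k < d i" for i j k
    proof -
      have "h n (d i) j k \<in> {0..1}" using PiE_mem[OF grid[OF that(1,2)], of k] that(3) by simp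
      then show ?thesis by (simp add: g_def)
    qed
  qed (use that S dims in auto)
  have lim: "(\<lambda>n. corr_factor n (card S) * Re (f n)) \<longlonglongrightarrow> Re y" if "f \<longlonglongrightarrow> y" for f y
    using tendsto_mult[OF corr_factor_tendsto[OF S(2)] tendsto_Re[OF that]] by simp
  have gc: "(\<lambda>n. \<Prod>i\<in>S. gcov n (d i) (g n i) (t i) (t' i)) \<longlonglongrightarrow> C_cov d S t t'" for t t'
    unfolding g_def by (rule gcov_prod_tendsto) (fact grid conv)+
  show ?thesis
  proof
    show "finite S" "\<forall>i\<in>S. 1 \<le> d i" by (fact S dims)+
    show "0 \<le> ?A" using grid_array.moment_bound_nonneg[OF arr[of 2]] by simp
    show "(\<lambda>(t, \<omega>). Z t \<omega>) \<in> borel_measurable (eucl_prod d S \<Otimes>\<^sub>M N)"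
      using lim_process_meas .
    show "integrable N (\<lambda>\<omega>. (cmod (Z t \<omega>))\<^sup>2)" if "t \<in> space (eucl_prod d S)" for t
      by (rule int_Z2[OF that])
    show "(\<integral>\<omega>. (cmod (Z t \<omega>))\<^sup>2 \<partial>N) \<le> ?A * weight d S t" if "t \<in> space (eucl_prod d S)" for t
      unfolding second_moment[OF that]
    proof (rule LIMSEQ_le_const2[OF lim[OF gc]], intro exI allI impI)
      fix n :: nat assume n: "2 \<le> n"
      interpret A: grid_array S d "g n" n S by (rule arr[OF n])
      have "Re (avg (perm_tuples S n) (\<lambda>\<pi>. A.em t \<pi> * cnj (A.em t \<pi>))) = avg (perm_tuples S n) (\<lambda>\<pi>. (cmod (A.em t \<pi>))\<^sup>2)"
        by (simp only: complex_norm_square[symmetric] avg_of_real Re_complex_of_real)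
      then show "corr_factor n (card S) * Re (\<Prod>i\<in>S. gcov n (d i) (g n i) (t i) (t i)) \<le> ?A * weight d S t"
        using A.emp_second_moment[of t] unfolding A.avg_emp_mult_cnj by simp
    qed
    show "(\<integral>\<omega>. (cmod (Z t \<omega> - Z t' \<omega>))\<^sup>2 \<partial>N) \<le> ?A * \<delta>\<^sup>2"
      if t: "t \<in> space (eucl_prod d S)" "t' \<in> space (eucl_prod d S)" and \<delta>: "0 \<le> \<delta>"
        "\<And>i k. i \<in> S \<Longrightarrow> k < d i \<Longrightarrow> \<bar>t i k - t' i k\<bar> \<le> \<delta>" for t t' \<delta>
      unfolding increment[OF t]
    proof (rule LIMSEQ_le_const2[OF lim[OF tendsto_add[OF tendsto_diff[OF gc tendsto_mult[OF tendsto_const gc]] gc]]],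
        intro exI allI impI)
      fix n :: nat assume n: "2 \<le> n"
      interpret A: grid_array S d "g n" n S by (rule arr[OF n])
      show "corr_factor n (card S) * Re ((\<Prod>i\<in>S. gcov n (d i) (g n i) (t i) (t i))
        - 2 * (\<Prod>i\<in>S. gcov n (d i) (g n i) (t i) (t' i)) + (\<Prod>i\<in>S. gcov n (d i) (g n i) (t' i) (t' i))) \<le> ?A * \<delta>\<^sup>2"
        using A.emp_increment[of t t' \<delta>] \<delta> unfolding A.avg_emp_diff by blast
    qed
  qed
qed

section \<open>Replacing the integrals by Riemann sums\<close>

lemma abs_exp_diff_le:
  fixes x y :: real assumes "0 \<le> x" "0 \<le> y" shows "\<bar>exp (- x) - exp (- y)\<bar> \<le> \<bar>x - y\<bar>"
proof -
  have *: "exp (- a) - exp (- b) \<le> b - a" if "0 \<le> a" "a \<le> b" for a b :: real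
  proof -
    have "exp (- a) - exp (- b) = exp (- a) * (1 - exp (- (b - a)))"
      by (simp add: algebra_simps flip: exp_add)
    also have "\<dots> \<le> 1 * (b - a)"
    proof (rule mult_mono)
      show "1 - exp (- (b - a)) \<le> b - a" using exp_ge_add_one_self[of "- (b - a)"] by linarith
    qed (use that in auto)
    finally show ?thesis by simp
  qed
  show ?thesis
  proof (cases "x \<le> y")
    case True
    with *[OF assms(1) True] show ?thesis by (simp add: abs_if)
  next
    case False
    with *[OF assms(2), of x] show ?thesis by (simp add: abs_if)
  qed
qed

text \<open>The map \<open>exp (- x)\<close> is 1-Lipschitz on nonnegative reals, so the mean
  absolute errors of the Riemann sums control the error of the Laplace transform.\<close>

lemma laplace_riemann_error:
  fixes p :: "nat set \<Rightarrow> nat"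
  assumes \<Omega>: "prob_space \<Omega>" and T: "finite T" and reg: "\<And>S. S \<in> T \<Longrightarrow> regular_process \<Omega> d S (Y S) (A S)"
    and L: "1 \<le> L" and m: "1 \<le> m"
  shows "\<bar>(\<integral>\<omega>. exp (- (\<Sum>S\<in>T. real (p S) * limit_integral d S (Y S) \<omega>)) \<partial>\<Omega>)
      - (\<integral>\<omega>. exp (- (\<Sum>S\<in>T. real (p S) * riemann d S L m (\<lambda>t. Y S t \<omega>))) \<partial>\<Omega>)\<bar>
    \<le> (\<Sum>S\<in>T. real (p S) * (A S * riemann_err d S L m))"
proof -
  interpret prob_space \<Omega> by fact
  define V where "V S \<omega> = limit_integral d S (Y S) \<omega>" for S \<omega>
  define U where "U S \<omega> = riemann d S L m (\<lambda>t. Y S t \<omega>)" for S \<omega>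
  have V: "integrable \<Omega> (V S)" and U: "integrable \<Omega> (U S)"
    and VU: "(\<integral>\<omega>. \<bar>V S \<omega> - U S \<omega>\<bar> \<partial>\<Omega>) \<le> A S * riemann_err d S L m" if "S \<in> T" for S
  proof -
    interpret regular_process \<Omega> d S "Y S" "A S" by (rule reg[OF that])
    show "integrable \<Omega> (V S)" "integrable \<Omega> (U S)" "(\<integral>\<omega>. \<bar>V S \<omega> - U S \<omega>\<bar> \<partial>\<Omega>) \<le> A S * riemann_err d S L m"
      unfolding V_def[abs_def] U_def[abs_def]
      by (rule integrable_limit_integral integrable_riemann riemann_error[OF L m])+
  qed
  have V0: "0 \<le> V S \<omega>" and U0: "0 \<le> U S \<omega>" for S \<omega>
    by (auto simp: V_def U_def limit_integral_def riemann_def intro!: sum_nonneg)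
  have int: "integrable \<Omega> (\<lambda>\<omega>. exp (- (\<Sum>S\<in>T. real (p S) * F S \<omega>)))"
    if F: "\<And>S. S \<in> T \<Longrightarrow> integrable \<Omega> (F S)" "\<And>S \<omega>. 0 \<le> F S \<omega>" for F :: "nat set \<Rightarrow> _ \<Rightarrow> real"
  proof (rule integrable_const_bound[where B = 1])
    have "(\<lambda>\<omega>. \<Sum>S\<in>T. real (p S) * F S \<omega>) \<in> borel_measurable \<Omega>"
      using F(1) by (intro borel_measurable_sum borel_measurable_times) auto
    then show "(\<lambda>\<omega>. exp (- (\<Sum>S\<in>T. real (p S) * F S \<omega>))) \<in> borel_measurable \<Omega>" by measurable
  qed (use F(2) in \<open>auto intro!: AE_I2 sum_nonneg\<close>)
  note intV = int[of V, OF V V0] and intU = int[of U, OF U U0]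
  have "\<bar>(\<integral>\<omega>. exp (- (\<Sum>S\<in>T. real (p S) * V S \<omega>)) \<partial>\<Omega>) - (\<integral>\<omega>. exp (- (\<Sum>S\<in>T. real (p S) * U S \<omega>)) \<partial>\<Omega>)\<bar>
    = \<bar>\<integral>\<omega>. exp (- (\<Sum>S\<in>T. real (p S) * V S \<omega>)) - exp (- (\<Sum>S\<in>T. real (p S) * U S \<omega>)) \<partial>\<Omega>\<bar>"
    by (simp only: Bochner_Integration.integral_diff[OF intV intU])
  also have "\<dots> \<le> (\<integral>\<omega>. \<bar>exp (- (\<Sum>S\<in>T. real (p S) * V S \<omega>)) - exp (- (\<Sum>S\<in>T. real (p S) * U S \<omega>))\<bar> \<partial>\<Omega>)"
    by (rule integral_abs_bound)
  also have "\<dots> \<le> (\<integral>\<omega>. (\<Sum>S\<in>T. real (p S) * \<bar>V S \<omega> - U S \<omega>\<bar>) \<partial>\<Omega>)"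
  proof (rule integral_mono)
    show "integrable \<Omega> (\<lambda>\<omega>. \<bar>exp (- (\<Sum>S\<in>T. real (p S) * V S \<omega>)) - exp (- (\<Sum>S\<in>T. real (p S) * U S \<omega>))\<bar>)"
      by (intro integrable_abs Bochner_Integration.integrable_diff intV intU)
    show "integrable \<Omega> (\<lambda>\<omega>. \<Sum>S\<in>T. real (p S) * \<bar>V S \<omega> - U S \<omega>\<bar>)"
      using V U by (intro Bochner_Integration.integrable_sum integrable_mult_right integrable_abs Bochner_Integration.integrable_diff)
    fix \<omega>
    have "\<bar>exp (- (\<Sum>S\<in>T. real (p S) * V S \<omega>)) - exp (- (\<Sum>S\<in>T. real (p S) * U S \<omega>))\<bar>
      \<le> \<bar>(\<Sum>S\<in>T. real (p S) * V S \<omega>) - (\<Sum>S\<in>T. real (p S) * U S \<omega>)\<bar>"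
      by (intro abs_exp_diff_le sum_nonneg mult_nonneg_nonneg V0 U0) auto
    also have "\<dots> = \<bar>\<Sum>S\<in>T. real (p S) * (V S \<omega> - U S \<omega>)\<bar>"
      by (simp add: sum_subtractf right_diff_distrib)
    also have "\<dots> \<le> (\<Sum>S\<in>T. \<bar>real (p S) * (V S \<omega> - U S \<omega>)\<bar>)" by (rule sum_abs)
    finally show "\<bar>exp (- (\<Sum>S\<in>T. real (p S) * V S \<omega>)) - exp (- (\<Sum>S\<in>T. real (p S) * U S \<omega>))\<bar>
      \<le> (\<Sum>S\<in>T. real (p S) * \<bar>V S \<omega> - U S \<omega>\<bar>)" by (simp add: abs_mult)
  qed
  also have "\<dots> = (\<Sum>S\<in>T. real (p S) * (\<integral>\<omega>. \<bar>V S \<omega> - U S \<omega>\<bar> \<partial>\<Omega>))"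
    using V U by (subst Bochner_Integration.integral_sum) auto
  also have "\<dots> \<le> (\<Sum>S\<in>T. real (p S) * (A S * riemann_err d S L m))"
    by (intro sum_mono mult_left_mono VU) auto
  finally show ?thesis by (simp only: V_def U_def)
qed

text \<open>The order of choice matters: \<open>L\<close> controls the tails regardless of
  \<open>m\<close>; for this fixed \<open>L\<close> the windows have fixed masses, which a large
  \<open>m\<close> divides down.\<close>

lemma riemann_err_small:
  assumes T: "finite T" and S: "\<And>S. S \<in> T \<Longrightarrow> finite S \<and> (\<forall>i\<in>S. 1 \<le> d i)" and e: "0 < (e :: real)"
  shows "\<exists>L m. 1 \<le> L \<and> 1 \<le> m \<and> (\<Sum>S\<in>T. a S * riemann_err d S L m) < e"
proof -
  have "(\<lambda>L. \<Sum>S\<in>T. a S * tail d S L) \<longlonglongrightarrow> (\<Sum>S\<in>T. a S * 0)"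
    using S by (intro tendsto_sum tendsto_mult tendsto_const tail_tendsto_0) auto
  then have lim: "(\<lambda>L. \<Sum>S\<in>T. a S * tail d S L) \<longlonglongrightarrow> 0" by simp
  have "eventually (\<lambda>L. (\<Sum>S\<in>T. a S * tail d S L) < e / 2 \<and> 1 \<le> L) sequentially"
    using e by (intro eventually_conj order_tendstoD(2)[OF lim] eventually_ge_at_top) simp
  then obtain L where L: "(\<Sum>S\<in>T. a S * tail d S L) < e / 2" "1 \<le> L"
    by (auto simp: eventually_sequentially)
  let ?w = "\<lambda>S. measure (w_prod d S) (window d S L)"
  have "(\<lambda>m. \<Sum>S\<in>T. a S * (3 * (1 / real m) * ?w S)) \<longlonglongrightarrow> (\<Sum>S\<in>T. a S * (3 * 0 * ?w S))"
    by (intro tendsto_sum tendsto_mult tendsto_const lim_1_over_n)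
  then have lim': "(\<lambda>m. \<Sum>S\<in>T. a S * (3 * (1 / real m) * ?w S)) \<longlonglongrightarrow> 0" by simp
  have "eventually (\<lambda>m. (\<Sum>S\<in>T. a S * (3 * (1 / real m) * ?w S)) < e / 2 \<and> 1 \<le> m) sequentially"
    using e by (intro eventually_conj order_tendstoD(2)[OF lim'] eventually_ge_at_top) simp
  then obtain m where m: "(\<Sum>S\<in>T. a S * (3 * (1 / real m) * ?w S)) < e / 2" "1 \<le> m"
    by (auto simp: eventually_sequentially)
  have "(\<Sum>S\<in>T. a S * riemann_err d S L m) = (\<Sum>S\<in>T. a S * tail d S L) + (\<Sum>S\<in>T. a S * (3 * (1 / real m) * ?w S))"
    by (simp add: riemann_err_def distrib_left sum.distrib)
  then show ?thesis using L m by (intro exI[of _ L] exI[of _ m]) simp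
qed

text \<open>A three-epsilon argument. The discretization error has the same bound for every
  \<open>n >= 2\<close> and for the limit, because the moment constants agree; for fixed
  \<open>L\<close> and \<open>m\<close> only finitely many frequencies are involved.\<close>

theorem emp_laplace_tendsto:
  fixes h :: "nat \<Rightarrow> nat \<Rightarrow> nat \<Rightarrow> nat \<Rightarrow> real" and p :: "nat set \<Rightarrow> nat"
  assumes N: "prob_space N" and I: "finite I" and T: "T \<subseteq> {S. S \<subseteq> I \<and> 2 \<le> card S}" and dims: "\<forall>i\<in>I. 1 \<le> d i"
    and grid: "\<And>n i j. i \<in> I \<Longrightarrow> j \<in> {1..n} \<Longrightarrow> h n (d i) j \<in> PiE {..<d i} (\<lambda>_. {0..1})"
    and conv: "\<And>i. i \<in> I \<Longrightarrow> weak_conv_on {..<d i} (\<lambda>n. empirical (d i) n (h n (d i))) (unif_cube (d i))"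
    and Z_proc: "\<And>S. S \<in> T \<Longrightarrow> limit_process N d S (Z S)"
    and Z_indep: "prob_space.indep_vars N (\<lambda>S. PiM (space (eucl_prod d S)) (\<lambda>_. borel))
        (\<lambda>S \<omega>. \<lambda>t\<in>space (eucl_prod d S). Z S t \<omega>) T"
    and arr: "\<And>n S. 2 \<le> n \<Longrightarrow> S \<in> T \<Longrightarrow> grid_array I d (\<lambda>i. h n (d i)) n S"
    and reg: "\<And>S. S \<in> T \<Longrightarrow> regular_process N d S (Z S) (grid_array.moment_bound d S)"
  shows "(\<lambda>n. \<integral>\<pi>. exp (- (\<Sum>S\<in>T. real (p S) * limit_integral d S (emp_process n d (\<lambda>i. h n (d i)) S) \<pi>))
      \<partial>uniform_count_measure (perm_tuples I n))
    \<longlonglongrightarrow> (\<integral>\<omega>. exp (- (\<Sum>S\<in>T. real (p S) * limit_integral d S (Z S) \<omega>)) \<partial>N)" (is "?f \<longlonglongrightarrow> ?g")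
proof -
  define \<Omega> where "\<Omega> n = uniform_count_measure (perm_tuples I n)" for n
  define em where "em n = emp_process n d (\<lambda>i. h n (d i))" for n
  have finT: "finite T" using I by (intro finite_subset[OF T]) (simp add: finite_subset[of _ "Pow I"])
  have S: "S \<subseteq> I" "2 \<le> card S" "finite S" "\<forall>i\<in>S. 1 \<le> d i" if "S \<in> T" for S
    using T that dims finite_subset[OF _ I] by auto
  have P\<Omega>: "prob_space (\<Omega> n)" for n
    unfolding \<Omega>_def using I by (intro prob_space_uniform_count_measure) auto
  have int_avg: "(\<integral>\<pi>. f \<pi> \<partial>\<Omega> n) = avg (perm_tuples I n) f" for f :: "_ \<Rightarrow> complex" and n
    unfolding \<Omega>_def uniform_count_measure_def using I
    by (subst lebesgue_integral_point_measure_finite) (simp_all add: avg_def scaleR_conv_of_real sum_distrib_right[symmetric] divide_inverse mult.commute)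
  have riem: "(\<lambda>n. \<integral>\<pi>. exp (- (\<Sum>S\<in>T. real (p S) * riemann d S L m (\<lambda>t. em n S t \<pi>))) \<partial>\<Omega> n)
    \<longlonglongrightarrow> (\<integral>\<omega>. exp (- (\<Sum>S\<in>T. real (p S) * riemann d S L m (\<lambda>t. Z S t \<omega>))) \<partial>N)" for L m
  proof -
    define P where "P = Sigma T (\<lambda>S. nodes d S L m)"
    \<comment> \<open>The factor 2 offsets the one half in the Gaussian Laplace transform.\<close>
    define v where "v q = 2 * real (p (fst q)) * measure (w_prod d (fst q)) (cell d (fst q) L m (snd q))" for q
    have finN: "finite (nodes d S L m)" if "S \<in> T" for S using S[OF that] by (intro finite_nodes)
    have P: "finite P" "P \<subseteq> Sigma T (\<lambda>S. space (eucl_prod d S))"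
      unfolding P_def using finT finN rnd_in_space by (auto simp: nodes_def)
    have sumP: "(\<Sum>q\<in>P. v q * (cmod (y (fst q) (snd q)))\<^sup>2) / 2 = (\<Sum>S\<in>T. real (p S) * riemann d S L m (y S))" for y
      unfolding P_def riemann_def v_def using finT finN
      by (subst sum.Sigma[symmetric, of T "\<lambda>S. nodes d S L m" "\<lambda>S \<tau>. 2 * real (p S) * measure (w_prod d S) (cell d S L m \<tau>) * (cmod (y S \<tau>))\<^sup>2", unfolded split_def])
         (auto simp: sum_divide_distrib sum_distrib_left mult_ac)
    have "(\<lambda>n. \<integral>\<pi>. exp (- ((\<Sum>q\<in>P. v q * (cmod (em n (fst q) (snd q) \<pi>))\<^sup>2) / 2)) \<partial>\<Omega> n)
      \<longlonglongrightarrow> (\<integral>\<omega>. exp (- ((\<Sum>q\<in>P. v q * (cmod (Z (fst q) (snd q) \<omega>))\<^sup>2) / 2)) \<partial>N)"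
    proof (rule char_conv_imp_laplace_conv[OF P\<Omega> N P(1)])
      show "0 \<le> v q" for q by (simp add: v_def)
      show "em n (fst q) (snd q) \<in> borel_measurable (\<Omega> n)" for n q
        by (simp add: \<Omega>_def measurable_cong_sets[OF sets_uniform_count_measure_count_space refl])
      show "Z (fst q) (snd q) \<in> borel_measurable N" if "q \<in> P" for q
        using Z_proc[of "fst q"] P(2) that by (auto simp: limit_process_def complex_gaussian_process_def)
      fix c
      have "(\<lambda>n. avg (perm_tuples I n) (\<lambda>\<pi>. iexp (Re (\<Sum>q\<in>P. c q * em n (fst q) (snd q) \<pi>))))
        \<longlonglongrightarrow> of_real (exp (- (cov_form d P c / 2)))"
        unfolding em_def
      proof (rule emp_process_CLT[OF I P(1)])
        fix q assume "q \<in> P"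
        then have "fst q \<in> T" by (auto simp: P_def)
        from S[OF this] show "fst q \<subseteq> I" "2 \<le> card (fst q)" by auto
      qed (fact grid conv)+
      then show "(\<lambda>n. \<integral>\<pi>. iexp (Re (\<Sum>q\<in>P. c q * em n (fst q) (snd q) \<pi>)) \<partial>\<Omega> n)
        \<longlonglongrightarrow> (\<integral>\<omega>. iexp (Re (\<Sum>q\<in>P. c q * Z (fst q) (snd q) \<omega>)) \<partial>N)"
        unfolding int_avg using char_limit_functional[OF N finT Z_proc Z_indep P, of c] by simp
    qed
    moreover note sumP[of "\<lambda>S t. em _ S t _"] sumP[of "\<lambda>S t. Z S t _"]
    ultimately show ?thesis by (simp only:)
  qed
  show ?thesis
  proof (rule LIMSEQ_I)
    fix e :: real assume e: "0 < e"
    let ?A = "\<lambda>S. grid_array.moment_bound d S"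
    obtain L m where Lm: "1 \<le> L" "1 \<le> m" "(\<Sum>S\<in>T. real (p S) * ?A S * riemann_err d S L m) < e / 3"
      using riemann_err_small[OF finT, of d "e / 3" "\<lambda>S. real (p S) * ?A S"] S e by auto
    then have err: "(\<Sum>S\<in>T. real (p S) * (?A S * riemann_err d S L m)) < e / 3" by (simp only: mult.assoc)
    from LIMSEQ_D[OF riem[of L m], of "e / 3"] e obtain n1 where n1: "\<And>n. n1 \<le> n \<Longrightarrow>
      \<bar>(\<integral>\<pi>. exp (- (\<Sum>S\<in>T. real (p S) * riemann d S L m (\<lambda>t. em n S t \<pi>))) \<partial>\<Omega> n)
        - (\<integral>\<omega>. exp (- (\<Sum>S\<in>T. real (p S) * riemann d S L m (\<lambda>t. Z S t \<omega>))) \<partial>N)\<bar> < e / 3"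
      by auto
    have "norm (?f n - ?g) < e" if n: "max 2 n1 \<le> n" for n
    proof -
      have "regular_process (\<Omega> n) d S (em n S) (?A S)" if "S \<in> T" for S
        unfolding \<Omega>_def em_def using n that by (intro grid_array.regular_emp arr) auto
      then have 1: "\<bar>(\<integral>\<pi>. exp (- (\<Sum>S\<in>T. real (p S) * limit_integral d S (em n S) \<pi>)) \<partial>\<Omega> n)
        - (\<integral>\<pi>. exp (- (\<Sum>S\<in>T. real (p S) * riemann d S L m (\<lambda>t. em n S t \<pi>))) \<partial>\<Omega> n)\<bar>
        \<le> (\<Sum>S\<in>T. real (p S) * (?A S * riemann_err d S L m))"
        by (rule laplace_riemann_error[OF P\<Omega> finT _ Lm(1,2)])
      have 2: "\<bar>(\<integral>\<omega>. exp (- (\<Sum>S\<in>T. real (p S) * limit_integral d S (Z S) \<omega>)) \<partial>N)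
        - (\<integral>\<omega>. exp (- (\<Sum>S\<in>T. real (p S) * riemann d S L m (\<lambda>t. Z S t \<omega>))) \<partial>N)\<bar>
        \<le> (\<Sum>S\<in>T. real (p S) * (?A S * riemann_err d S L m))"
        by (rule laplace_riemann_error[OF N finT reg Lm(1,2)])
      from n have "n1 \<le> n" by simp
      from n1[OF this] 1 2 err show ?thesis
        unfolding \<Omega>_def[symmetric] em_def[symmetric] real_norm_def by linarith
    qed
    then show "\<exists>no. \<forall>n\<ge>no. norm (?f n - ?g) < e" by blast
  qed
qed

section \<open>Transfer from the data to random permutations\<close>

lemma RdCov2_eq_limit_integral:
  assumes n: "1 \<le> n" and \<pi>: "\<pi> \<in> perm_tuples I n" and S: "S \<subseteq> I"
  shows "real n * RdCov2 n d (\<lambda>i a. g i (\<pi> i a)) S = limit_integral d S (emp_process n d g S) \<pi>"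
proof -
  have gc: "(1 / of_nat n) * (\<Sum>a=1..n. iexp (ip (d i) t (g i (\<pi> i a)))) = gchar n (d i) (g i) t" if "i \<in> S" for i t
  proof -
    have "\<pi> i permutes {1..n}" using PiE_mem[OF \<pi>[unfolded perm_tuples_def], of i] S that by (auto simp: perms_def)
    from sum.reindex_bij_betw[OF permutes_imp_bij[OF this], of "\<lambda>j. iexp (ip (d i) t (g i j))"]
    show ?thesis by (simp add: gchar_def avg_def)
  qed
  have pr: "(\<Prod>i\<in>S. (1 / of_nat n) * (\<Sum>a=1..n. iexp (ip (d i) (t i) (g i (\<pi> i a)))) - iexp (ip (d i) (t i) (g i (\<pi> i b))))
      = (\<Prod>i\<in>S. gdev n (d i) (g i) (t i) (\<pi> i b))" for t b
    by (intro prod.cong refl) (simp only: gc gdev_def)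
  \<comment> \<open>The factor \<open>n\<close> goes inside the squared modulus as
    \<open>sqrt n\<close>, turning \<open>1 / n\<close> into the scaling \<open>1 / sqrt n\<close>
    of \<open>emp_process\<close>.\<close>
  have sq: "real n * (cmod ((1 / of_nat n) * z))\<^sup>2 = (cmod (z / of_real (sqrt n)))\<^sup>2" for z :: complex
    using n by (simp add: norm_mult norm_divide power_divide power_mult_distrib power2_eq_square field_simps)
  show ?thesis
    unfolding RdCov2_def limit_integral_def emp_process_def pr sq[symmetric] by simp
qed

lemma RdCov2_cong:
  assumes "\<And>i a. i \<in> S \<Longrightarrow> a \<in> {1..n} \<Longrightarrow> R i a = R' i a"
  shows "RdCov2 n d R S = RdCov2 n d R' S"
  unfolding RdCov2_def using assms by (simp cong: prod.cong_simp sum.cong_simp)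

lemma opt_perm_cong:
  assumes "\<And>a. a \<in> {1..n} \<Longrightarrow> x a = x' a"
  shows "opt_perm n e g x = opt_perm n e g x'"
proof -
  have "(\<lambda>\<sigma>. \<Sum>a=1..n. (enorm e (\<lambda>k. x a k - g (\<sigma> a) k))\<^sup>2) = (\<lambda>\<sigma>. \<Sum>a=1..n. (enorm e (\<lambda>k. x' a k - g (\<sigma> a) k))\<^sup>2)"
    using assms by (intro ext sum.cong) auto
  then show ?thesis unfolding opt_perm_def by (rule arg_cong)
qed

text \<open>The ranks are a function of finitely many permutations, so every functional of them is
  measurable and bounded whatever \<open>\<Psi>\<close> is; no regularity of \<open>RdCov2\<close>
  has to be checked.\<close>

lemma (in grid_sample) rank_law:
  fixes M :: "'w measure" and X :: "nat \<Rightarrow> 'w \<Rightarrow> nat \<Rightarrow> nat \<Rightarrow> real"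
    and \<Psi> :: "(nat \<Rightarrow> nat \<Rightarrow> nat \<Rightarrow> real) \<Rightarrow> 'b" and f :: "'b \<Rightarrow> real"
  defines "Rk \<equiv> \<lambda>\<omega> i a. g i (opt_perm n (d i) (g i) (\<lambda>a. X a \<omega> i) a)"
  assumes M: "prob_space M"
    and indep: "prob_space.indep_vars M (\<lambda>_. eucl_prod d I) X {1..n}"
    and distr: "\<And>a. a \<in> {1..n} \<Longrightarrow> distr M (eucl_prod d I) (X a) = PiM I \<mu>"
    and \<Psi>: "\<And>R R'. (\<And>i a. i \<in> I \<Longrightarrow> a \<in> {1..n} \<Longrightarrow> R i a = R' i a) \<Longrightarrow> \<Psi> R = \<Psi> R'"
    and \<Psi>_space: "\<And>R. \<Psi> R \<in> space K"
  shows "(\<lambda>\<omega>. \<Psi> (Rk \<omega>)) \<in> measurable M K"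
    and "integrable M (\<lambda>\<omega>. f (\<Psi> (Rk \<omega>)))"
    and "(\<integral>\<omega>. f (\<Psi> (Rk \<omega>)) \<partial>M) = avg (perm_tuples I n) (\<lambda>\<pi>. f (\<Psi> (\<lambda>i a. g i (\<pi> i a))))"
proof -
  interpret M: prob_space M by fact
  let ?F = "\<lambda>\<omega>. \<lambda>ai\<in>{1..n} \<times> I. X (fst ai) \<omega> (snd ai)"
  define G where "G \<pi> = \<Psi> (\<lambda>i a. g i (\<pi> i a))" for \<pi>
  have F: "?F \<in> measurable M sample" and dF: "distr M sample ?F = sample"
    by (rule distr_sample[OF M indep], fact distr)+
  have eq: "\<Psi> (Rk \<omega>) = G (rank_perm (?F \<omega>))" for \<omega>
    unfolding G_def
  proof (rule \<Psi>)
    fix i a assume i: "i \<in> I"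
    have "opt_perm n (d i) (g i) (\<lambda>a. X a \<omega> i) = opt_perm n (d i) (g i) (\<lambda>a. ?F \<omega> (a, i))"
      using i by (intro opt_perm_cong) simp
    with i show "Rk \<omega> i a = g i (rank_perm (?F \<omega>) i a)"
      by (simp only: Rk_def rank_perm_def restrict_apply' if_True)
  qed
  have comp: "(\<lambda>\<omega>. H (rank_perm (?F \<omega>))) \<in> measurable M K'"
    if "\<And>\<pi>. H \<pi> \<in> space K'" for H :: "_ \<Rightarrow> 'c" and K'
    by (rule measurable_compose[OF measurable_compose[OF F measurable_rank_perm]]) (use that in auto)
  show "(\<lambda>\<omega>. \<Psi> (Rk \<omega>)) \<in> measurable M K"
    unfolding eq by (rule comp) (simp add: G_def \<Psi>_space)
  show "integrable M (\<lambda>\<omega>. f (\<Psi> (Rk \<omega>)))"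
    unfolding eq
  proof (rule M.integrable_const_bound[where B = "Max ((\<lambda>\<pi>. \<bar>f (G \<pi>)\<bar>) ` perm_tuples I n)"])
    show "AE \<omega> in M. norm (f (G (rank_perm (?F \<omega>)))) \<le> Max ((\<lambda>\<pi>. \<bar>f (G \<pi>)\<bar>) ` perm_tuples I n)"
      using rank_perm_in finite_I by (intro AE_I2) (auto intro!: Max_ge)
  qed (rule comp[of "\<lambda>\<pi>. f (G \<pi>)" borel], simp)
  have "(\<integral>\<omega>. f (\<Psi> (Rk \<omega>)) \<partial>M) = (\<integral>x. f (G (rank_perm x)) \<partial>distr M sample ?F)"
    unfolding eq by (rule integral_distr[OF F, symmetric]) (rule measurable_compose[OF measurable_rank_perm], simp)
  also have "\<dots> = avg (perm_tuples I n) (\<lambda>\<pi>. f (\<Psi> (\<lambda>i a. g i (\<pi> i a))))"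
    unfolding dF G_def by (rule integral_rank_perm[where \<Psi> = "\<lambda>R. f (\<Psi> R)"]) (rule arg_cong[OF \<Psi>])
  finally show "(\<integral>\<omega>. f (\<Psi> (Rk \<omega>)) \<partial>M) = avg (perm_tuples I n) (\<lambda>\<pi>. f (\<Psi> (\<lambda>i a. g i (\<pi> i a))))" .
qed

theorem theorem3p7:
  fixes r :: nat
    and d :: "nat \<Rightarrow> nat"
    and \<mu> :: "nat \<Rightarrow> (nat \<Rightarrow> real) measure"
    and h :: "nat \<Rightarrow> nat \<Rightarrow> nat \<Rightarrow> nat \<Rightarrow> real"
    and M :: "nat \<Rightarrow> 'w measure"
    and X :: "nat \<Rightarrow> nat \<Rightarrow> 'w \<Rightarrow> nat \<Rightarrow> nat \<Rightarrow> real"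
    and N :: "'v measure"
    and Z :: "nat set \<Rightarrow> (nat \<Rightarrow> nat \<Rightarrow> real) \<Rightarrow> 'v \<Rightarrow> complex"
  defines "\<T> \<equiv> {S. S \<subseteq> {1..r} \<and> card S \<ge> 2}"
    and "R \<equiv> \<lambda>n \<omega> i. emp_rank n (d i) (h n (d i)) (\<lambda>a. X n a \<omega> i)"
  assumes dims: "\<And>i. i \<in> {1..r} \<Longrightarrow> d i \<ge> 1"
    and mu_prob: "\<And>i. i \<in> {1..r} \<Longrightarrow> prob_space (\<mu> i)"
    and mu_sets: "\<And>i. i \<in> {1..r} \<Longrightarrow> sets (\<mu> i) = sets (eucl (d i))"
    and mu_ac: "\<And>i. i \<in> {1..r} \<Longrightarrow> absolutely_continuous (eucl (d i)) (\<mu> i)"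
    and M_prob: "\<And>n. prob_space (M n)"
    and X_indep: "\<And>n. prob_space.indep_vars (M n) (\<lambda>_. eucl_prod d {1..r}) (X n) {1..n}"
    and X_distr: "\<And>n a. a \<in> {1..n} \<Longrightarrow>
        distr (M n) (eucl_prod d {1..r}) (X n a) = PiM {1..r} \<mu>"
    and grid: "\<And>n i a. i \<in> {1..r} \<Longrightarrow> a \<in> {1..n} \<Longrightarrow>
        h n (d i) a \<in> PiE {..<d i} (\<lambda>_. {0..1})"
    and grid_conv: "\<And>i. i \<in> {1..r} \<Longrightarrow>
        weak_conv_on {..<d i} (\<lambda>n. empirical (d i) n (h n (d i))) (unif_cube (d i))"
    and N_prob: "prob_space N"
    and Z_proc: "\<And>S. S \<in> \<T> \<Longrightarrow> limit_process N d S (Z S)"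
    and Z_indep: "prob_space.indep_vars N (\<lambda>S. PiM (space (eucl_prod d S)) (\<lambda>_. borel))
        (\<lambda>S \<omega>. \<lambda>t\<in>space (eucl_prod d S). Z S t \<omega>) \<T>"
  shows "converges_in_distribution \<T>
           M (\<lambda>n \<omega>. \<lambda>S\<in>\<T>. real n * RdCov2 n d (R n \<omega>) S)
           N (\<lambda>\<omega>. \<lambda>S\<in>\<T>. limit_integral d S (Z S) \<omega>)
       \<and> (\<forall>C :: nat \<Rightarrow> real. (\<forall>s\<in>{2..r}. C s \<ge> 0) \<longrightarrow>
           weak_conv_m
             (\<lambda>n. distr (M n) borel (\<lambda>\<omega>. real n * RJdCov2 n r d C (R n \<omega>)))
             (distr N borel (\<lambda>\<omega>.
                \<Sum>s=2..r. C s * (\<Sum>S\<in>{S. S \<subseteq> {1..r} \<and> card S = s}. limit_integral d S (Z S) \<omega>))))"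
proof -
  let ?I = "{1..r}"
  define g where "g n i = h n (d i)" for n i
  define W where "W \<omega> = (\<lambda>S\<in>\<T>. limit_integral d S (Z S) \<omega>)" for \<omega>
  define V where "V n \<omega> = (\<lambda>S\<in>\<T>. real n * RdCov2 n d (R n \<omega>) S)" for n \<omega>
  define em where "em n = emp_process n d (\<lambda>i. h n (d i))" for n
  define \<Omega> where "\<Omega> n = uniform_count_measure (perm_tuples ?I n)" for n
  define A where "A S = grid_array.moment_bound d S" for S
  \<comment> \<open>\<open>\<mu>\<close> is unconstrained outside \<open>{1..r}\<close>, whereas
    \<open>grid_sample\<close> asks for probability measures at every index; a point mass fills the
    gap.\<close>
  define \<nu> where "\<nu> i = (if i \<in> ?I then \<mu> i else return (count_space UNIV) undefined)" for i
  have fin\<T>: "finite \<T>" unfolding \<T>_def by (rule finite_subset[of _ "Pow ?I"]) auto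
  have S: "S \<subseteq> ?I" "2 \<le> card S" "finite S" "\<forall>i\<in>S. 1 \<le> d i" if "S \<in> \<T>" for S
    using that dims finite_subset[of S ?I] unfolding \<T>_def by (auto simp del: One_nat_def)
  have arr: "grid_array ?I d (\<lambda>i. h n (d i)) n S" if "2 \<le> n" "S \<in> \<T>" for n S
  proof
    show "\<bar>h n (d i) j k\<bar> \<le> 1" if "i \<in> S" "j \<in> {1..n}" "k < d i" for i j k
    proof -
      have "i \<in> ?I" using S(1)[OF \<open>S \<in> \<T>\<close>] that(1) by blast
      then have "h n (d i) j k \<in> {0..1}" using PiE_mem[OF grid[OF _ that(2)], of i k] that(3) by simp
      then show ?thesis by simp
    qed
  qed (use that S[OF that(2)] in auto)
  have reg: "regular_process N d S (Z S) (A S)" if "S \<in> \<T>" for S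
    unfolding A_def
  proof (rule regular_limit[OF N_prob Z_proc[OF that] S(3)[OF that] S(2)[OF that] S(4)[OF that]])
    fix i assume "i \<in> S"
    then have i: "i \<in> ?I" using S(1)[OF that] by blast
    show "weak_conv_on {..<d i} (\<lambda>n. empirical (d i) n (h n (d i))) (unif_cube (d i))" by (rule grid_conv[OF i])
    show "h n (d i) j \<in> PiE {..<d i} (\<lambda>_. {0..1})" if "j \<in> {1..n}" for n j by (rule grid[OF i that])
  qed
  have reg_em: "regular_process (\<Omega> n) d S (em n S) (A S)" if "2 \<le> n" "S \<in> \<T>" for n S
    unfolding \<Omega>_def em_def A_def by (rule grid_array.regular_emp[OF arr[OF that]])
  have sample: "grid_sample ?I d \<nu> (g n) n" if "1 \<le> n" for n
  proof (rule grid_sample.intro)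
    show "prob_space (\<nu> i)" for i
      using mu_prob by (auto simp: \<nu>_def intro!: prob_space_return)
    show "sets (\<nu> i) = sets (eucl (d i))" "absolutely_continuous (eucl (d i)) (\<nu> i)" if "i \<in> ?I" for i
      using mu_sets[OF that] mu_ac[OF that] that by (simp_all add: \<nu>_def)
    show "g n i j \<in> PiE {..<d i} (\<lambda>_. UNIV)" if "i \<in> ?I" "j \<in> {1..n}" for i j
      using grid[OF that] by (auto simp: g_def PiE_iff)
  qed (use that in auto)
  have \<nu>_PiM: "distr (M n) (eucl_prod d ?I) (X n a) = PiM ?I \<nu>" if "a \<in> {1..n}" for n a
    unfolding X_distr[OF that] by (rule PiM_cong) (simp_all add: \<nu>_def)
  let ?\<Psi> = "\<lambda>n R. \<lambda>S\<in>\<T>. real n * RdCov2 n d R S"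
  let ?B = "PiM \<T> (\<lambda>_. borel :: real measure)"
  have \<Psi>_cong: "?\<Psi> n R = ?\<Psi> n R'" if "\<And>i a. i \<in> ?I \<Longrightarrow> a \<in> {1..n} \<Longrightarrow> R i a = R' i a" for n R R'
  proof (rule restrict_ext)
    fix S assume "S \<in> \<T>"
    then have "RdCov2 n d R S = RdCov2 n d R' S" using S(1) that by (intro RdCov2_cong) blast
    then show "real n * RdCov2 n d R S = real n * RdCov2 n d R' S" by simp
  qed
  have \<Psi>_space: "?\<Psi> n R \<in> space ?B" for n R by (simp add: space_PiM)
  have V_eq: "V n \<omega> = ?\<Psi> n (\<lambda>i a. g n i (opt_perm n (d i) (g n i) (\<lambda>a. X n a \<omega> i) a))" for n \<omega>
    by (simp only: V_def R_def emp_rank_def[abs_def] g_def)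
  have V_meas: "V n \<in> measurable (M n) ?B" for n
  \<comment> \<open>For \<open>n = 0\<close> the grid is empty and \<open>grid_sample\<close> does
    not apply; the factor \<open>n\<close> makes the vector 0.\<close>
  proof (cases "n = 0")
    case True
    then have "V n = (\<lambda>_. \<lambda>S\<in>\<T>. 0)" by (simp add: V_def fun_eq_iff)
    then show ?thesis by (simp add: space_PiM)
  next
    case False
    then have n: "1 \<le> n" by simp
    show ?thesis
      unfolding V_eq[abs_def]
      by (rule grid_sample.rank_law(1)[OF sample[OF n] M_prob X_indep \<nu>_PiM \<Psi>_cong \<Psi>_space])
  qed
  \<comment> \<open>Expectations over the data become expectations over uniform permutations, where
    \<open>n * RdCov2\<close> is the integral of the squared empirical process.\<close>
  have law: "integrable (M n) (\<lambda>\<omega>. f (V n \<omega>))"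
    "(\<integral>\<omega>. f (V n \<omega>) \<partial>M n) = (\<integral>\<pi>. f (\<lambda>S\<in>\<T>. limit_integral d S (em n S) \<pi>) \<partial>\<Omega> n)"
    if n: "1 \<le> n" for n and f :: "(nat set \<Rightarrow> real) \<Rightarrow> real"
  proof -
    show "integrable (M n) (\<lambda>\<omega>. f (V n \<omega>))"
      unfolding V_eq
      by (rule grid_sample.rank_law(2)[OF sample[OF n] M_prob X_indep \<nu>_PiM \<Psi>_cong \<Psi>_space])
    have "(\<integral>\<omega>. f (V n \<omega>) \<partial>M n) = avg (perm_tuples ?I n) (\<lambda>\<pi>. f (?\<Psi> n (\<lambda>i a. g n i (\<pi> i a))))"
      unfolding V_eq
      by (rule grid_sample.rank_law(3)[OF sample[OF n] M_prob X_indep \<nu>_PiM \<Psi>_cong \<Psi>_space])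
    also have "\<dots> = avg (perm_tuples ?I n) (\<lambda>\<pi>. f (\<lambda>S\<in>\<T>. limit_integral d S (em n S) \<pi>))"
    proof (intro avg_cong arg_cong[where f = f] restrict_ext)
      fix \<pi> S assume "\<pi> \<in> perm_tuples ?I n" "S \<in> \<T>"
      then show "real n * RdCov2 n d (\<lambda>i a. g n i (\<pi> i a)) S = limit_integral d S (em n S) \<pi>"
        unfolding em_def g_def by (intro RdCov2_eq_limit_integral[OF n _ S(1)])
    qed
    also have "\<dots> = (\<integral>\<pi>. f (\<lambda>S\<in>\<T>. limit_integral d S (em n S) \<pi>) \<partial>\<Omega> n)"
      unfolding \<Omega>_def by (subst integral_uniform_count_measure) (simp_all add: avg_def)
    finally show "(\<integral>\<omega>. f (V n \<omega>) \<partial>M n) = (\<integral>\<pi>. f (\<lambda>S\<in>\<T>. limit_integral d S (em n S) \<pi>) \<partial>\<Omega> n)" .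
  qed
  have W_int: "integrable N (\<lambda>\<omega>. W \<omega> S)" if "S \<in> \<T>" for S
    using regular_process.integrable_limit_integral[OF reg[OF that]] that by (simp add: W_def)
  \<comment> \<open>One bound for the means of all components, empirical and limiting; every summand
    is nonnegative, so each is at most the sum.\<close>
  define K where "K = (\<Sum>S\<in>\<T>. A S * (\<integral>t. weight d S t \<partial>w_prod d S))"
  have K: "A S * (\<integral>t. weight d S t \<partial>w_prod d S) \<le> K" if "S \<in> \<T>" for S
    unfolding K_def using that fin\<T> regular_process.A_nonneg[OF reg]
    by (intro member_le_sum mult_nonneg_nonneg Bochner_Integration.integral_nonneg weight_nonneg) auto
  have conv: "converges_in_distribution \<T> M V N W"
  proof (rule laplace_imp_converges_in_distribution[OF fin\<T> M_prob N_prob V_meas, where ?n0.0 = 2 and K = K])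
    show "W \<in> measurable N ?B"
      unfolding W_def[abs_def]
      using borel_measurable_integrable[OF regular_process.integrable_limit_integral[OF reg]]
      by (intro measurable_restrict) auto
    show "0 \<le> V n \<omega> S" "0 \<le> W \<omega>' S" if "S \<in> \<T>" for n \<omega> \<omega>' S
      using that by (simp_all add: V_def W_def RdCov2_def limit_integral_def)
    show "integrable (M n) (\<lambda>\<omega>. V n \<omega> S)" if "2 \<le> n" for n S
      using law(1)[of n "\<lambda>v. v S"] that by simp
    show "(\<integral>\<omega>. V n \<omega> S \<partial>M n) \<le> K" if "2 \<le> n" "S \<in> \<T>" for n S
      using law(2)[of n "\<lambda>v. v S"] regular_process.integral_limit_integral_le[OF reg_em[OF that]] K[OF that(2)] that
      by simp
    show "integrable N (\<lambda>\<omega>. W \<omega> S)" if "S \<in> \<T>" for S by (rule W_int[OF that])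
    show "(\<integral>\<omega>. W \<omega> S \<partial>N) \<le> K" if "S \<in> \<T>" for S
      using regular_process.integral_limit_integral_le[OF reg[OF that]] K[OF that] that by (simp add: W_def)
    fix p :: "nat set \<Rightarrow> nat"
    have "(\<lambda>n. \<integral>\<pi>. exp (- (\<Sum>S\<in>\<T>. real (p S) * limit_integral d S (em n S) \<pi>)) \<partial>\<Omega> n)
      \<longlonglongrightarrow> (\<integral>\<omega>. exp (- (\<Sum>S\<in>\<T>. real (p S) * limit_integral d S (Z S) \<omega>)) \<partial>N)"
      unfolding em_def \<Omega>_def
    proof (rule emp_laplace_tendsto[OF N_prob])
      show "\<T> \<subseteq> {S. S \<subseteq> ?I \<and> 2 \<le> card S}" by (simp add: \<T>_def)
      show "\<forall>i\<in>?I. 1 \<le> d i" using dims by blast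
      show "regular_process N d S (Z S) (grid_array.moment_bound d S)" if "S \<in> \<T>" for S
        using reg[OF that] by (simp only: A_def)
    qed (fact grid grid_conv Z_proc Z_indep arr finite_atLeastAtMost)+
    moreover have "eventually (\<lambda>n. (\<integral>\<pi>. exp (- (\<Sum>S\<in>\<T>. real (p S) * limit_integral d S (em n S) \<pi>)) \<partial>\<Omega> n)
      = (\<integral>\<omega>. exp (- (\<Sum>S\<in>\<T>. real (p S) * V n \<omega> S)) \<partial>M n)) sequentially"
      using law(2)[of _ "\<lambda>v. exp (- (\<Sum>S\<in>\<T>. real (p S) * v S))"] by (intro eventually_sequentiallyI[of 1]) simp
    ultimately have "(\<lambda>n. \<integral>\<omega>. exp (- (\<Sum>S\<in>\<T>. real (p S) * V n \<omega> S)) \<partial>M n)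
      \<longlonglongrightarrow> (\<integral>\<omega>. exp (- (\<Sum>S\<in>\<T>. real (p S) * limit_integral d S (Z S) \<omega>)) \<partial>N)"
      by (rule Lim_transform_eventually)
    then show "(\<lambda>n. \<integral>\<omega>. exp (- (\<Sum>S\<in>\<T>. real (p S) * V n \<omega> S)) \<partial>M n)
      \<longlonglongrightarrow> (\<integral>\<omega>. exp (- (\<Sum>S\<in>\<T>. real (p S) * W \<omega> S)) \<partial>N)"
      by (simp add: W_def)
  qed
  have "weak_conv_m
      (\<lambda>n. distr (M n) borel (\<lambda>\<omega>. real n * RJdCov2 n r d C (R n \<omega>)))
      (distr N borel (\<lambda>\<omega>.
         \<Sum>s=2..r. C s * (\<Sum>S\<in>{S. S \<subseteq> ?I \<and> card S = s}. limit_integral d S (Z S) \<omega>)))" for C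
  proof -
    \<comment> \<open>Continuous mapping: the weighted statistic is this linear, hence continuous,
      function of the vector, since every index set of size \<open>s >= 2\<close> lies in
      \<open>\<T>\<close>. Composing it with bounded continuous test functions reduces the claim to
      \<open>conv\<close>.\<close>
    define l where "l v = (\<Sum>s=2..r. C s * (\<Sum>S\<in>{S. S \<subseteq> ?I \<and> card S = s}. v S))" for v :: "nat set \<Rightarrow> real"
    have in\<T>: "S \<in> \<T>" if "s \<in> {2..r}" "S \<in> {S. S \<subseteq> ?I \<and> card S = s}" for s S
      using that by (auto simp: \<T>_def)
    have lV: "(\<lambda>\<omega>. real n * RJdCov2 n r d C (R n \<omega>)) = (\<lambda>\<omega>. l (V n \<omega>))" for n
      unfolding l_def RJdCov2_def sum_distrib_left
      by (intro ext sum.cong refl) (simp add: V_def in\<T>)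
    have lW: "(\<lambda>\<omega>. \<Sum>s=2..r. C s * (\<Sum>S\<in>{S. S \<subseteq> ?I \<and> card S = s}. limit_integral d S (Z S) \<omega>)) = (\<lambda>\<omega>. l (W \<omega>))"
      unfolding l_def by (intro ext sum.cong arg_cong2[where f = "(*)"] refl) (simp add: W_def in\<T>)
    have l_cont: "continuous_on B l" for B
      unfolding l_def[abs_def]
      by (intro continuous_intros continuous_on_product_coordinates[THEN continuous_on_subset]) simp
    have l_meas: "l \<in> borel_measurable ?B"
      by (rule continuous_imp_measurable_PiM[OF fin\<T> l_cont])
    have W_meas: "W \<in> measurable N ?B" using conv by (simp add: converges_in_distribution_def)
    have dV: "real_distribution (distr (M n) borel (\<lambda>\<omega>. l (V n \<omega>)))" for n
      by (rule prob_space.real_distribution_distr[OF M_prob measurable_compose[OF V_meas l_meas]])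
    have dW: "real_distribution (distr N borel (\<lambda>\<omega>. l (W \<omega>)))"
      by (rule prob_space.real_distribution_distr[OF N_prob measurable_compose[OF W_meas l_meas]])
    show ?thesis
      unfolding lV lW
    proof (rule integral_bdd_continuous_conv_imp_weak_conv[OF dV dW])
      fix f :: "real \<Rightarrow> real" assume f: "\<And>x. isCont f x" "\<And>x. \<bar>f x\<bar> \<le> 1"
      have f_cont: "continuous_on UNIV f" using f(1) by (simp add: continuous_at_imp_continuous_on)
      have fm: "f \<in> borel_measurable borel" by (rule borel_measurable_continuous_onI[OF f_cont])
      have "continuous_on (PiE \<T> (\<lambda>_. UNIV)) (\<lambda>v. f (l v))"
        by (rule continuous_on_compose2[OF f_cont l_cont]) simp
      moreover have "bounded ((\<lambda>v. f (l v)) ` PiE \<T> (\<lambda>_. UNIV))"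
        unfolding bounded_iff using f(2) by (intro exI[of _ 1]) auto
      ultimately have lim: "(\<lambda>n. \<integral>v. f (l v) \<partial>distr (M n) ?B (V n)) \<longlonglongrightarrow> (\<integral>v. f (l v) \<partial>distr N ?B W)"
        using conv unfolding converges_in_distribution_def weak_conv_on_def by blast
      have "(\<integral>v. f (l v) \<partial>distr P ?B U) = (\<integral>x. f x \<partial>distr P borel (\<lambda>\<omega>. l (U \<omega>)))"
        if "U \<in> measurable P ?B" for P :: "'z measure" and U
        using integral_distr[OF that measurable_compose[OF l_meas fm]]
          integral_distr[OF measurable_compose[OF that l_meas] fm] by simp
      from lim[unfolded this[OF V_meas] this[OF W_meas]]
      show "(\<lambda>n. integral\<^sup>L (distr (M n) borel (\<lambda>\<omega>. l (V n \<omega>))) f) \<longlonglongrightarrow> integral\<^sup>L (distr N borel (\<lambda>\<omega>. l (W \<omega>))) f" .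
    qed
  qed
  with conv show ?thesis by (simp only: V_def[abs_def] W_def[abs_def]) blast
qed

end
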